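(* Let $k\ge1$ and let $(M_N)_{N\ge1}$ be a sequence of random tensors $M_N\in(\mathbb C^N)^{\otimes 2k}$ satisfying Hypothesis (H) with parameter $(c,c')$. Then there exist a $\mathfrak S_k^*$-probability space $(\mathcal A,\mathbb C\mathfrak S_k,\mathcal E)$ and a family $\mathbf m=(m_\sigma)_{\sigma\in\mathfrak S_{2k}}$ in $\mathcal A$ such that the family of flattenings $(M_{N,\sigma})_{\sigma\in\mathfrak S_{2k}}$ converges in $\mathfrak S_k^*$-distribution to $\mathbf m$, the family $\mathbf m$ is centered and $\mathfrak S_k$-circular, and for all $\sigma,\sigma'\in\mathfrak S_{2k}$ and all $\eta\in\mathfrak S_k$: $$\mathcal E(m_\sigma u_\eta m_{\sigma'}^* )=\begin{cases} c\,u_{\eta'} & \text{if there is } \eta'\in\mathfrak S_k \text{ with } \sigma=(\eta'\sqcup\eta)\sigma',\\ 0&\text{otherwise,}\end{cases}$$ $$\mathcal E(m_\sigma^* u_\eta m_{\sigma'})=\begin{cases} c\,u_{\eta'} & \text{if there is } \eta'\in\mathfrak S_k \text{ with } \sigma=(\eta\sqcup\eta')\sigma',\\ 0&\text{otherwise,}\end{cases}$$ $$\mathcal E(m_\sigma u_\eta m_{\sigma'})=\begin{cases} c'\,u_{\eta'} & \text{if there is } \eta'\in\mathfrak S_k \text{ with } \sigma=\tau(\eta\sqcup\eta')\sigma',\\ 0&\text{otherwise.}\end{cases}$$ (In each case such an $\eta'$ is unique when it exists.)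
   Context: Fix an integer $k\ge1$; $[n]=\{1,\dots,n\}$; $\mathfrak S_n$ is the symmetric group on $[n]$. A tensor $M_N\in(\mathbb C^N)^{\otimes 2k}$ is an array $(M_N(i_1,\dots,i_{2k}))_{i_j\in[N]}$. Matrices in $\mathrm M_{N^k}(\mathbb C)\cong\mathrm{End}((\mathbb C^N)^{\otimes k})$ are indexed by pairs $(\mathbf i,\mathbf i')\in[N]^k\times[N]^k$. For $\sigma\in\mathfrak S_{2k}$ the flattening $M_{N,\sigma}\in\mathrm M_{N^k}(\mathbb C)$ is defined by $M_{N,\sigma}((i_1,\dots,i_k),(i_{k+1},\dots,i_{2k}))=M_N(i_{\sigma(1)},\dots,i_{\sigma(2k)})$. Hypothesis (H) with parameter $(c,c')$: for each $N$ the entries of $M_N$ are i.i.d., distributed as a centered complex random variable $m_N$ with finite moments of all orders, and $N^k\mathbb E|m_N|^2\to c>0$, $N^k\mathbb E[m_N^2]\to c'\in\mathbb C$, and $N^k\mathbb E[m_N^{\ell_1}\overline{m_N}^{\ell_2}]\to0$ for all nonnegative integers $\ell_1,\ell_2$ with $\ell_1+\ell_2>2$. For $\eta\in\mathfrak S_k$, $U_{N,\eta}\in\mathrm M_{N^k}(\mathbb C)$ is the unitary with $U_{N,\eta}(v_1\otimes\cdots\otimes v_k)=v_{\eta^{-1}(1)}\otimes\cdots\otimes v_{\eta^{-1}(k)}$ (so $U_{N,\eta}U_{N,\eta'}=U_{N,\eta\eta'}$, $U_{N,\eta}^*=U_{N,\eta^{-1}}$). $\mathbb C\mathfrak S_{N,k}$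 is the span of the $U_{N,\eta}$. For a random matrix $A$ with integrable entries, $\Phi_N(A)=\mathbb E[N^{-k}\mathrm{Tr}A]$ and $\mathcal E_N(A)=\sum_{\eta\in\mathfrak S_k}\Phi_N(AU_{N,\eta}^* )U_{N,\eta}$. $\mathbb C\mathfrak S_k$ is the group algebra with basis $(u_\eta)_{\eta\in\mathfrak S_k}$, $u_\eta u_{\eta'}=u_{\eta\eta'}$, $u_\eta^*=u_{\eta^{-1}}$. For $N\ge k$ every $B_N\in\mathbb C\mathfrak S_{N,k}$ writes uniquely $B_N=\sum_\eta B_N(\eta)U_{N,\eta}$; $B_N\to b=\sum_\eta b(\eta)u_\eta$ means $B_N(\eta)\to b(\eta)$ for all $\eta$. A $\mathfrak S_k^*$-probability space $(\mathcal A,\mathbb C\mathfrak S_k,\mathcal E)$: $\mathcal A$ is a unital $*$-algebra containing $\mathbb C\mathfrak S_k$ as a unital $*$-subalgebra, and $\mathcal E:\mathcal A\to\mathbb C\mathfrak S_k$ is a completely positive unital linear map with $\mathcal E(bab')=b\mathcal E(a)b'$ for $b,b'\in\mathbb C\mathfrak S_k$. A family $(M_{N,j})_{j\in J}$ of random matrices in $\mathrm M_{N^k}(\mathbb C)$ (entries with all moments finite) converges in $\mathfrak S_k^*$-distribution to $(m_j)_{j\in J}\subset\mathcal A$ if for all $L\ge1$, $j_\ell\in J$, $\varepsilon_\ell\in\{1,*\}$, $\eta_\ell\in\mathfrak S_k$: $\mathcal E_N(M_{N,j_1}^{\varepsilon_1}U_{N,\eta_1}\cdots M_{N,j_L}^{\varepsilon_L}U_{N,\eta_L})\to\mathcal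 E(m_{j_1}^{\varepsilon_1}u_{\eta_1}\cdots m_{j_L}^{\varepsilon_L}u_{\eta_L})$ (here $X^1=X$). Non-crossing extension: given multilinear maps $\mathcal M_n:\mathcal A^n\to\mathbb C\mathfrak S_k$, for a non-crossing partition $\xi$ of $[n]$ define $\mathcal M_\xi$ recursively: if $\xi=\{[n]\}$, $\mathcal M_\xi=\mathcal M_n$; otherwise let $B=\{i,\dots,i+n'-1\}$ be the block of $\xi$ consisting of consecutive integers with smallest $i$, and set $\mathcal M_\xi(a_1,\dots,a_n)=\mathcal M_{\xi\setminus B}(a_1,\dots,a_{i-1}\mathcal M_{n'}(a_i,\dots,a_{i+n'-1}),a_{i+n'},\dots,a_n)$ if $i>1$, resp. $\mathcal M_{\xi\setminus B}(\mathcal M_{n'}(a_1,\dots,a_{n'})a_{n'+1},a_{n'+2},\dots,a_n)$ if $i=1$, where $\xi\setminus B$ is obtained by deleting $B$ and relabelling increasingly. The $\mathfrak S_k$-free cumulants are the unique multilinear maps $\mathcal K_n:\mathcal A^n\to\mathbb C\mathfrak S_k$ with $\mathcal E(a_1\cdots a_n)=\sum_{\xi\in\mathrm{NC}(n)}\mathcal K_\xi(a_1,\dots,a_n)$ for all $n\ge1$ ($\mathrm{NC}(n)$: non-crossing partitions of $[n]$). A family $(m_j)_{j\in J}$ is centered if $\mathcal E(m_j)=0$ for all $j$, and $\mathfrak S_k$-circular if $\mathcal K_L(m_{j_1}^{\varepsilon_1}b_1,\dots,m_{j_L}^{\varepsilon_L}b_L)=0$ for all $L\ge3$, $j_\ell\in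 J$, $\varepsilon_\ell\in\{1,*\}$, $b_\ell\in\mathbb C\mathfrak S_k$. For $\eta,\eta'\in\mathfrak S_k$, $\eta\sqcup\eta'\in\mathfrak S_{2k}$ is $i\mapsto\eta(i)$ for $i\in[k]$ and $i\mapsto\eta'(i-k)+k$ for $i\in[2k]\setminus[k]$. $\tau\in\mathfrak S_{2k}$ is $i\mapsto i+k$ for $i\in[k]$, $i\mapsto i-k$ for $i\in[2k]\setminus[k]$. *)

theory Defs
  imports "HOL-Probability.Probability"
begin

type_synonym perm = "nat \<Rightarrow> nat"
type_synonym cs = "perm \<Rightarrow> complex"   (* b = sum_eta b(eta) u_eta, stored as its coefficient function *)
type_synonym idx = "nat \<Rightarrow> nat"     (* multi-indices (i_1,...,i_n), extensional on {1..n} *)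
type_synonym mat = "idx \<Rightarrow> idx \<Rightarrow> complex"  (* matrices in M_{N^k}(C), indexed by pairs of k-tuples *)

definition Sym :: "nat \<Rightarrow> perm set" where
  "Sym n = {p. p permutes {1..n}}"

definition CSk :: "nat \<Rightarrow> cs set" where
  "CSk k = {b. \<forall>\<eta>. \<eta> \<notin> Sym k \<longrightarrow> b \<eta> = 0}"

definition cs_u :: "perm \<Rightarrow> cs" where
  "cs_u \<eta> = (\<lambda>\<rho>. if \<rho> = \<eta> then 1 else 0)"

definition cs_zero :: cs where
  "cs_zero = (\<lambda>_. 0)"

definition cs_add :: "cs \<Rightarrow> cs \<Rightarrow> cs" where
  "cs_add b b' = (\<lambda>\<eta>. b \<eta> + b' \<eta>)"

definition cs_smult :: "complex \<Rightarrow> cs \<Rightarrow> cs" where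
  "cs_smult z b = (\<lambda>\<eta>. z * b \<eta>)"

definition cs_sum :: "('i \<Rightarrow> cs) \<Rightarrow> 'i set \<Rightarrow> cs" where
  "cs_sum f S = (\<lambda>\<eta>. \<Sum>i\<in>S. f i \<eta>)"

text \<open>u_rho u_rho' = u_(rho o rho'), u_eta^* = u_(eta^-1).\<close>
definition cs_mul :: "nat \<Rightarrow> cs \<Rightarrow> cs \<Rightarrow> cs" where
  "cs_mul k b b' = (\<lambda>\<eta>. if \<eta> \<in> Sym k then (\<Sum>\<rho>\<in>Sym k. b \<rho> * b' (inv \<rho> \<circ> \<eta>)) else 0)"

definition cs_star :: "nat \<Rightarrow> cs \<Rightarrow> cs" where
  "cs_star k b = (\<lambda>\<eta>. if \<eta> \<in> Sym k then cnj (b (inv \<eta>)) else 0)"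

definition cs_pos :: "nat \<Rightarrow> cs \<Rightarrow> bool" where
  "cs_pos k x \<longleftrightarrow> (\<exists>c\<in>CSk k. x = cs_mul k (cs_star k c) c)"

record 'a salg =
  a_carrier :: "'a set"
  a_zero :: 'a
  a_one :: 'a
  a_add :: "'a \<Rightarrow> 'a \<Rightarrow> 'a"
  a_smult :: "complex \<Rightarrow> 'a \<Rightarrow> 'a"
  a_mul :: "'a \<Rightarrow> 'a \<Rightarrow> 'a"
  a_star :: "'a \<Rightarrow> 'a"
  a_emb :: "cs \<Rightarrow> 'a"   (* the inclusion of C S_k as unital *-subalgebra *)

definition star_algebra :: "'a salg \<Rightarrow> bool" where
  "star_algebra A \<longleftrightarrow>
    (let C = a_carrier A; add = a_add A; sm = a_smult A; mul = a_mul A; st = a_star A;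
         z = a_zero A; one = a_one A in
     z \<in> C \<and> one \<in> C \<and>
     (\<forall>x\<in>C. \<forall>y\<in>C. add x y \<in> C \<and> mul x y \<in> C) \<and>
     (\<forall>a. \<forall>x\<in>C. sm a x \<in> C) \<and> (\<forall>x\<in>C. st x \<in> C) \<and>
     (\<forall>x\<in>C. \<forall>y\<in>C. \<forall>w\<in>C. add (add x y) w = add x (add y w)) \<and>
     (\<forall>x\<in>C. \<forall>y\<in>C. add x y = add y x) \<and>
     (\<forall>x\<in>C. add z x = x) \<and>
     (\<forall>x\<in>C. add x (sm (-1) x) = z) \<and>
     (\<forall>a b. \<forall>x\<in>C. sm a (sm b x) = sm (a * b) x) \<and>
     (\<forall>x\<in>C. sm 1 x = x) \<and>
     (\<forall>a. \<forall>x\<in>C. \<forall>y\<in>C. sm a (add x y) = add (sm a x) (sm a y)) \<and>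
     (\<forall>a b. \<forall>x\<in>C. sm (a + b) x = add (sm a x) (sm b x)) \<and>
     (\<forall>x\<in>C. \<forall>y\<in>C. \<forall>w\<in>C. mul (mul x y) w = mul x (mul y w)) \<and>
     (\<forall>x\<in>C. mul one x = x \<and> mul x one = x) \<and>
     (\<forall>x\<in>C. \<forall>y\<in>C. \<forall>w\<in>C. mul x (add y w) = add (mul x y) (mul x w)
                         \<and> mul (add x y) w = add (mul x w) (mul y w)) \<and>
     (\<forall>a. \<forall>x\<in>C. \<forall>y\<in>C. mul (sm a x) y = sm a (mul x y) \<and> mul x (sm a y) = sm a (mul x y)) \<and>
     (\<forall>x\<in>C. st (st x) = x) \<and>
     (\<forall>x\<in>C. \<forall>y\<in>C. st (add x y) = add (st x) (st y)) \<and>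
     (\<forall>a. \<forall>x\<in>C. st (sm a x) = sm (cnj a) (st x)) \<and>
     (\<forall>x\<in>C. \<forall>y\<in>C. st (mul x y) = mul (st y) (st x)))"

definition Sk_prob_space :: "nat \<Rightarrow> 'a salg \<Rightarrow> ('a \<Rightarrow> cs) \<Rightarrow> bool" where
  "Sk_prob_space k A E \<longleftrightarrow> star_algebra A \<and>
    (let C = a_carrier A; add = a_add A; sm = a_smult A; mul = a_mul A; st = a_star A;
         one = a_one A; emb = a_emb A in
     \<comment> \<open>C S_k is a unital *-subalgebra (via the injective unital *-homomorphism emb)\<close>
     (\<forall>b\<in>CSk k. emb b \<in> C) \<and> inj_on emb (CSk k) \<and> emb (cs_u id) = one \<and>
     (\<forall>b\<in>CSk k. \<forall>b'\<in>CSk k. emb (cs_add b b') = add (emb b) (emb b')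
                             \<and> emb (cs_mul k b b') = mul (emb b) (emb b')) \<and>
     (\<forall>a. \<forall>b\<in>CSk k. emb (cs_smult a b) = sm a (emb b)) \<and>
     (\<forall>b\<in>CSk k. emb (cs_star k b) = st (emb b)) \<and>
     \<comment> \<open>E : A -> C S_k linear, unital, C S_k-bimodule map\<close>
     (\<forall>x\<in>C. E x \<in> CSk k) \<and>
     (\<forall>x\<in>C. \<forall>y\<in>C. E (add x y) = cs_add (E x) (E y)) \<and>
     (\<forall>a. \<forall>x\<in>C. E (sm a x) = cs_smult a (E x)) \<and>
     E one = cs_u id \<and>
     (\<forall>b\<in>CSk k. \<forall>b'\<in>CSk k. \<forall>x\<in>C.
        E (mul (mul (emb b) x) (emb b')) = cs_mul k (cs_mul k b (E x)) b') \<and>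
     \<comment> \<open>complete positivity\<close>
     (\<forall>(n::nat) a b. (\<forall>i<n. a i \<in> C \<and> b i \<in> CSk k) \<longrightarrow>
        cs_pos k (cs_sum (\<lambda>(i, j). cs_mul k (cs_mul k (cs_star k (b i)) (E (mul (st (a i)) (a j)))) (b j))
                         ({..<n} \<times> {..<n}))))"

definition a_prod :: "'a salg \<Rightarrow> 'a list \<Rightarrow> 'a" where
  "a_prod A as = foldr (a_mul A) as (a_one A)"

definition a_pw :: "'a salg \<Rightarrow> bool \<Rightarrow> 'a \<Rightarrow> 'a" where
  "a_pw A e x = (if e then a_star A x else x)"

definition NC :: "nat \<Rightarrow> nat set set set" where
  "NC n = {\<xi>. partition_on {1..n} \<xi> \<and>
     (\<forall>B\<in>\<xi>. \<forall>B'\<in>\<xi>. B \<noteq> B' \<longrightarrow>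
        \<not> (\<exists>a b c d. a < b \<and> b < c \<and> c < d \<and> a \<in> B \<and> c \<in> B \<and> b \<in> B' \<and> d \<in> B'))}"

definition first_interval_block :: "nat set set \<Rightarrow> nat set" where
  "first_interval_block \<xi> =
    (let I = {B\<in>\<xi>. \<exists>i n'. 1 \<le> n' \<and> B = {i..<i+n'}} in
     THE B. B \<in> I \<and> (\<forall>B'\<in>I. Min B \<le> Min B'))"

text \<open>Recursive definition of M_xi (the fuel is the number of blocks).
  Lists are 0-indexed: as ! (j-1) is a_j.\<close>
fun ncx :: "nat \<Rightarrow> 'a salg \<Rightarrow> (nat \<Rightarrow> 'a list \<Rightarrow> cs) \<Rightarrow> nat set set \<Rightarrow> 'a list \<Rightarrow> cs" where
  "ncx 0 A K \<xi> as = cs_zero"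
| "ncx (Suc m) A K \<xi> as =
    (if \<xi> = {{1..length as}} then K (length as) as else
     (let B = first_interval_block \<xi>; i = Min B; n' = card B;
          inner = a_emb A (K n' (take n' (drop (i - 1) as)));
          as' = (if i = 1 then a_mul A inner (as ! n') # drop (n' + 1) as
                 else take (i - 2) as @ [a_mul A (as ! (i - 2)) inner] @ drop (i - 1 + n') as);
          \<xi>' = (\<lambda>B'. (\<lambda>j. if j < i then j else j - n') ` B') ` (\<xi> - {B})
      in ncx m A K \<xi>' as'))"

definition nc_ext :: "'a salg \<Rightarrow> (nat \<Rightarrow> 'a list \<Rightarrow> cs) \<Rightarrow> nat set set \<Rightarrow> 'a list \<Rightarrow> cs" where
  "nc_ext A K \<xi> as = ncx (card \<xi>) A K \<xi> as"

text \<open>K is the family of S_k-free cumulants: the (unique) family satisfying the moment-cumulant formula.\<close>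
definition is_Sk_cumulants :: "'a salg \<Rightarrow> ('a \<Rightarrow> cs) \<Rightarrow> (nat \<Rightarrow> 'a list \<Rightarrow> cs) \<Rightarrow> bool" where
  "is_Sk_cumulants A E K \<longleftrightarrow>
    (\<forall>n\<ge>1. \<forall>as. length as = n \<and> set as \<subseteq> a_carrier A \<longrightarrow>
       E (a_prod A as) = cs_sum (\<lambda>\<xi>. nc_ext A K \<xi> as) (NC n))"

definition Sk_centered :: "'a salg \<Rightarrow> ('a \<Rightarrow> cs) \<Rightarrow> 'j set \<Rightarrow> ('j \<Rightarrow> 'a) \<Rightarrow> bool" where
  "Sk_centered A E J m \<longleftrightarrow> (\<forall>j\<in>J. E (m j) = cs_zero)"

definition Sk_circular :: "nat \<Rightarrow> 'a salg \<Rightarrow> ('a \<Rightarrow> cs) \<Rightarrow> 'j set \<Rightarrow> ('j \<Rightarrow> 'a) \<Rightarrow> bool" where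
  "Sk_circular k A E J m \<longleftrightarrow>
    (\<exists>K. is_Sk_cumulants A E K) \<and>
    (\<forall>K. is_Sk_cumulants A E K \<longrightarrow>
      (\<forall>L\<ge>3. \<forall>js eps b. (\<forall>l<L. js l \<in> J \<and> b l \<in> CSk k) \<longrightarrow>
         K L (map (\<lambda>l. a_mul A (a_pw A (eps l) (m (js l))) (a_emb A (b l))) [0..<L]) = cs_zero))"

definition Jset :: "nat \<Rightarrow> nat \<Rightarrow> idx set" where
  "Jset k N = PiE {1..k} (\<lambda>_. {1..N})"

definition Iset :: "nat \<Rightarrow> nat \<Rightarrow> idx set" where
  "Iset k N = PiE {1..2*k} (\<lambda>_. {1..N})"

text \<open>U_eta (v_1 x ... x v_k) = v_(eta^-1 1) x ... x v_(eta^-1 k).\<close>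
definition Umat :: "nat \<Rightarrow> perm \<Rightarrow> mat" where
  "Umat k \<eta> = (\<lambda>i j. if \<forall>l\<in>{1..k}. i l = j (inv \<eta> l) then 1 else 0)"

definition mmul :: "nat \<Rightarrow> nat \<Rightarrow> mat \<Rightarrow> mat \<Rightarrow> mat" where
  "mmul k N X Y = (\<lambda>i j. \<Sum>l\<in>Jset k N. X i l * Y l j)"

definition madj :: "mat \<Rightarrow> mat" where
  "madj X = (\<lambda>i j. cnj (X j i))"

definition mid :: mat where
  "mid = (\<lambda>i j. if i = j then 1 else 0)"

definition mtr :: "nat \<Rightarrow> nat \<Rightarrow> mat \<Rightarrow> complex" where
  "mtr k N X = (\<Sum>i\<in>Jset k N. X i i)"

definition mprod :: "nat \<Rightarrow> nat \<Rightarrow> mat list \<Rightarrow> mat" where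
  "mprod k N Xs = foldr (mmul k N) Xs mid"

definition m_pw :: "bool \<Rightarrow> mat \<Rightarrow> mat" where
  "m_pw e X = (if e then madj X else X)"

definition PhiN :: "nat \<Rightarrow> nat \<Rightarrow> 'w measure \<Rightarrow> ('w \<Rightarrow> mat) \<Rightarrow> complex" where
  "PhiN k N Q X = integral\<^sup>L Q (\<lambda>\<omega>. mtr k N (X \<omega>) / of_nat N ^ k)"

definition EN :: "nat \<Rightarrow> nat \<Rightarrow> 'w measure \<Rightarrow> ('w \<Rightarrow> mat) \<Rightarrow> mat" where
  "EN k N Q X = (\<lambda>i j. \<Sum>\<eta>\<in>Sym k. PhiN k N Q (\<lambda>\<omega>. mmul k N (X \<omega>) (madj (Umat k \<eta>))) * Umat k \<eta> i j)"

text \<open>Coefficients B_N(eta) of B_N = sum_eta B_N(eta) U_(N,eta) (unique for N >= k).\<close>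
definition CSN_coeff :: "nat \<Rightarrow> nat \<Rightarrow> mat \<Rightarrow> cs" where
  "CSN_coeff k N B = (THE f. f \<in> CSk k \<and>
     (\<forall>i\<in>Jset k N. \<forall>j\<in>Jset k N. B i j = (\<Sum>\<eta>\<in>Sym k. f \<eta> * Umat k \<eta> i j)))"

definition conv_CS :: "nat \<Rightarrow> (nat \<Rightarrow> mat) \<Rightarrow> cs \<Rightarrow> bool" where
  "conv_CS k B b \<longleftrightarrow> (\<forall>\<eta>\<in>Sym k. (\<lambda>N. CSN_coeff k N (B N) \<eta>) \<longlonglongrightarrow> b \<eta>)"

definition conv_Sk_distr :: "nat \<Rightarrow> (nat \<Rightarrow> 'w measure) \<Rightarrow> ('j \<Rightarrow> nat \<Rightarrow> 'w \<Rightarrow> mat) \<Rightarrow> 'j set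
      \<Rightarrow> 'a salg \<Rightarrow> ('a \<Rightarrow> cs) \<Rightarrow> ('j \<Rightarrow> 'a) \<Rightarrow> bool" where
  "conv_Sk_distr k Q X J A E m \<longleftrightarrow>
    (\<forall>L\<ge>1. \<forall>js eps eta. (\<forall>l<L. js l \<in> J \<and> eta l \<in> Sym k) \<longrightarrow>
       conv_CS k
         (\<lambda>N. EN k N (Q N) (\<lambda>\<omega>. mprod k N
               (map (\<lambda>l. mmul k N (m_pw (eps l) (X (js l) N \<omega>)) (Umat k (eta l))) [0..<L])))
         (E (a_prod A (map (\<lambda>l. a_mul A (a_pw A (eps l) (m (js l))) (a_emb A (cs_u (eta l)))) [0..<L]))))"

text \<open>M_(N,sigma)((i_1..i_k),(i_(k+1)..i_2k)) = M_N(i_sigma(1),...,i_sigma(2k)).\<close>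
definition flattening :: "nat \<Rightarrow> perm \<Rightarrow> (idx \<Rightarrow> complex) \<Rightarrow> mat" where
  "flattening k \<sigma> T = (\<lambda>r s. T (\<lambda>p\<in>{1..2*k}. (\<lambda>q. if q \<le> k then r q else s (q - k)) (\<sigma> p)))"

text \<open>A fixed index (1,...,1); by identical distribution m_N is distributed as this entry.\<close>
definition ent0 :: "nat \<Rightarrow> idx" where
  "ent0 k = (\<lambda>j\<in>{1..2*k}. 1)"

definition Hyp_H :: "nat \<Rightarrow> (nat \<Rightarrow> 'w measure) \<Rightarrow> (nat \<Rightarrow> 'w \<Rightarrow> idx \<Rightarrow> complex) \<Rightarrow> real \<Rightarrow> complex \<Rightarrow> bool" where
  "Hyp_H k P M c c' \<longleftrightarrow>
    c > 0 \<and>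
    (\<forall>N\<ge>1. prob_space (P N) \<and>
       prob_space.indep_vars (P N) (\<lambda>_. borel) (\<lambda>i \<omega>. M N \<omega> i) (Iset k N) \<and>
       (\<forall>i\<in>Iset k N. distr (P N) borel (\<lambda>\<omega>. M N \<omega> i) = distr (P N) borel (\<lambda>\<omega>. M N \<omega> (ent0 k))) \<and>
       (\<forall>p::nat. integrable (P N) (\<lambda>\<omega>. cmod (M N \<omega> (ent0 k)) ^ p)) \<and>
       integral\<^sup>L (P N) (\<lambda>\<omega>. M N \<omega> (ent0 k)) = 0) \<and>
    (\<lambda>N. real N ^ k * integral\<^sup>L (P N) (\<lambda>\<omega>. cmod (M N \<omega> (ent0 k)) ^ 2)) \<longlonglongrightarrow> c \<and>
    (\<lambda>N. of_nat N ^ k * integral\<^sup>L (P N) (\<lambda>\<omega>. M N \<omega> (ent0 k) ^ 2)) \<longlonglongrightarrow> c' \<and>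
    (\<forall>l1 l2::nat. l1 + l2 > 2 \<longrightarrow>
       (\<lambda>N. of_nat N ^ k * integral\<^sup>L (P N) (\<lambda>\<omega>. M N \<omega> (ent0 k) ^ l1 * cnj (M N \<omega> (ent0 k)) ^ l2))
         \<longlonglongrightarrow> 0)"

definition djs :: "nat \<Rightarrow> perm \<Rightarrow> perm \<Rightarrow> perm" where
  "djs k \<eta> \<eta>' = (\<lambda>i. if 1 \<le> i \<and> i \<le> k then \<eta> i
                     else if k < i \<and> i \<le> 2*k then \<eta>' (i - k) + k else i)"

definition tau :: "nat \<Rightarrow> perm" where
  "tau k = (\<lambda>i. if 1 \<le> i \<and> i \<le> k then i + k else if k < i \<and> i \<le> 2*k then i - k else i)"

definition case_val :: "nat \<Rightarrow> complex \<Rightarrow> (perm \<Rightarrow> bool) \<Rightarrow> cs \<Rightarrow> bool" where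
  "case_val k c cond x \<longleftrightarrow>
     (\<forall>\<eta>'\<in>Sym k. cond \<eta>' \<longrightarrow> x = cs_smult c (cs_u \<eta>')) \<and>
     ((\<not> (\<exists>\<eta>'\<in>Sym k. cond \<eta>')) \<longrightarrow> x = cs_zero)"

end

theory Submission
  imports Defs "HOL-Computational_Algebra.Fundamental_Theorem_Algebra"
begin

text \<open>Expanding a normalised trace of a word in the flattenings over index paths and sorting the paths by
  the partition of positions carrying equal tensor entries, a partition with blocks not all of size two
  has vanishing weight, and a pairing contributes in the limit only if it can be reduced by repeatedly
  removing an adjacent pair whose two permutations are compatible: a pair closed too late, or an
  incompatible one, identifies two free coordinates and costs a factor \<open>N\<close>. Removing a compatible pair
  leaves a permutation matrix, which is exactly how the nested maps of a non-crossing partition are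
  evaluated, so the limit satisfies the moment-cumulant formula with cumulants of order two only.
  The algebra is the algebra of a monoid of formal words; its expectation is read off the limiting trace,
  whose positivity is inherited from the matrices, and complete positivity follows because positive
  definite functions on a finite group are squares in the group algebra.\<close>

section \<open>The star-algebra of a star-monoid\<close>

text \<open>Circularity quantifies over every family of maps satisfying the moment-cumulant formula.
  So cumulants must exist on the whole algebra, which recursion on the order gives, and they must
  vanish on the arguments that occur. The latter is argued inside the bimodule spanned by one-letter
  words: it contains all \<open>m^\<epsilon> b\<close>, and multiplying a neighbour by an inner
  cumulant stays inside it, although products of two letters leave it. Both sides are multilinear
  there, so they need comparing only on scaled basis words, where an inner covariance is a multiple
  of one permutation and contraction maps basis words to basis words. The formal algebra is not
  divided by the null space of the trace: complete positivity asks for squares in the group algebra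
  only, where the coefficient at the identity is faithful, and a polynomial functional calculus
  produces the square root. Different formal words may have equal matrices; the trace sees only the
  matrices, which permits moving a permutation into a neighbouring letter.\<close>

definition supp :: "('m \<Rightarrow> complex) \<Rightarrow> 'm set" where
  "supp f = {m. f m \<noteq> 0}"

definition finsupp :: "'m set \<Rightarrow> ('m \<Rightarrow> complex) set" where
  "finsupp G = {f. finite (supp f) \<and> supp f \<subseteq> G}"

text \<open>The value at \<open>f\<close> of the linear extension of \<open>\<phi>\<close>. Pairing
  with all \<open>\<phi>\<close> separates finitely supported functions, so identities in the
  algebra are checked as identities between iterated sums.\<close>

definition lp :: "('m \<Rightarrow> complex) \<Rightarrow> ('m \<Rightarrow> complex) \<Rightarrow> complex" where
  "lp f \<phi> = (\<Sum>m\<in>supp f. f m * \<phi> m)"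

definition delta :: "'m \<Rightarrow> 'm \<Rightarrow> complex" where
  "delta m = (\<lambda>x. if x = m then 1 else 0)"

definition f_add :: "('m \<Rightarrow> complex) \<Rightarrow> ('m \<Rightarrow> complex) \<Rightarrow> 'm \<Rightarrow> complex" where
  "f_add f g = (\<lambda>m. f m + g m)"

definition f_smult :: "complex \<Rightarrow> ('m \<Rightarrow> complex) \<Rightarrow> 'm \<Rightarrow> complex" where
  "f_smult a f = (\<lambda>m. a * f m)"

lemma lp_superset:
  assumes "finite S" "supp f \<subseteq> S"
  shows "lp f \<phi> = (\<Sum>m\<in>S. f m * \<phi> m)"
  unfolding lp_def by (rule sum.mono_neutral_left) (use assms in \<open>auto simp: supp_def\<close>)

lemma supp_delta: "supp (delta m) = {m}"
  by (auto simp: supp_def delta_def)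

lemma supp_add: "supp (f_add f g) \<subseteq> supp f \<union> supp g"
  by (auto simp: supp_def f_add_def)

lemma supp_smult: "supp (f_smult a f) \<subseteq> supp f"
  by (auto simp: supp_def f_smult_def)

lemma finsupp_zero [simp]: "(\<lambda>_. 0) \<in> finsupp G"
  by (simp add: finsupp_def supp_def)

lemma finsupp_delta [simp]: "m \<in> G \<Longrightarrow> delta m \<in> finsupp G"
  by (simp add: finsupp_def supp_delta)

lemma finsupp_add [simp]: "f \<in> finsupp G \<Longrightarrow> g \<in> finsupp G \<Longrightarrow> f_add f g \<in> finsupp G"
  using supp_add[of f g] unfolding finsupp_def by (auto intro: finite_subset)

lemma finsupp_smult [simp]: "f \<in> finsupp G \<Longrightarrow> f_smult a f \<in> finsupp G"
  using supp_smult[of a f] unfolding finsupp_def by (auto intro: finite_subset)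

lemma lp_zero [simp]: "lp (\<lambda>_. 0) \<phi> = 0"
  by (simp add: lp_def)

lemma lp_delta [simp]: "lp (delta m) \<phi> = \<phi> m"
  by (simp add: lp_def supp_delta) (simp add: delta_def)

lemma lp_add [simp]:
  assumes "f \<in> finsupp G" "g \<in> finsupp G"
  shows "lp (f_add f g) \<phi> = lp f \<phi> + lp g \<phi>"
proof -
  let ?S = "supp f \<union> supp g"
  have S: "finite ?S" using assms by (simp add: finsupp_def)
  show ?thesis
    unfolding lp_superset[OF S supp_add] lp_superset[OF S Un_upper1] lp_superset[OF S Un_upper2]
    by (simp add: f_add_def sum.distrib ring_distribs)
qed

lemma lp_smult [simp]:
  assumes "f \<in> finsupp G"
  shows "lp (f_smult a f) \<phi> = a * lp f \<phi>"
proof -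
  have S: "finite (supp f)" using assms by (simp add: finsupp_def)
  show ?thesis
    unfolding lp_superset[OF S supp_smult] lp_superset[OF S subset_refl]
    by (simp add: f_smult_def sum_distrib_left mult.assoc)
qed

lemma lp_cong:
  assumes "f \<in> finsupp G" "\<And>m. m \<in> G \<Longrightarrow> \<phi> m = \<psi> m"
  shows "lp f \<phi> = lp f \<psi>"
  unfolding lp_def by (rule sum.cong) (use assms in \<open>auto simp: finsupp_def\<close>)

lemma lp_add_right: "lp f (\<lambda>m. \<phi> m + \<psi> m) = lp f \<phi> + lp f \<psi>"
  by (simp add: lp_def sum.distrib ring_distribs)

lemma lp_smult_right: "lp f (\<lambda>m. a * \<phi> m) = a * lp f \<phi>"
  by (simp add: lp_def sum_distrib_left mult_ac)

lemma lp_sum_right: "lp f (\<lambda>m. \<Sum>i\<in>I. \<phi> i m) = (\<Sum>i\<in>I. lp f (\<phi> i))"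
  by (simp add: lp_def sum_distrib_left) (rule sum.swap)

lemma lp_swap: "lp f (\<lambda>p. lp g (\<lambda>q. \<phi> p q)) = lp g (\<lambda>q. lp f (\<lambda>p. \<phi> p q))"
  unfolding lp_def sum_distrib_left
  by (subst sum.swap) (simp add: mult_ac)

lemma lp_point:
  assumes "f \<in> finsupp G"
  shows "lp f (\<lambda>x. if x = m then 1 else 0) = f m"
proof -
  have "lp f (\<lambda>x. if x = m then 1 else 0) = (\<Sum>x\<in>insert m (supp f). f x * (if x = m then 1 else 0))"
    by (rule lp_superset) (use assms in \<open>auto simp: finsupp_def\<close>)
  also have "\<dots> = (\<Sum>x\<in>{m}. f x * (if x = m then 1 else 0))"
    by (rule sum.mono_neutral_right) (use assms in \<open>auto simp: finsupp_def\<close>)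
  finally show ?thesis by simp
qed

lemma finsupp_eqI:
  assumes "f \<in> finsupp G" "g \<in> finsupp G" "\<And>\<phi>. lp f \<phi> = lp g \<phi>"
  shows "f = g"
  using lp_point[OF assms(1)] lp_point[OF assms(2)] assms(3) by fastforce

lemma finsupp_sum:
  assumes "finite I" "\<And>i. i \<in> I \<Longrightarrow> f i \<in> finsupp G"
  shows "(\<lambda>m. \<Sum>i\<in>I. f i m) \<in> finsupp G"
    and "lp (\<lambda>m. \<Sum>i\<in>I. f i m) \<phi> = (\<Sum>i\<in>I. lp (f i) \<phi>)"
proof -
  have "(\<lambda>m. \<Sum>i\<in>I. f i m) \<in> finsupp G \<and> lp (\<lambda>m. \<Sum>i\<in>I. f i m) \<phi> = (\<Sum>i\<in>I. lp (f i) \<phi>)"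
    using assms
  proof (induction I rule: finite_induct)
    case empty then show ?case by simp
  next
    case (insert x F)
    have "(\<lambda>m. \<Sum>i\<in>insert x F. f i m) = f_add (f x) (\<lambda>m. \<Sum>i\<in>F. f i m)"
      using insert by (simp add: f_add_def)
    moreover have "(\<lambda>m. \<Sum>i\<in>F. f i m) \<in> finsupp G" "f x \<in> finsupp G"
      using insert by auto
    ultimately show ?case using insert by (simp add: lp_add[of _ G])
  qed
  then show "(\<lambda>m. \<Sum>i\<in>I. f i m) \<in> finsupp G"
    and "lp (\<lambda>m. \<Sum>i\<in>I. f i m) \<phi> = (\<Sum>i\<in>I. lp (f i) \<phi>)" by auto
qed

locale star_monoid =
  fixes G :: "'m set" and opr :: "'m \<Rightarrow> 'm \<Rightarrow> 'm" and e :: 'm and st :: "'m \<Rightarrow> 'm"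
  assumes op_closed [simp]: "x \<in> G \<Longrightarrow> y \<in> G \<Longrightarrow> opr x y \<in> G"
    and e_closed [simp]: "e \<in> G"
    and st_closed [simp]: "x \<in> G \<Longrightarrow> st x \<in> G"
    and op_assoc: "x \<in> G \<Longrightarrow> y \<in> G \<Longrightarrow> z \<in> G \<Longrightarrow> opr (opr x y) z = opr x (opr y z)"
    and op_e_left [simp]: "x \<in> G \<Longrightarrow> opr e x = x"
    and op_e_right [simp]: "x \<in> G \<Longrightarrow> opr x e = x"
    and st_st [simp]: "x \<in> G \<Longrightarrow> st (st x) = x"
    and st_op: "x \<in> G \<Longrightarrow> y \<in> G \<Longrightarrow> st (opr x y) = opr (st y) (st x)"
begin

text \<open>Convolution. A monoid has no division, so the coefficient at \<open>m\<close> is the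
  pairing with the indicator of the pairs whose product is \<open>m\<close>.\<close>

definition f_mul :: "('m \<Rightarrow> complex) \<Rightarrow> ('m \<Rightarrow> complex) \<Rightarrow> 'm \<Rightarrow> complex" where
  "f_mul f g = (\<lambda>m. lp f (\<lambda>p. lp g (\<lambda>q. if opr p q = m then 1 else 0)))"

definition f_star :: "('m \<Rightarrow> complex) \<Rightarrow> 'm \<Rightarrow> complex" where
  "f_star f = (\<lambda>m. if m \<in> G then cnj (f (st m)) else 0)"

abbreviation "FS \<equiv> finsupp G"

lemma supp_mul:
  assumes "f \<in> FS" "g \<in> FS"
  shows "supp (f_mul f g) \<subseteq> (\<lambda>(p, q). opr p q) ` (supp f \<times> supp g)"
proof
  fix m assume "m \<in> supp (f_mul f g)"
  then have "f_mul f g m \<noteq> 0" by (simp add: supp_def)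
  then obtain p where p: "p \<in> supp f" "f p * lp g (\<lambda>q. if opr p q = m then 1 else 0) \<noteq> 0"
    unfolding f_mul_def lp_def[of f] by (rule sum.not_neutral_contains_not_neutral)
  from p(2) have "lp g (\<lambda>q. if opr p q = m then 1 else 0) \<noteq> 0" by simp
  then obtain q where "q \<in> supp g" "g q * (if opr p q = m then 1 else 0) \<noteq> 0"
    unfolding lp_def by (rule sum.not_neutral_contains_not_neutral)
  then show "m \<in> (\<lambda>(p, q). opr p q) ` (supp f \<times> supp g)"
    using p(1) by (auto split: if_splits)
qed

lemma mul_closed [simp]:
  assumes "f \<in> FS" "g \<in> FS"
  shows "f_mul f g \<in> FS"
proof -
  have "finite ((\<lambda>(p, q). opr p q) ` (supp f \<times> supp g))"
    using assms by (auto simp: finsupp_def)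
  moreover have "(\<lambda>(p, q). opr p q) ` (supp f \<times> supp g) \<subseteq> G"
    using assms by (auto simp: finsupp_def intro!: op_closed)
  ultimately show ?thesis using supp_mul[OF assms] unfolding finsupp_def
    by (auto intro: finite_subset)
qed

lemma lp_mul [simp]:
  assumes "f \<in> FS" "g \<in> FS"
  shows "lp (f_mul f g) \<phi> = lp f (\<lambda>p. lp g (\<lambda>q. \<phi> (opr p q)))"
proof -
  let ?S = "(\<lambda>(p, q). opr p q) ` (supp f \<times> supp g)"
  have S: "finite ?S" using assms by (auto simp: finsupp_def)
  have "lp (f_mul f g) \<phi> = (\<Sum>m\<in>?S. \<phi> m * f_mul f g m)"
    by (simp add: lp_superset[OF S supp_mul[OF assms]] mult_ac)
  also have "\<dots> = lp f (\<lambda>p. lp g (\<lambda>q. \<Sum>m\<in>?S. \<phi> m * (if opr p q = m then 1 else 0)))"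
    unfolding f_mul_def lp_sum_right lp_smult_right ..
  also have "\<dots> = lp f (\<lambda>p. lp g (\<lambda>q. \<phi> (opr p q)))"
    unfolding lp_def
  proof (intro sum.cong refl arg_cong2[where f="(*)"])
    fix p q assume "p \<in> supp f" "q \<in> supp g"
    then have "opr p q \<in> ?S" by force
    then show "(\<Sum>m\<in>?S. \<phi> m * (if opr p q = m then 1 else 0)) = \<phi> (opr p q)"
      using S by (simp add: if_distrib sum.delta cong: if_cong)
  qed
  finally show ?thesis .
qed

lemma star_closed [simp]:
  assumes "f \<in> FS"
  shows "f_star f \<in> FS"
proof -
  have "supp (f_star f) \<subseteq> st ` supp f"
    unfolding supp_def f_star_def by (auto split: if_splits) (metis (mono_tags, lifting) imageI mem_Collect_eq st_st)
  then show ?thesis using assms unfolding finsupp_def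
    by (auto intro: finite_subset simp: f_star_def supp_def split: if_splits)
qed

lemma lp_star [simp]:
  assumes "f \<in> FS"
  shows "lp (f_star f) \<phi> = cnj (lp f (\<lambda>m. cnj (\<phi> (st m))))"
proof -
  have supp: "supp (f_star f) = st ` supp f"
  proof
    show "supp (f_star f) \<subseteq> st ` supp f"
      unfolding supp_def f_star_def by (auto split: if_splits) (metis (mono_tags, lifting) imageI mem_Collect_eq st_st)
    show "st ` supp f \<subseteq> supp (f_star f)"
      using assms by (auto simp: supp_def f_star_def finsupp_def)
  qed
  have inj: "inj_on st (supp f)"
    using assms by (intro inj_on_inverseI[of _ st]) (auto simp: finsupp_def)
  have "lp (f_star f) \<phi> = (\<Sum>m\<in>supp f. f_star f (st m) * \<phi> (st m))"
    unfolding lp_def supp by (simp add: sum.reindex[OF inj])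
  also have "\<dots> = (\<Sum>m\<in>supp f. cnj (f m * cnj (\<phi> (st m))))"
    by (rule sum.cong) (use assms in \<open>auto simp: f_star_def finsupp_def\<close>)
  finally show ?thesis by (simp add: lp_def)
qed

lemma lp_inner_cong:
  assumes "f \<in> FS" "g \<in> FS" "\<And>p q. p \<in> G \<Longrightarrow> q \<in> G \<Longrightarrow> \<phi> p q = \<psi> p q"
  shows "lp f (\<lambda>p. lp g (\<phi> p)) = lp f (\<lambda>p. lp g (\<psi> p))"
  by (intro lp_cong[OF assms(1)] lp_cong[OF assms(2)] assms(3))

lemma mul_assoc:
  assumes "f \<in> FS" "g \<in> FS" "h \<in> FS"
  shows "f_mul (f_mul f g) h = f_mul f (f_mul g h)"
  by (rule finsupp_eqI[of _ G])
    (use assms in \<open>auto simp: op_assoc intro!: lp_cong[of _ G]\<close>)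

lemma mul_one [simp]:
  assumes "f \<in> FS"
  shows "f_mul (delta e) f = f" "f_mul f (delta e) = f"
  by (rule finsupp_eqI[of _ G]; use assms in \<open>auto intro!: lp_cong[of _ G]\<close>)+

lemma mul_add:
  assumes "f \<in> FS" "g \<in> FS" "h \<in> FS"
  shows "f_mul f (f_add g h) = f_add (f_mul f g) (f_mul f h)"
    and "f_mul (f_add f g) h = f_add (f_mul f h) (f_mul g h)"
  by (rule finsupp_eqI[of _ G]; use assms in \<open>simp add: lp_add[of _ G] lp_add_right\<close>)+

lemma mul_smult:
  assumes "f \<in> FS" "g \<in> FS"
  shows "f_mul (f_smult a f) g = f_smult a (f_mul f g)"
    and "f_mul f (f_smult a g) = f_smult a (f_mul f g)"
  by (rule finsupp_eqI[of _ G]; use assms in \<open>simp add: lp_smult[of _ G] lp_smult_right\<close>)+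

lemma star_star [simp]: "f \<in> FS \<Longrightarrow> f_star (f_star f) = f"
  by (rule finsupp_eqI[of _ G]) (auto intro!: lp_cong[of _ G])

lemma star_add:
  assumes "f \<in> FS" "g \<in> FS"
  shows "f_star (f_add f g) = f_add (f_star f) (f_star g)"
  by (rule finsupp_eqI[of _ G]) (use assms in \<open>simp_all add: lp_add[of _ G]\<close>)

lemma star_smult:
  assumes "f \<in> FS"
  shows "f_star (f_smult a f) = f_smult (cnj a) (f_star f)"
  by (rule finsupp_eqI[of _ G]) (use assms in \<open>simp_all add: lp_smult[of _ G]\<close>)

lemma star_mul:
  assumes "f \<in> FS" "g \<in> FS"
  shows "f_star (f_mul f g) = f_mul (f_star g) (f_star f)"
proof (rule finsupp_eqI[of _ G])
  fix \<phi>
  have "lp (f_star (f_mul f g)) \<phi> = cnj (lp f (\<lambda>p. lp g (\<lambda>q. cnj (\<phi> (opr (st q) (st p))))))"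
    using assms by (simp add: st_op lp_inner_cong[where \<phi>="\<lambda>p q. cnj (\<phi> (st (opr p q)))"
        and \<psi>="\<lambda>p q. cnj (\<phi> (opr (st q) (st p)))"])
  also have "\<dots> = lp (f_mul (f_star g) (f_star f)) \<phi>"
    using assms by (simp add: lp_swap[of g])
  finally show "lp (f_star (f_mul f g)) \<phi> = lp (f_mul (f_star g) (f_star f)) \<phi>" .
qed (use assms in auto)

lemma mul_zero [simp]:
  shows "f_mul (\<lambda>_. 0) g = (\<lambda>_. 0)" "f_mul f (\<lambda>_. 0) = (\<lambda>_. 0)"
  by (auto simp: f_mul_def lp_def supp_def)

lemma mul_delta:
  assumes "p \<in> G" "q \<in> G"
  shows "f_mul (delta p) (delta q) = delta (opr p q)"
  by (rule finsupp_eqI[of _ G]) (use assms in auto)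

lemma star_delta:
  assumes "p \<in> G"
  shows "f_star (delta p) = delta (st p)"
  by (rule finsupp_eqI[of _ G]) (use assms in auto)

lemma star_one [simp]: "f_star (delta e) = delta e"
proof -
  have "st e = opr (st e) e" by simp
  also have "\<dots> = st (opr (st e) e)" by (metis e_closed op_e_left op_e_right st_closed st_op st_st)
  finally have "st e = e" by simp
  then show ?thesis using star_delta[of e] by simp
qed

definition star_alg :: "(cs \<Rightarrow> 'm \<Rightarrow> complex) \<Rightarrow> ('m \<Rightarrow> complex) salg" where
  "star_alg emb = \<lparr>a_carrier = FS, a_zero = (\<lambda>_. 0), a_one = delta e, a_add = f_add,
     a_smult = f_smult, a_mul = f_mul, a_star = f_star, a_emb = emb\<rparr>"

lemma star_algebra_star_alg: "star_algebra (star_alg emb)"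
proof -
  have F: "f_add f (f_smult (-1) f) = (\<lambda>_. 0)" "f_add (f_add f g) h = f_add f (f_add g h)"
    "f_smult a (f_smult b f) = f_smult (a * b) f" "f_smult 1 f = f"
    "f_smult a (f_add f g) = f_add (f_smult a f) (f_smult a g)"
    "f_smult (a + b) f = f_add (f_smult a f) (f_smult b f)" "f_add (\<lambda>_. 0) f = f"
    for f g h :: "'m \<Rightarrow> complex" and a b
    by (auto simp: f_add_def f_smult_def algebra_simps)
  have C: "f_add f g = f_add g f" for f g :: "'m \<Rightarrow> complex"
    by (auto simp: f_add_def)
  show ?thesis
    unfolding star_algebra_def Let_def star_alg_def salg.simps
    by (intro conjI ballI allI;
        (rule C | (simp only: F finsupp_zero finsupp_add finsupp_smult mul_closed star_closed mul_assoc
          mul_add mul_smult star_add star_smult star_mul star_star mul_one finsupp_delta e_closed)))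
qed

end

section \<open>Square roots of positive elements in the group algebra of a finite group\<close>

text \<open>Elimination of one coordinate: a pivot \<open>j\<close> with nonzero entry at
  \<open>s\<close> clears that coordinate from all other vectors, and induction applies with one
  coordinate and one vector fewer.\<close>

lemma finite_linear_dependence:
  fixes v :: "'i \<Rightarrow> 's \<Rightarrow> complex"
  assumes "finite S" "finite I" "card S < card I"
  shows "\<exists>a. (\<exists>i\<in>I. a i \<noteq> 0) \<and> (\<forall>s\<in>S. (\<Sum>i\<in>I. a i * v i s) = 0)"
  using assms
proof (induction S arbitrary: I v rule: finite_induct)
  case empty
  then have "I \<noteq> {}" by auto
  then show ?case by (intro exI[of _ "\<lambda>_. 1"]) auto
next
  case (insert s S)
  show ?case
  proof (cases "\<forall>i\<in>I. v i s = 0")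
    case True
    have "card S < card I" using insert by auto
    from insert.IH[OF insert.prems(1) this, of v] True show ?thesis by auto
  next
    case False
    then obtain j where j: "j \<in> I" "v j s \<noteq> 0" by blast
    define w where "w i t = v i t - v i s / v j s * v j t" for i t
    have "card S < card (I - {j})" using insert j by auto
    from insert.IH[OF _ this, of w] insert.prems(1) obtain a where
      a: "\<exists>i\<in>I-{j}. a i \<noteq> 0" "\<And>t. t \<in> S \<Longrightarrow> (\<Sum>i\<in>I-{j}. a i * w i t) = 0" by auto
    \<comment> \<open>The pivot receives the coefficient that undoes the subtraction of its
      multiples.\<close>
    define b where "b i = (if i = j then - (\<Sum>i\<in>I-{j}. a i * (v i s / v j s)) else a i)" for i
    have eq: "(\<Sum>i\<in>I. b i * v i t) = (\<Sum>i\<in>I-{j}. a i * w i t)" for t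
    proof -
      have "(\<Sum>i\<in>I. b i * v i t) = b j * v j t + (\<Sum>i\<in>I-{j}. b i * v i t)"
        using insert.prems(1) j(1) by (simp add: sum.remove)
      also have "(\<Sum>i\<in>I-{j}. b i * v i t) = (\<Sum>i\<in>I-{j}. a i * v i t)"
        by (rule sum.cong) (auto simp: b_def)
      also have "b j * v j t = - (\<Sum>i\<in>I-{j}. a i * (v i s / v j s) * v j t)"
        by (simp add: b_def sum_distrib_right)
      finally show ?thesis by (simp add: w_def sum_subtractf right_diff_distrib mult.assoc)
    qed
    have "w i s = 0" for i using j by (simp add: w_def)
    then have "\<forall>t\<in>insert s S. (\<Sum>i\<in>I. b i * v i t) = 0"
      unfolding eq using a(2) by auto
    moreover have "\<exists>i\<in>I. b i \<noteq> 0" using a(1) by (auto simp: b_def)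
    ultimately show ?thesis by blast
  qed
qed

text \<open>Newton's step: \<open>d\<close> vanishes at the old nodes and not at the new one, so a
  multiple of it corrects the value there. The use is to interpolate the square root on a finite set
  of eigenvalues.\<close>

lemma polynomial_interpolation:
  fixes y :: "real \<Rightarrow> real"
  assumes "finite S"
  shows "\<exists>p. \<forall>x\<in>S. poly p x = y x"
  using assms
proof (induction S rule: finite_induct)
  case (insert s S)
  then obtain p where p: "\<forall>x\<in>S. poly p x = y x" by blast
  define d where "d = (\<Prod>x\<in>S. [:- x, 1:])"
  have d: "poly d x = (\<Prod>z\<in>S. x - z)" for x by (simp add: d_def poly_prod)
  then have "poly d s \<noteq> 0" using insert by auto
  moreover have "poly d x = 0" if "x \<in> S" for x using insert.hyps(1) that unfolding d by auto
  ultimately show ?case using p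
    by (intro exI[of _ "p + smult ((y s - poly p s) / poly d s) d"]) auto
qed simp

lemma of_real_poly_mult:
  "map_poly complex_of_real (p * q) = map_poly complex_of_real p * map_poly complex_of_real q"
  by (simp add: poly_eq_iff coeff_map_poly coeff_mult)

lemma of_real_poly_power: "map_poly complex_of_real (p ^ n) = map_poly complex_of_real p ^ n"
  by (induction n) (simp_all add: of_real_poly_mult)

lemma poly_of_real_poly: "poly (map_poly complex_of_real p) (complex_of_real x) = complex_of_real (poly p x)"
  by (induction p) (simp_all add: map_poly_pCons)

text \<open>The involution is the inverse, so the star-algebra is the group algebra of a finite
  group.\<close>

locale finite_star_group = star_monoid G opr e st
  for G :: "'m set" and opr e st +
  assumes fin: "finite G" and inv_left: "x \<in> G \<Longrightarrow> opr (st x) x = e"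
begin

lemma FS_iff: "f \<in> FS \<longleftrightarrow> (\<forall>m. m \<notin> G \<longrightarrow> f m = 0)"
  using fin by (auto simp: finsupp_def supp_def intro: finite_subset)

text \<open>The coefficient at the unit is the canonical trace, and the form it induces is the
  standard Hermitian inner product of coefficients. Its definiteness is the faithfulness on which
  the square roots rest.\<close>

lemma star_mul_at_e:
  assumes "f \<in> FS" "g \<in> FS"
  shows "f_mul (f_star f) g e = (\<Sum>m\<in>G. cnj (f m) * g m)"
proof -
  have *: "opr (st m) q = e \<longleftrightarrow> q = m" if "m \<in> G" "q \<in> G" for m q
  proof
    assume "opr (st m) q = e"
    then have "opr m (opr (st m) q) = m" using that by simp
    then show "q = m" using that op_assoc[of m "st m" q] inv_left[of "st m"] by simp
  qed (use that inv_left in auto)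
  have "f_mul (f_star f) g e = cnj (lp f (\<lambda>m. cnj (lp g (\<lambda>q. if opr (st m) q = e then 1 else 0))))"
    using assms by (simp add: f_mul_def)
  also have "\<dots> = cnj (lp f (\<lambda>m. cnj (lp g (\<lambda>q. if q = m then 1 else 0))))"
    using assms by (intro arg_cong[where f=cnj] lp_cong[OF assms(1)] lp_cong[OF assms(2)])
      (simp add: *)
  also have "\<dots> = (\<Sum>m\<in>G. cnj (f m) * g m)"
    using assms(1) unfolding lp_point[OF assms(2)]
    by (subst lp_superset[OF fin]) (auto simp: finsupp_def)
  finally show ?thesis .
qed

lemma star_mul_self_zero:
  assumes "f \<in> FS" "f_mul (f_star f) f e = 0"
  shows "f = (\<lambda>_. 0)"
proof -
  have "(\<Sum>m\<in>G. cnj (f m) * f m) = complex_of_real (\<Sum>m\<in>G. (cmod (f m))\<^sup>2)"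
    by (simp only: of_real_sum, rule sum.cong)
      (simp_all add: complex_norm_square[unfolded of_real_power] mult.commute)
  then have "(\<Sum>m\<in>G. (cmod (f m))\<^sup>2) = 0"
    using assms by (simp add: star_mul_at_e del: of_real_sum)
  then have "\<forall>m\<in>G. f m = 0"
    by (subst (asm) sum_nonneg_eq_0_iff) (use fin in auto)
  then show ?thesis using assms(1) by (force simp: FS_iff)
qed

section \<open>Polynomial functional calculus in the group algebra\<close>

definition ev :: "('m \<Rightarrow> complex) \<Rightarrow> complex poly \<Rightarrow> 'm \<Rightarrow> complex" where
  "ev f p = fold_coeffs (\<lambda>a g. f_add (f_smult a (delta e)) (f_mul f g)) p (\<lambda>_. 0)"

lemma ev_0 [simp]: "ev f 0 = (\<lambda>_. 0)"
  by (simp add: ev_def)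

lemma ev_pCons [simp]: "ev f (pCons a p) = f_add (f_smult a (delta e)) (f_mul f (ev f p))"
  by (cases "a = 0 \<and> p = 0") (auto simp: ev_def f_add_def f_smult_def)

lemma ev_closed [simp]: "f \<in> FS \<Longrightarrow> ev f p \<in> FS"
  by (induction p) auto

lemma ev_add:
  assumes "f \<in> FS"
  shows "ev f (p + q) = f_add (ev f p) (ev f q)"
  by (induction p q rule: poly_induct2)
    (use assms in \<open>auto simp: mul_add, auto simp: f_add_def f_smult_def algebra_simps\<close>)

lemma ev_smult:
  assumes "f \<in> FS"
  shows "ev f (smult c p) = f_smult c (ev f p)"
  by (induction p) (use assms in \<open>auto simp: mul_smult, auto simp: f_add_def f_smult_def algebra_simps\<close>)

lemma ev_mult:
  assumes "f \<in> FS"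
  shows "ev f (p * q) = f_mul (ev f p) (ev f q)"
proof (induction p)
  case (pCons a p)
  have "ev f (pCons a p * q) = f_add (f_smult a (ev f q)) (f_mul f (ev f (p * q)))"
    using assms by (simp add: ev_add ev_smult) (simp add: f_add_def f_smult_def)
  also have "\<dots> = f_mul (ev f (pCons a p)) (ev f q)"
    using assms by (simp add: pCons mul_add mul_assoc mul_smult)
  finally show ?case .
qed simp

lemma ev_1: "f \<in> FS \<Longrightarrow> ev f 1 = delta e"
  by (simp add: one_pCons) (simp add: f_add_def f_smult_def)

lemma ev_X: "f \<in> FS \<Longrightarrow> ev f [:0, 1:] = f"
proof -
  assume f: "f \<in> FS"
  have "f_smult 1 (delta e) = delta e" "f_smult 0 (delta e) = (\<lambda>_. 0)"
    "f_add (\<lambda>_. 0) f = f" "f_add (delta e) (\<lambda>_. 0) = delta e"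
    by (auto simp: f_smult_def f_add_def)
  then show ?thesis using f by simp
qed

text \<open>The \<open>card G + 1\<close> powers \<open>f^0, ..., f^(card G)\<close> live in a space
  of dimension \<open>card G\<close>.\<close>

lemma ev_annihilator:
  assumes "f \<in> FS"
  shows "\<exists>q. q \<noteq> 0 \<and> ev f q = (\<lambda>_. 0)"
proof -
  let ?I = "{..card G}"
  obtain a where a: "\<exists>i\<in>?I. a i \<noteq> 0" "\<And>s. s \<in> G \<Longrightarrow> (\<Sum>i\<in>?I. a i * ev f (monom 1 i) s) = 0"
    using finite_linear_dependence[OF fin, of ?I "\<lambda>i. ev f (monom 1 i)"] by auto
  define q where "q = (\<Sum>i\<in>?I. monom (a i) i)"
  have "coeff q i = (if i \<in> ?I then a i else 0)" for i
    by (simp add: q_def coeff_sum)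
  then have "q \<noteq> 0" using a(1) by (metis coeff_0)
  have ev_sum: "ev f (\<Sum>i\<in>J. monom (a i) i) = (\<lambda>s. \<Sum>i\<in>J. a i * ev f (monom 1 i) s)"
    if "finite J" for J
    using that
  proof (induction J rule: finite_induct)
    case (insert x F)
    have "monom (a x) x = smult (a x) (monom 1 x)" by (simp add: smult_monom)
    then show ?case using insert assms
      by (simp add: ev_add ev_smult) (simp add: f_add_def f_smult_def)
  qed simp
  have "ev f q s = 0" for s
    using a(2) ev_closed[OF assms, of "monom 1 _"]
    by (cases "s \<in> G") (auto simp: q_def ev_sum FS_iff)
  with \<open>q \<noteq> 0\<close> show ?thesis by blast
qed

lemma ev_star_real:
  assumes "f \<in> FS" "f_star f = f"
  shows "f_star (ev f (map_poly complex_of_real p)) = ev f (map_poly complex_of_real p)"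
proof (induction p)
  case 0
  have "f_star (\<lambda>_. 0) = (\<lambda>_. 0)" by (auto simp: f_star_def)
  then show ?case by simp
next
  case (pCons a p)
  let ?p = "map_poly complex_of_real p"
  have "f_mul (ev f ?p) (ev f [:0, 1:]) = f_mul (ev f [:0, 1:]) (ev f ?p)"
    using assms by (metis ev_mult mult.commute)
  then have "f_mul (ev f ?p) f = f_mul f (ev f ?p)"
    unfolding ev_X[OF assms(1)] .
  then show ?case using pCons assms
    by (simp add: map_poly_pCons star_add star_smult star_mul)
qed

text \<open>A self-adjoint nilpotent vanishes. If the least vanishing exponent \<open>m\<close> were
  at least two, then \<open>g = h^(m-1)\<close>, self-adjoint because its coefficients are real,
  would satisfy \<open>g^2 = h^(2m-2) = 0\<close>, and faithfulness would give \<open>g = 0\<close>,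
  against minimality.\<close>

lemma ev_nilpotent_real:
  assumes "f \<in> FS" "f_star f = f" "ev f (map_poly complex_of_real h ^ n) = (\<lambda>_. 0)"
  shows "ev f (map_poly complex_of_real h) = (\<lambda>_. 0)"
proof -
  let ?h = "map_poly complex_of_real h"
  define m where "m = (LEAST n. ev f (?h ^ n) = (\<lambda>_. 0))"
  have m: "ev f (?h ^ m) = (\<lambda>_. 0)" unfolding m_def by (rule LeastI, rule assms(3))
  have least: "ev f (?h ^ l) \<noteq> (\<lambda>_. 0)" if "l < m" for l
    using that not_less_Least unfolding m_def by blast
  have "m \<noteq> 0"
  proof
    assume "m = 0"
    then have "delta e e = (0::complex)" using m assms(1) by (simp add: ev_1)
    then show False by (simp add: delta_def)
  qed
  moreover have "\<not> m \<ge> 2"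
  proof
    assume "m \<ge> 2"
    define l where "l = m - 1"
    let ?g = "ev f (?h ^ l)"
    have real: "map_poly complex_of_real (h ^ l) = ?h ^ l" by (rule of_real_poly_power)
    have "f_mul (f_star ?g) ?g = ev f (?h ^ m * ?h ^ (l + l - m))"
      using ev_star_real[OF assms(1,2), of "h ^ l"] assms(1) \<open>m \<ge> 2\<close>
      unfolding real by (simp add: ev_mult[symmetric] power_add[symmetric] l_def numeral_2_eq_2)
    also have "\<dots> = (\<lambda>_. 0)" using m assms(1) by (simp add: ev_mult)
    finally have "?g = (\<lambda>_. 0)" using assms(1) by (intro star_mul_self_zero) auto
    then show False using least[of l] \<open>m \<ge> 2\<close> by (simp add: l_def)
  qed
  ultimately have "m = 1" by linarith
  with m show ?thesis by simp
qed

text \<open>An annihilating polynomial \<open>q\<close> of least degree has nonzero cofactors: if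
  \<open>q = (X - z) r\<close>, then \<open>ev f r\<close> is an eigenvector for \<open>z\<close>,
  and positivity tested on it forces \<open>z\<close> to be real and non-negative. A real polynomial
  \<open>p\<close> taking the square root as value at each root of \<open>q\<close> then gives a
  self-adjoint \<open>p(f)\<close> with square \<open>f\<close>.\<close>

theorem positive_is_square:
  assumes f: "f \<in> FS" "f_star f = f"
    and pos: "\<And>v. v \<in> FS \<Longrightarrow> f_mul (f_mul (f_star v) f) v e \<in> \<real> \<and> 0 \<le> Re (f_mul (f_mul (f_star v) f) v e)"
  shows "\<exists>c\<in>FS. f = f_mul (f_star c) c"
proof -
  define d where "d = (LEAST d. \<exists>q. q \<noteq> 0 \<and> ev f q = (\<lambda>_. 0) \<and> degree q = d)"
  have ex: "\<exists>q. q \<noteq> 0 \<and> ev f q = (\<lambda>_. 0) \<and> degree q = d"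
    unfolding d_def by (rule LeastI_ex) (use ev_annihilator[OF f(1)] in blast)
  then obtain q where q: "q \<noteq> 0" "ev f q = (\<lambda>_. 0)" "degree q = d" by blast
  have least: "ev f r \<noteq> (\<lambda>_. 0)" if "r \<noteq> 0" "degree r < d" for r
    using that not_less_Least unfolding d_def by blast
  have roots: "z \<in> \<real> \<and> 0 \<le> Re z" if "poly q z = 0" for z
  proof -
    have "[:- z, 1:] dvd q" using that by (simp add: poly_eq_0_iff_dvd)
    then obtain r where r: "q = [:- z, 1:] * r" unfolding dvd_def by blast    have "r \<noteq> 0" using q(1) r by auto
    then have "degree q = 1 + degree r" unfolding r by (subst degree_mult_eq) auto
    then have "degree r < d" using q(3) by simp
    let ?g = "ev f r"
    have g: "?g \<noteq> (\<lambda>_. 0)" using least \<open>r \<noteq> 0\<close> \<open>degree r < d\<close> by blast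
    have gFS: "?g \<in> FS" using f by simp
    have lin: "ev f [:- z, 1:] = f_add (f_smult (- z) (delta e)) f"
    proof -
      have "[:- z, 1:] = smult (-z) 1 + [:0, 1:]" by (simp add: one_pCons)
      then show ?thesis using f(1) by (simp only: ev_add ev_smult ev_1 ev_X)
    qed
    have "f_add (f_smult (- z) ?g) (f_mul f ?g) = (\<lambda>_. 0)"
      using q(2) f(1) unfolding r ev_mult[OF f(1)] lin by (simp add: mul_add mul_smult)
    then have fg: "f_mul f ?g = f_smult z ?g"
      by (auto simp: f_add_def f_smult_def fun_eq_iff)
    define N where "N = (\<Sum>m\<in>G. (cmod (?g m))\<^sup>2)"
    have N: "f_mul (f_star ?g) ?g e = complex_of_real N"
      unfolding star_mul_at_e[OF gFS gFS] N_def
      by (simp only: of_real_sum, rule sum.cong)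
        (simp_all add: complex_norm_square[unfolded of_real_power] mult.commute)
    have "N \<noteq> 0" using star_mul_self_zero[OF gFS] N g by auto
    then have "N > 0" by (simp add: N_def sum_nonneg order_less_le)
    have "f_mul (f_mul (f_star ?g) f) ?g e = z * complex_of_real N"
      using f gFS by (simp add: mul_assoc fg mul_smult) (simp add: f_smult_def N)
    with pos[OF gFS] have "z * complex_of_real N \<in> \<real>" "0 \<le> Re (z * complex_of_real N)" by auto
    then show ?thesis using \<open>N > 0\<close>
      by (auto simp: complex_is_Real_iff zero_le_mult_iff)
  qed
  have "finite {z. poly q z = 0}" using q(1) by (rule poly_roots_finite)
  then obtain p where p: "\<And>z. poly q z = 0 \<Longrightarrow> poly p (Re z) = sqrt (Re z)"
    using polynomial_interpolation[of "Re ` {z. poly q z = 0}" sqrt] by auto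
  define h where "h = p * p - [:0, 1:]"
  let ?C = "map_poly complex_of_real"
  have hz: "poly (?C h) z = 0" if "poly q z = 0" for z
  proof -
    have z: "z = complex_of_real (Re z)" "0 \<le> Re z"
      using roots[OF that] by (auto simp: complex_is_Real_iff complex_eq_iff)
    have "poly (?C h) (complex_of_real (Re z)) = complex_of_real (poly h (Re z))"
      by (rule poly_of_real_poly)
    also have "poly h (Re z) = 0" using p[OF that] z(2) by (simp add: h_def)
    finally show ?thesis using z(1) by simp
  qed
  \<comment> \<open>Roots of \<open>q\<close> may be multiple, so what is divisible by
    \<open>q\<close> is a power of \<open>h\<close>. Thus \<open>h(f)\<close> is nilpotent, and
    being self-adjoint it is zero.\<close>
  have "q dvd (?C h) ^ degree q"
    using hz q(1) nullstellensatz_univariate[of q "?C h"] by blast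
  then obtain s where "(?C h) ^ degree q = q * s" by (auto simp: dvd_def)
  then have "ev f ((?C h) ^ degree q) = (\<lambda>_. 0)" using q(2) f(1) by (simp add: ev_mult)
  then have h0: "ev f (?C h) = (\<lambda>_. 0)" by (rule ev_nilpotent_real[OF f])
  define c where "c = ev f (?C p)"
  have c: "f_star c = c" unfolding c_def by (rule ev_star_real[OF f])
  have "?C p * ?C p = ?C h + [:0, 1:]"
    by (simp add: poly_eq_iff coeff_map_poly h_def coeff_mult)
      (simp add: coeff_pCons split: nat.split)
  then have "f_mul c c = f_add (ev f (?C h)) f"
    using f(1) unfolding c_def by (simp only: ev_mult[symmetric] ev_add ev_X)
  also have "\<dots> = f" using h0 by (simp add: f_add_def)
  finally show ?thesis using c f(1) by (intro bexI[of _ c]) (auto simp: c_def)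
qed

end

section \<open>Probability spaces over the group algebra from tracial functionals\<close>

lemma Sym_id [simp]: "id \<in> Sym n"
  by (simp add: Sym_def permutes_id)

lemma Sym_comp [simp]: "a \<in> Sym n \<Longrightarrow> b \<in> Sym n \<Longrightarrow> a \<circ> b \<in> Sym n"
  by (simp add: Sym_def permutes_compose)

lemma Sym_inv [simp]: "a \<in> Sym n \<Longrightarrow> inv a \<in> Sym n"
  by (simp add: Sym_def permutes_inv)

lemma Sym_inv_inv [simp]: "a \<in> Sym n \<Longrightarrow> inv (inv a) = a"
  by (auto simp: Sym_def permutes_inv_inv)

lemma Sym_inv_comp: "a \<in> Sym n \<Longrightarrow> inv a \<circ> a = id" "a \<in> Sym n \<Longrightarrow> a \<circ> inv a = id"
  by (auto simp: Sym_def permutes_inv_o)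

lemma Sym_inv_comp_assoc:
  "a \<in> Sym n \<Longrightarrow> inv a \<circ> (a \<circ> b) = b" "a \<in> Sym n \<Longrightarrow> a \<circ> (inv a \<circ> b) = b"
  by (simp_all add: o_assoc Sym_inv_comp)

lemma Sym_inv_distrib: "a \<in> Sym n \<Longrightarrow> b \<in> Sym n \<Longrightarrow> inv (a \<circ> b) = inv b \<circ> inv a"
  by (auto simp: Sym_def intro!: o_inv_distrib permutes_bij)

lemma Sym_inv_id [simp]: "inv (id :: nat \<Rightarrow> nat) = id"
  by (rule inv_id)

lemma finite_Sym [simp]: "finite (Sym n)"
  by (simp add: Sym_def finite_permutations)

lemma Sym_finite_star_group: "finite_star_group (Sym k) (\<circ>) id inv"
  by unfold_locales (auto simp: o_assoc Sym_inv_comp Sym_inv_distrib)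

lemma CSk_eq_finsupp: "CSk k = finsupp (Sym k)"
  by (auto simp: CSk_def finsupp_def supp_def intro: finite_subset[OF _ finite_Sym])

lemma cs_u_eq_delta: "cs_u = delta"
  by (simp add: cs_u_def delta_def fun_eq_iff)

lemma cs_add_eq: "cs_add = f_add" and cs_smult_eq: "cs_smult = f_smult"
  by (simp_all add: cs_add_def f_add_def cs_smult_def f_smult_def fun_eq_iff)

text \<open>One formula divides by \<open>\<rho>\<close> in the group, the other tests products with
  an indicator; for coefficients vanishing off \<open>Sym k\<close> both are the same
  convolution.\<close>

lemma cs_mul_eq:
  assumes "b \<in> CSk k" "b' \<in> CSk k"
  shows "cs_mul k b b' = star_monoid.f_mul (\<circ>) b b'"
proof -
  interpret S: finite_star_group "Sym k" "(\<circ>)" id inv by (rule Sym_finite_star_group)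
  have b: "b \<in> S.FS" "b' \<in> S.FS" using assms by (simp_all add: CSk_eq_finsupp)
  show ?thesis
  proof
    fix \<eta>
    show "cs_mul k b b' \<eta> = S.f_mul b b' \<eta>"
    proof (cases "\<eta> \<in> Sym k")
      case False
      then show ?thesis using S.mul_closed[OF b] by (simp add: cs_mul_def S.FS_iff)
    next
      case True
      have eq: "\<rho> \<circ> \<rho>' = \<eta> \<longleftrightarrow> \<rho>' = inv \<rho> \<circ> \<eta>" if "\<rho> \<in> Sym k" "\<rho>' \<in> Sym k" for \<rho> \<rho>'
        using that Sym_inv_comp_assoc by metis
      have "S.f_mul b b' \<eta> = lp b (\<lambda>\<rho>. lp b' (\<lambda>\<rho>'. if \<rho>' = inv \<rho> \<circ> \<eta> then 1 else 0))"
        unfolding S.f_mul_def by (intro lp_cong[OF b(1)] lp_cong[OF b(2)]) (simp add: eq)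
      also have "\<dots> = (\<Sum>\<rho>\<in>Sym k. b \<rho> * b' (inv \<rho> \<circ> \<eta>))"
        unfolding lp_point[OF b(2)] by (rule lp_superset) (use b in \<open>auto simp: finsupp_def\<close>)
      finally show ?thesis using True by (simp add: cs_mul_def)
    qed
  qed
qed

lemma cs_star_eq: "cs_star k b = star_monoid.f_star (Sym k) inv b"
proof -
  interpret S: finite_star_group "Sym k" "(\<circ>)" id inv by (rule Sym_finite_star_group)
  show ?thesis by (simp add: cs_star_def S.f_star_def)
qed

locale Sk_monoid = star_monoid G opr e st
  for G :: "'m set" and opr e st +
  fixes k :: nat and u :: "perm \<Rightarrow> 'm"
  assumes u_closed [simp]: "a \<in> Sym k \<Longrightarrow> u a \<in> G"
    and u_id: "u id = e"
    and u_comp: "a \<in> Sym k \<Longrightarrow> b \<in> Sym k \<Longrightarrow> opr (u a) (u b) = u (a \<circ> b)"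
    and u_st: "a \<in> Sym k \<Longrightarrow> st (u a) = u (inv a)"
    and u_inj: "inj_on u (Sym k)"
begin

sublocale S: finite_star_group "Sym k" "(\<circ>)" id inv
  by (rule Sym_finite_star_group)

definition emb :: "cs \<Rightarrow> 'm \<Rightarrow> complex" where
  "emb b = (\<lambda>m. \<Sum>\<eta>\<in>Sym k. b \<eta> * delta (u \<eta>) m)"

lemma emb_closed [simp]: "emb b \<in> FS"
  and lp_emb: "lp (emb b) \<psi> = (\<Sum>\<eta>\<in>Sym k. b \<eta> * \<psi> (u \<eta>))"
proof -
  have *: "emb b = (\<lambda>m. \<Sum>\<eta>\<in>Sym k. f_smult (b \<eta>) (delta (u \<eta>)) m)"
    by (simp add: emb_def f_smult_def)
  show "emb b \<in> FS" unfolding * by (rule finsupp_sum) auto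
  have "lp (emb b) \<psi> = (\<Sum>\<eta>\<in>Sym k. lp (f_smult (b \<eta>) (delta (u \<eta>))) \<psi>)"
    unfolding * by (rule finsupp_sum(2)[where G=G]) auto
  also have "\<dots> = (\<Sum>\<eta>\<in>Sym k. b \<eta> * \<psi> (u \<eta>))"
    by (rule sum.cong) (simp_all add: lp_smult[of _ G])
  finally show "lp (emb b) \<psi> = (\<Sum>\<eta>\<in>Sym k. b \<eta> * \<psi> (u \<eta>))" .
qed

lemma lp_Sym: "b \<in> S.FS \<Longrightarrow> lp b \<psi> = (\<Sum>\<eta>\<in>Sym k. b \<eta> * \<psi> \<eta>)"
  by (rule lp_superset) (auto simp: finsupp_def)

lemma lp_emb': "b \<in> S.FS \<Longrightarrow> lp (emb b) \<psi> = lp b (\<lambda>\<eta>. \<psi> (u \<eta>))"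
  by (simp add: lp_emb lp_Sym)

lemma emb_delta: "\<eta> \<in> Sym k \<Longrightarrow> emb (delta \<eta>) = delta (u \<eta>)"
  by (rule finsupp_eqI[of _ G]) (simp_all add: lp_emb')

lemma emb_add: "b \<in> S.FS \<Longrightarrow> b' \<in> S.FS \<Longrightarrow> emb (f_add b b') = f_add (emb b) (emb b')"
  by (rule finsupp_eqI[of _ G]) (simp_all add: lp_emb' lp_add[of _ G] lp_add[of _ "Sym k"])

lemma emb_smult: "b \<in> S.FS \<Longrightarrow> emb (f_smult a b) = f_smult a (emb b)"
  by (rule finsupp_eqI[of _ G]) (simp_all add: lp_emb' lp_smult[of _ G] lp_smult[of _ "Sym k"])

lemma emb_zero [simp]: "emb (\<lambda>_. 0) = (\<lambda>_. 0)"
  by (simp add: emb_def)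

lemma emb_mul:
  assumes "b \<in> S.FS" "b' \<in> S.FS"
  shows "emb (S.f_mul b b') = f_mul (emb b) (emb b')"
proof (rule finsupp_eqI[of _ G])
  fix \<phi>
  show "lp (emb (S.f_mul b b')) \<phi> = lp (f_mul (emb b) (emb b')) \<phi>"
    using assms by (simp add: lp_emb') (rule S.lp_inner_cong, simp_all add: u_comp)
qed (use assms in auto)

lemma emb_star:
  assumes "b \<in> S.FS"
  shows "emb (S.f_star b) = f_star (emb b)"
proof (rule finsupp_eqI[of _ G])
  fix \<phi>
  have "lp b (\<lambda>m. cnj (\<phi> (u (inv m)))) = lp b (\<lambda>\<eta>. cnj (\<phi> (st (u \<eta>))))"
    by (rule lp_cong[OF assms]) (simp add: u_st)
  then show "lp (emb (S.f_star b)) \<phi> = lp (f_star (emb b)) \<phi>"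
    using assms by (simp add: lp_emb')
qed (use assms in auto)

lemma emb_inj: "inj_on emb S.FS"
proof (rule inj_onI)
  fix b b' assume b: "b \<in> S.FS" "b' \<in> S.FS" and eq: "emb b = emb b'"
  show "b = b'"
  proof
    fix \<eta>
    show "b \<eta> = b' \<eta>"
    proof (cases "\<eta> \<in> Sym k")
      case True
      have *: "lp (emb c) (\<lambda>m. if m = u \<eta> then 1 else 0) = c \<eta>" if "c \<in> S.FS" for c
      proof -
        have "lp (emb c) (\<lambda>m. if m = u \<eta> then 1 else 0) = lp c (\<lambda>\<rho>. if \<rho> = \<eta> then 1 else 0)"
          unfolding lp_emb'[OF that] using u_inj True
          by (intro lp_cong[OF that]) (auto simp: inj_on_def)
        then show ?thesis using that by (simp add: lp_point)
      qed
      show ?thesis using *[OF b(1)] *[OF b(2)] eq by simp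
    qed (use b in \<open>auto simp: S.FS_iff\<close>)
  qed
qed

abbreviation "Alg \<equiv> star_alg emb"

end

text \<open>On group elements the trace is the Kronecker symbol at the identity, so the coefficient
  at \<open>\<rho>\<close> of an element \<open>b\<close> of the group algebra is the trace of
  \<open>b\<close> times \<open>u (inv \<rho>)\<close>. The expectation \<open>E\<close> applies
  this formula to every element of the algebra, exactly as \<open>EN\<close> does for
  matrices.\<close>

locale Sk_trace = Sk_monoid G opr e st k u
  for G :: "'m set" and opr e st k u +
  fixes \<phi> :: "'m \<Rightarrow> complex"
  assumes trace: "a \<in> G \<Longrightarrow> b \<in> G \<Longrightarrow> \<phi> (opr a b) = \<phi> (opr b a)"
    and \<phi>_u: "\<eta> \<in> Sym k \<Longrightarrow> \<phi> (u \<eta>) = (if \<eta> = id then 1 else 0)"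
    and \<phi>_star: "a \<in> G \<Longrightarrow> \<phi> (st a) = cnj (\<phi> a)"
    and \<phi>_pos: "f \<in> FS \<Longrightarrow> 0 \<le> Re (lp (f_mul (f_star f) f) \<phi>)"
begin

definition E :: "('m \<Rightarrow> complex) \<Rightarrow> cs" where
  "E f = (\<lambda>\<rho>. if \<rho> \<in> Sym k then lp f (\<lambda>m. \<phi> (opr m (u (inv \<rho>)))) else 0)"

lemma E_closed [simp]: "E f \<in> S.FS"
  by (simp add: S.FS_iff E_def)

lemma E_add: "f \<in> FS \<Longrightarrow> g \<in> FS \<Longrightarrow> E (f_add f g) = f_add (E f) (E g)"
  by (rule ext) (simp add: E_def lp_add[of _ G], simp add: f_add_def)

lemma E_smult: "f \<in> FS \<Longrightarrow> E (f_smult a f) = f_smult a (E f)"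
  by (rule ext) (simp add: E_def lp_smult[of _ G], simp add: f_smult_def)

lemma E_delta: "m \<in> G \<Longrightarrow> E (delta m) \<rho> = (if \<rho> \<in> Sym k then \<phi> (opr m (u (inv \<rho>))) else 0)"
  by (simp add: E_def)

lemma E_zero [simp]: "E (\<lambda>_. 0) = (\<lambda>_. 0)"
  by (auto simp: E_def)

lemma E_one: "E (delta e) = delta id"
proof
  fix \<rho>
  show "E (delta e) \<rho> = delta id \<rho>"
  proof (cases "\<rho> \<in> Sym k")
    case True
    have "inv \<rho> = id \<longleftrightarrow> \<rho> = id" using True Sym_inv_inv by fastforce
    then have "E (delta e) \<rho> = (if \<rho> = id then 1 else 0)" using True by (simp add: E_delta \<phi>_u)
    then show ?thesis by (simp add: delta_def)
  next
    case False
    then have "\<rho> \<noteq> id" by auto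
    with False show ?thesis by (simp add: E_def delta_def)
  qed
qed

lemma S_mul_at:
  assumes "b \<in> S.FS" "b' \<in> S.FS" "\<rho> \<in> Sym k"
  shows "S.f_mul b b' \<rho> = (\<Sum>\<eta>\<in>Sym k. b \<eta> * b' (inv \<eta> \<circ> \<rho>))"
  using cs_mul_eq[of b k b'] assms by (simp add: CSk_eq_finsupp cs_mul_def fun_eq_iff) metis

lemma E_right:
  assumes "x \<in> FS" "b \<in> S.FS"
  shows "E (f_mul x (emb b)) = S.f_mul (E x) b"
proof
  fix \<rho>
  show "E (f_mul x (emb b)) \<rho> = S.f_mul (E x) b \<rho>"
  proof (cases "\<rho> \<in> Sym k")
    case False
    then show ?thesis using assms S.FS_iff S.mul_closed E_closed by metis
  next
    case True
    have "E (f_mul x (emb b)) \<rho>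
        = lp x (\<lambda>p. \<Sum>\<eta>\<in>Sym k. b \<eta> * \<phi> (opr (opr p (u \<eta>)) (u (inv \<rho>))))"
      using True assms by (simp add: E_def lp_emb)
    also have "\<dots> = (\<Sum>\<eta>\<in>Sym k. b \<eta> * lp x (\<lambda>p. \<phi> (opr (opr p (u \<eta>)) (u (inv \<rho>)))))"
      by (simp add: lp_sum_right lp_smult_right)
    also have "\<dots> = (\<Sum>\<eta>\<in>Sym k. b \<eta> * E x (\<rho> \<circ> inv \<eta>))"
    proof (rule sum.cong)
      fix \<eta> assume \<eta>: "\<eta> \<in> Sym k"
      then have "inv (\<rho> \<circ> inv \<eta>) = \<eta> \<circ> inv \<rho>"
        using True by (simp add: Sym_inv_distrib[of _ k])
      then have "E x (\<rho> \<circ> inv \<eta>) = lp x (\<lambda>p. \<phi> (opr (opr p (u \<eta>)) (u (inv \<rho>))))"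
        using \<eta> True assms(1) unfolding E_def by (auto intro!: lp_cong[of _ G] simp: op_assoc u_comp)
      then show "b \<eta> * lp x (\<lambda>p. \<phi> (opr (opr p (u \<eta>)) (u (inv \<rho>)))) = b \<eta> * E x (\<rho> \<circ> inv \<eta>)"
        by simp
    qed simp
    also have "\<dots> = (\<Sum>\<alpha>\<in>Sym k. E x \<alpha> * b (inv \<alpha> \<circ> \<rho>))"
      by (rule sum.reindex_bij_witness[where i="\<lambda>\<alpha>. inv \<alpha> \<circ> \<rho>" and j="\<lambda>\<eta>. \<rho> \<circ> inv \<eta>"])
        (use True in \<open>auto simp: Sym_inv_distrib[of _ k] Sym_inv_comp[of _ k] Sym_inv_comp_assoc[of _ k] o_assoc[symmetric]\<close>)
    also have "\<dots> = S.f_mul (E x) b \<rho>"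
      using assms True by (simp add: S_mul_at)
    finally show ?thesis .
  qed
qed

text \<open>Traciality carries \<open>u \<eta>\<close> from the front of the product to its back,
  where it merges with the \<open>u (inv \<rho>)\<close> of the coefficient formula.\<close>

lemma E_left:
  assumes "x \<in> FS" "b \<in> S.FS"
  shows "E (f_mul (emb b) x) = S.f_mul b (E x)"
proof
  fix \<rho>
  show "E (f_mul (emb b) x) \<rho> = S.f_mul b (E x) \<rho>"
  proof (cases "\<rho> \<in> Sym k")
    case False
    then show ?thesis using assms S.FS_iff S.mul_closed E_closed by metis
  next
    case True
    have "E (f_mul (emb b) x) \<rho>
        = (\<Sum>\<eta>\<in>Sym k. b \<eta> * lp x (\<lambda>p. \<phi> (opr (opr (u \<eta>) p) (u (inv \<rho>)))))"
      using True assms by (simp add: E_def lp_emb)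
    also have "\<dots> = (\<Sum>\<eta>\<in>Sym k. b \<eta> * E x (inv \<eta> \<circ> \<rho>))"
    proof (rule sum.cong)
      fix \<eta> assume \<eta>: "\<eta> \<in> Sym k"
      have inv: "inv (inv \<eta> \<circ> \<rho>) = inv \<rho> \<circ> \<eta>"
        using True \<eta> by (simp add: Sym_inv_distrib[of _ k])
      have "\<phi> (opr (opr (u \<eta>) p) (u (inv \<rho>))) = \<phi> (opr p (u (inv \<rho> \<circ> \<eta>)))" if "p \<in> G" for p
        using trace[of "u \<eta>" "opr p (u (inv \<rho>))"] that \<eta> True by (simp add: op_assoc u_comp)
      then have "E x (inv \<eta> \<circ> \<rho>) = lp x (\<lambda>p. \<phi> (opr (opr (u \<eta>) p) (u (inv \<rho>))))"
        using \<eta> True assms(1) unfolding E_def inv by (auto intro!: lp_cong[of _ G])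
      then show "b \<eta> * lp x (\<lambda>p. \<phi> (opr (opr (u \<eta>) p) (u (inv \<rho>)))) = b \<eta> * E x (inv \<eta> \<circ> \<rho>)"
        by simp
    qed simp
    also have "\<dots> = S.f_mul b (E x) \<rho>"
      using assms True by (simp add: S_mul_at)
    finally show ?thesis .
  qed
qed

lemma E_star:
  assumes "x \<in> FS"
  shows "E (f_star x) = S.f_star (E x)"
proof
  fix \<rho>
  show "E (f_star x) \<rho> = S.f_star (E x) \<rho>"
  proof (cases "\<rho> \<in> Sym k")
    case True
    have "cnj (\<phi> (opr (st m) (u (inv \<rho>)))) = \<phi> (opr m (u \<rho>))" if "m \<in> G" for m
    proof -
      have "cnj (\<phi> (opr (st m) (u (inv \<rho>)))) = \<phi> (opr (u \<rho>) m)"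
        using that True by (simp add: \<phi>_star[symmetric] st_op u_st)
      then show ?thesis using trace[of "u \<rho>" m] that True by simp
    qed
    then have "lp x (\<lambda>m. cnj (\<phi> (opr (st m) (u (inv \<rho>))))) = lp x (\<lambda>m. \<phi> (opr m (u \<rho>)))"
      by (intro lp_cong[OF assms])
    then show ?thesis using True assms by (simp add: E_def S.f_star_def)
  qed (simp add: E_def S.f_star_def)
qed

text \<open>For \<open>v\<close> in the group algebra, the bimodule property turns the compression
  of the expectation by \<open>v\<close> into the expectation of the square of \<open>y v\<close>,
  whose coefficient at \<open>id\<close> is a value of the positive trace. This is the positivity
  required by the square-root theorem.\<close>

lemma E_star_mul_square:
  assumes y: "y \<in> FS"
  shows "cs_pos k (E (f_mul (f_star y) y))"
proof -
  let ?f = "E (f_mul (f_star y) y)"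
  have sa: "S.f_star ?f = ?f"
    using y by (simp add: E_star[symmetric] star_mul)
  have "S.f_mul (S.f_mul (S.f_star v) ?f) v id \<in> \<real> \<and> 0 \<le> Re (S.f_mul (S.f_mul (S.f_star v) ?f) v id)"
    if v: "v \<in> S.FS" for v
  proof -
    let ?z = "f_mul y (emb v)"
    let ?w = "S.f_mul (S.f_mul (S.f_star v) ?f) v"
    have z: "?z \<in> FS" using y by simp
    have w: "?w = E (f_mul (f_star ?z) ?z)"
      using y v by (simp add: E_left[symmetric] E_right[symmetric] emb_star star_mul mul_assoc)
    have "?w id = lp (f_mul (f_star ?z) ?z) (\<lambda>m. \<phi> (opr m e))"
      unfolding w by (simp add: E_def u_id)
    also have "\<dots> = lp (f_mul (f_star ?z) ?z) \<phi>"
      by (rule lp_cong[of _ G]) (use y in auto)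
    finally have "0 \<le> Re (?w id)" using \<phi>_pos[OF z] by simp
    moreover have "S.f_star ?w = ?w" using v sa by (simp add: S.star_mul S.mul_assoc)
    then have "S.f_star ?w id = ?w id" by simp
    then have "?w id \<in> \<real>" by (simp add: S.f_star_def complex_is_Real_iff complex_eq_iff)
    ultimately show ?thesis by simp
  qed
  then obtain c where c: "c \<in> S.FS" "?f = S.f_mul (S.f_star c) c"
    using S.positive_is_square[OF E_closed sa] by blast
  then show ?thesis unfolding cs_pos_def
    by (intro bexI[of _ c]) (simp_all add: CSk_eq_finsupp cs_star_eq cs_mul_eq)
qed

text \<open>The double sum collapses: with \<open>y\<close> the sum of all \<open>a j\<close> times
  \<open>emb (b j)\<close>, the bimodule property makes it the expectation of the square of
  \<open>y\<close>. Complete positivity thus reduces to the case of a single element.\<close>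

lemma E_completely_positive:
  assumes "\<And>i. i < n \<Longrightarrow> a i \<in> FS \<and> b i \<in> S.FS"
  shows "cs_pos k (cs_sum (\<lambda>(i, j). S.f_mul (S.f_mul (S.f_star (b i)) (E (f_mul (f_star (a i)) (a j)))) (b j))
    ({..<n::nat} \<times> {..<n}))"
proof -
  define z where "z i = f_mul (a i) (emb (b i))" for i
  define y where "y = (\<lambda>m. \<Sum>j\<in>{..<n}. z j m)"
  have z: "z j \<in> FS" if "j \<in> {..<n}" for j using assms that by (simp add: z_def)
  have y: "y \<in> FS" "\<And>\<psi>. lp y \<psi> = (\<Sum>j\<in>{..<n}. lp (z j) \<psi>)"
    unfolding y_def using z by (auto intro!: finsupp_sum finsupp_sum(2)[where G=G])
  have "E (f_mul (f_star y) y) \<rho> = (\<Sum>i<n. \<Sum>j<n. E (f_mul (f_star (z i)) (z j)) \<rho>)" for \<rho>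
    using y(1) z by (simp add: E_def y(2) lp_sum_right) (intro impI, rule sum.swap)
  moreover have "E (f_mul (f_star (z i)) (z j))
      = S.f_mul (S.f_mul (S.f_star (b i)) (E (f_mul (f_star (a i)) (a j)))) (b j)"
    if "i < n" "j < n" for i j
    using assms[OF that(1)] assms[OF that(2)]
    by (simp add: z_def star_mul emb_star[symmetric] mul_assoc E_left[symmetric] E_right[symmetric])
  ultimately have "cs_sum (\<lambda>(i, j). S.f_mul (S.f_mul (S.f_star (b i)) (E (f_mul (f_star (a i)) (a j)))) (b j))
    ({..<n} \<times> {..<n}) = E (f_mul (f_star y) y)"
    by (simp add: cs_sum_def fun_eq_iff sum.cartesian_product split_def)
  then show ?thesis using E_star_mul_square[OF y(1)] by simp
qed

theorem Sk_prob_space_Alg: "Sk_prob_space k Alg E"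
proof -
  have cp: "cs_pos k (cs_sum (\<lambda>(i, j). cs_mul k (cs_mul k (cs_star k (b i)) (E (f_mul (f_star (a i)) (a j)))) (b j))
      ({..<n} \<times> {..<n}))"
    if "\<And>i. i < n \<Longrightarrow> a i \<in> FS \<and> b i \<in> CSk k" for n :: nat and a b
  proof -
    have "cs_sum (\<lambda>(i, j). cs_mul k (cs_mul k (cs_star k (b i)) (E (f_mul (f_star (a i)) (a j)))) (b j))
        ({..<n} \<times> {..<n})
      = cs_sum (\<lambda>(i, j). S.f_mul (S.f_mul (S.f_star (b i)) (E (f_mul (f_star (a i)) (a j)))) (b j))
        ({..<n} \<times> {..<n})"
      unfolding cs_sum_def
      by (intro ext sum.cong) (use that in \<open>auto simp: CSk_eq_finsupp cs_mul_eq cs_star_eq\<close>)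
    then show ?thesis using E_completely_positive[of n a b] that by (simp add: CSk_eq_finsupp)
  qed
  show ?thesis
    unfolding Sk_prob_space_def Let_def
    by (intro conjI star_algebra_star_alg)
      (use cp in \<open>auto simp: star_alg_def CSk_eq_finsupp cs_add_eq cs_smult_eq cs_u_eq_delta cs_mul_eq cs_star_eq
          emb_add emb_mul emb_smult emb_star emb_inj emb_delta u_id E_add E_smult E_one E_left E_right\<close>)
qed

end

section \<open>Non-crossing partitions and nested multilinear maps\<close>

definition crosses :: "nat set \<Rightarrow> nat set \<Rightarrow> bool" where
  "crosses B B' \<longleftrightarrow> (\<exists>a b c d. a < b \<and> b < c \<and> c < d \<and> a \<in> B \<and> c \<in> B \<and> b \<in> B' \<and> d \<in> B')"

definition noncrossing :: "nat set set \<Rightarrow> bool" where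
  "noncrossing \<xi> \<longleftrightarrow> (\<forall>B\<in>\<xi>. \<forall>B'\<in>\<xi>. B \<noteq> B' \<longrightarrow> \<not> crosses B B')"

lemma NC_iff: "\<xi> \<in> NC n \<longleftrightarrow> partition_on {1..n} \<xi> \<and> noncrossing \<xi>"
  by (simp add: NC_def noncrossing_def crosses_def)

lemma partition_block_eq:
  "partition_on A P \<Longrightarrow> B \<in> P \<Longrightarrow> B' \<in> P \<Longrightarrow> x \<in> B \<Longrightarrow> x \<in> B' \<Longrightarrow> B = B'"
  using partition_onD2 by (metis IntI disjoint_def empty_iff)

lemma partition_block_subset: "partition_on A P \<Longrightarrow> B \<in> P \<Longrightarrow> B \<subseteq> A"
  using partition_onD1 by blast

lemma partition_block_exists: "partition_on A P \<Longrightarrow> x \<in> A \<Longrightarrow> \<exists>B\<in>P. x \<in> B"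
  using partition_onD1 by blast

text \<open>A block of least spread \<open>Max B - Min B\<close> has no gaps: a missing point would
  belong to a block that cannot cross \<open>B\<close>, hence is trapped strictly between its end
  points and has smaller spread.\<close>

lemma noncrossing_has_interval_block:
  assumes "\<xi> \<in> NC n" "1 \<le> n"
  shows "\<exists>B\<in>\<xi>. \<exists>i n'. 1 \<le> n' \<and> B = {i..<i+n'}"
proof -
  have part: "partition_on {1..n} \<xi>" and nc: "noncrossing \<xi>" using assms(1) by (auto simp: NC_iff)
  have sub: "B \<subseteq> {1..n}" if "B \<in> \<xi>" for B using partition_block_subset[OF part that] .
  have fin: "finite B" if "B \<in> \<xi>" for B using sub[OF that] finite_subset by blast
  have ne: "B \<noteq> {}" if "B \<in> \<xi>" for B using partition_onD3[OF part] that by blast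
  have "\<xi> \<noteq> {}" using partition_onD1[OF part] assms(2) by auto
  then obtain B0 where "B0 \<in> \<xi>" by blast
  define B where "B = arg_min (\<lambda>B. Max B - Min B) (\<lambda>B. B \<in> \<xi>)"
  have B: "B \<in> \<xi>" unfolding B_def using arg_min_natI[where P="\<lambda>B. B \<in> \<xi>", OF \<open>B0 \<in> \<xi>\<close>] .
  have least: "Max B - Min B \<le> Max B' - Min B'" if "B' \<in> \<xi>" for B'
    unfolding B_def by (rule arg_min_nat_le[where P="\<lambda>B. B \<in> \<xi>"]) (rule that)
  have mem: "Min B \<in> B" "Max B \<in> B" using B fin ne by auto
  have "x \<in> B" if x: "Min B \<le> x" "x \<le> Max B" for x
  proof (rule ccontr)
    assume "x \<notin> B"
    then have lt: "Min B < x" "x < Max B" using x mem by (metis le_neq_implies_less)+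
    have "x \<in> {1..n}" using lt sub[OF B] mem by fastforce
    then obtain B' where B': "B' \<in> \<xi>" "x \<in> B'" using partition_block_exists[OF part] by blast
    then have "B' \<noteq> B" using \<open>x \<notin> B\<close> by blast
    have in1: "Min B < y \<and> y < Max B" if y: "y \<in> B'" for y
    proof -
      have "y \<noteq> Min B" "y \<noteq> Max B"
        using y mem partition_block_eq[OF part B'(1) B] \<open>B' \<noteq> B\<close> by blast+
      moreover have "\<not> y < Min B"
        using nc B B' lt y mem \<open>B' \<noteq> B\<close> unfolding noncrossing_def crosses_def by blast
      moreover have "\<not> y > Max B"
        using nc B B' lt y mem \<open>B' \<noteq> B\<close> unfolding noncrossing_def crosses_def by blast
      ultimately show ?thesis by linarith
    qed
    have "Min B' \<in> B'" "Max B' \<in> B'" using B'(1) fin ne by auto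
    with in1[of "Min B'"] in1[of "Max B'"] least[OF B'(1)]
    have "Max B - Min B \<le> Max B' - Min B'" "Min B < Min B'" "Max B' < Max B" "Min B' \<le> Max B'"
      using Min_le[OF fin[OF B'(1)], of "Max B'"] by auto
    then show False by linarith
  qed
  then have "{Min B..Max B} \<subseteq> B" by (auto simp: subset_iff)
  moreover have "B \<subseteq> {Min B..Max B}" using fin[OF B] by auto
  moreover have "Min B \<le> Max B" using fin[OF B] mem by simp
  then have "{Min B..Max B} = {Min B..<Min B + (Max B - Min B + 1)}" by auto
  ultimately have "B = {Min B..<Min B + (Max B - Min B + 1)}" by (metis subset_antisym)
  then show ?thesis using B by (metis le_add2)
qed

text \<open>The definite description is meaningful because two blocks with the same minimum share a
  point and therefore coincide.\<close>

lemma first_interval_block: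
  assumes part: "partition_on {1..n} \<xi>"
    and ex: "\<exists>B\<in>\<xi>. \<exists>i n'. 1 \<le> n' \<and> B = {i..<i+n'}"
  obtains i n' where "1 \<le> n'" "{i..<i+n'} \<in> \<xi>" "first_interval_block \<xi> = {i..<i+n'}"
    "\<And>i' n''. 1 \<le> n'' \<Longrightarrow> {i'..<i'+n''} \<in> \<xi> \<Longrightarrow> i \<le> i'"
proof -
  define I where "I = {B\<in>\<xi>. \<exists>i n'. 1 \<le> n' \<and> B = {i..<i+n'}}"
  have "I \<noteq> {}" using ex by (auto simp: I_def)
  then obtain B0 where "B0 \<in> I" by blast
  define B where "B = arg_min Min (\<lambda>B. B \<in> I)"
  have B: "B \<in> I" unfolding B_def using arg_min_natI[where P="\<lambda>B. B \<in> I", OF \<open>B0 \<in> I\<close>] .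
  have least: "Min B \<le> Min B'" if "B' \<in> I" for B'
    unfolding B_def by (rule arg_min_nat_le[where P="\<lambda>B. B \<in> I"]) (rule that)
  have mm: "Min C \<in> C" if "C \<in> I" for C
    using that unfolding I_def by (auto intro!: Min_in)
  have "first_interval_block \<xi> = (THE B. B \<in> I \<and> (\<forall>B'\<in>I. Min B \<le> Min B'))"
    by (simp add: first_interval_block_def I_def)
  also have "\<dots> = B"
  proof (rule the_equality)
    show "B \<in> I \<and> (\<forall>B'\<in>I. Min B \<le> Min B')" using B least by blast
    fix C assume C: "C \<in> I \<and> (\<forall>B'\<in>I. Min C \<le> Min B')"
    then have "Min C = Min B" using B least by (meson le_antisym)
    then have "Min B \<in> C" "Min B \<in> B" using mm B C by metis+
    then show "C = B" using partition_block_eq[OF part] B C unfolding I_def by blast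
  qed
  finally have fib: "first_interval_block \<xi> = B" .
  obtain i n' where i: "1 \<le> n'" "B = {i..<i+n'}" using B by (auto simp: I_def)
  have min: "Min {j..<j+m} = j" if "1 \<le> m" for j m :: nat
    using that by (intro Min_eqI) auto
  have "i \<le> i'" if "1 \<le> n''" "{i'..<i'+n''} \<in> \<xi>" for i' n''
  proof -
    have "{i'..<i'+n''} \<in> I" using that unfolding I_def by blast
    then show ?thesis using least[of "{i'..<i'+n''}"] min[OF that(1)] min[OF i(1)] i(2) by simp
  qed
  with i fib B show ?thesis by (intro that[of n' i]) (auto simp: I_def)
qed

section \<open>Removal of an interval block\<close>

definition relab :: "nat \<Rightarrow> nat \<Rightarrow> nat \<Rightarrow> nat" where
  "relab i n' j = (if j < i then j else j - n')"

definition del_block :: "nat \<Rightarrow> nat \<Rightarrow> nat set set \<Rightarrow> nat set set" where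
  "del_block i n' \<xi> = (\<lambda>B. relab i n' ` B) ` (\<xi> - {{i..<i+n'}})"

context
  fixes n i n' :: nat and \<xi> :: "nat set set"
  assumes part: "partition_on {1..n} \<xi>" and blk: "{i..<i+n'} \<in> \<xi>" and n': "1 \<le> n'"
begin

lemma interval_bounds: "1 \<le> i" "i + n' \<le> n + 1"
proof -
  have "{i..<i+n'} \<subseteq> {1..n}" by (rule partition_block_subset[OF part blk])
  moreover have "i \<in> {i..<i+n'}" "i + n' - 1 \<in> {i..<i+n'}" using n' by auto
  ultimately have "i \<in> {1..n}" "i + n' - 1 \<in> {1..n}" by blast+
  then show "1 \<le> i" "i + n' \<le> n + 1" by auto
qed

lemma relab_strict_mono:
  "x \<notin> {i..<i+n'} \<Longrightarrow> y \<notin> {i..<i+n'} \<Longrightarrow> x < y \<longleftrightarrow> relab i n' x < relab i n' y"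
  by (auto simp: relab_def)

lemma relab_inj: "inj_on (relab i n') ({1..n} - {i..<i+n'})"
  by (auto simp: inj_on_def relab_def split: if_splits)

lemma relab_image: "relab i n' ` ({1..n} - {i..<i+n'}) = {1..n-n'}"
proof
  show "relab i n' ` ({1..n} - {i..<i+n'}) \<subseteq> {1..n-n'}"
    using interval_bounds n' by (auto simp: relab_def)
  show "{1..n-n'} \<subseteq> relab i n' ` ({1..n} - {i..<i+n'})"
  proof
    fix x assume x: "x \<in> {1..n-n'}"
    show "x \<in> relab i n' ` ({1..n} - {i..<i+n'})"
    proof (cases "x < i")
      case True
      then show ?thesis using x by (intro image_eqI[of _ _ x]) (auto simp: relab_def)
    next
      case False
      then show ?thesis using x by (intro image_eqI[of _ _ "x + n'"]) (auto simp: relab_def)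
    qed
  qed
qed

lemma other_blocks: "B \<in> \<xi> - {{i..<i+n'}} \<Longrightarrow> B \<subseteq> {1..n} - {i..<i+n'}"
  using partition_block_eq[OF part _ blk] partition_block_subset[OF part] by blast

lemma partition_on_del_block: "partition_on {1..n-n'} (del_block i n' \<xi>)"
proof -
  have d: "disjnt {i..<i+n'} (\<Union>(\<xi> - {{i..<i+n'}}))"
    unfolding disjnt_iff using other_blocks by blast
  have "partition_on {1..n} (insert {i..<i+n'} (\<xi> - {{i..<i+n'}}))"
    using part blk by (simp only: insert_Diff)
  then have "partition_on ({1..n} - {i..<i+n'}) (\<xi> - {{i..<i+n'}})"
    using partition_on_insert[OF d] by blast
  from partition_on_inj_image[OF this relab_inj]
  have "partition_on {1..n-n'} ((`) (relab i n') ` (\<xi> - {{i..<i+n'}}) - {{}})"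
    by (simp only: relab_image)
  moreover have "{} \<notin> (`) (relab i n') ` (\<xi> - {{i..<i+n'}})"
  proof
    assume "{} \<in> (`) (relab i n') ` (\<xi> - {{i..<i+n'}})"
    then have "{} \<in> \<xi>" by (metis (no_types, lifting) DiffD1 imageE image_is_empty)
    then show False using partition_onD3[OF part] by blast
  qed
  then have "(`) (relab i n') ` (\<xi> - {{i..<i+n'}}) - {{}} = (`) (relab i n') ` (\<xi> - {{i..<i+n'}})"
    by (rule Diff_insert0[of _ _ "{}", simplified])
  ultimately show ?thesis by (simp only: del_block_def)
qed

lemma relab_image_inj: "inj_on ((`) (relab i n')) (\<xi> - {{i..<i+n'}})"
  by (rule inj_on_image, rule inj_on_subset[OF relab_inj], rule Union_least, rule other_blocks)

lemma card_del_block: "card \<xi> = Suc (card (del_block i n' \<xi>))"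
proof -
  have "finite \<xi>" using part finite_elements by blast
  then have "card \<xi> = Suc (card (\<xi> - {{i..<i+n'}}))"
    using blk by (rule card.remove)
  then show ?thesis unfolding del_block_def card_image[OF relab_image_inj] .
qed

text \<open>An interval block crosses nothing, since a point between two of its points is its own;
  and relabelling preserves the order of the remaining points, hence their crossings.\<close>

lemma noncrossing_del_block: "noncrossing (del_block i n' \<xi>) \<longleftrightarrow> noncrossing \<xi>"
proof -
  define B0 where "B0 = {i..<i+n'}"
  have nB: "\<not> crosses B B'"
    if "B \<in> \<xi>" "B' \<in> \<xi>" "B \<noteq> B'" "B = B0 \<or> B' = B0" for B B'
  proof
    assume "crosses B B'"
    then obtain a b c d where *: "a < b" "b < c" "c < d" "a \<in> B" "c \<in> B" "b \<in> B'" "d \<in> B'" unfolding crosses_def by blast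
    show False using that(4)
    proof
      assume "B = B0"
      then have "b \<in> B" using * by (auto simp: B0_def)
      then show False using partition_block_eq[OF part that(1,2)] * that(3) by blast
    next
      assume "B' = B0"
      then have "c \<in> B'" using * by (auto simp: B0_def)
      then show False using partition_block_eq[OF part that(1,2)] * that(3) by blast
    qed
  qed
  have ord: "relab i n' x < relab i n' y \<longleftrightarrow> x < y"
    if "B \<in> \<xi> - {B0}" "B' \<in> \<xi> - {B0}" "x \<in> B" "y \<in> B'" for B B' x y
    using relab_strict_mono[of x y] other_blocks[of B] other_blocks[of B'] that
    unfolding B0_def by blast
  have cr: "crosses B B' \<longleftrightarrow> crosses (relab i n' ` B) (relab i n' ` B')" (is "?L \<longleftrightarrow> ?R")
    if BB': "B \<in> \<xi> - {B0}" "B' \<in> \<xi> - {B0}" for B B'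
  proof
    assume ?L
    then obtain a b c d where *: "a < b" "b < c" "c < d" "a \<in> B" "c \<in> B" "b \<in> B'" "d \<in> B'" unfolding crosses_def by blast
    let ?r = "relab i n'"
    have "?r a < ?r b" "?r b < ?r c" "?r c < ?r d"
      using * ord[OF BB'] ord[OF BB'(2,1)] by blast+
    then show ?R unfolding crosses_def using * by blast
  next
    assume ?R
    then obtain a b c d where *: "relab i n' a < relab i n' b" "relab i n' b < relab i n' c"
      "relab i n' c < relab i n' d" "a \<in> B" "c \<in> B" "b \<in> B'" "d \<in> B'" unfolding crosses_def by blast
    then have "a < b" "b < c" "c < d" using ord[OF BB'] ord[OF BB'(2,1)] by blast+
    then show ?L unfolding crosses_def using * by blast
  qed
  have neq: "relab i n' ` B = relab i n' ` B' \<longleftrightarrow> B = B'" if "B \<in> \<xi> - {B0}" "B' \<in> \<xi> - {B0}" for B B'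
    using inj_on_eq_iff[OF relab_image_inj] that unfolding B0_def by blast
  have "noncrossing (del_block i n' \<xi>) \<longleftrightarrow>
      (\<forall>B\<in>\<xi>-{B0}. \<forall>B'\<in>\<xi>-{B0}. relab i n' ` B \<noteq> relab i n' ` B' \<longrightarrow>
        \<not> crosses (relab i n' ` B) (relab i n' ` B'))"
    unfolding noncrossing_def del_block_def B0_def[symmetric] by auto
  also have "\<dots> \<longleftrightarrow> (\<forall>B\<in>\<xi>-{B0}. \<forall>B'\<in>\<xi>-{B0}. B \<noteq> B' \<longrightarrow> \<not> crosses B B')"
    by (intro ball_cong refl) (simp only: cr neq)
  also have "\<dots> \<longleftrightarrow> noncrossing \<xi>"
    unfolding noncrossing_def
  proof (intro iffI ballI impI)
    fix B B' assume *: "\<forall>B\<in>\<xi>-{B0}. \<forall>B'\<in>\<xi>-{B0}. B \<noteq> B' \<longrightarrow> \<not> crosses B B'" "B \<in> \<xi>" "B' \<in> \<xi>" "B \<noteq> B'"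
    show "\<not> crosses B B'"
    proof (cases "B = B0 \<or> B' = B0")
      case True then show ?thesis using nB * by blast
    next
      case False then show ?thesis using * by blast
    qed
  qed blast
  finally show ?thesis .
qed

lemma NC_del_block: "del_block i n' \<xi> \<in> NC (n - n') \<longleftrightarrow> \<xi> \<in> NC n"
  using partition_on_del_block noncrossing_del_block part by (simp add: NC_iff)

end

lemma partition_whole_block:
  assumes "partition_on A P" "A \<in> P" "A \<noteq> {}"
  shows "P = {A}"
proof -
  have "B = A" if "B \<in> P" for B
  proof -
    have "B \<noteq> {}" using that partition_onD3[OF assms(1)] by blast
    then obtain x where "x \<in> B" by blast
    moreover from this have "x \<in> A" using partition_block_subset[OF assms(1) that] by blast
    ultimately show ?thesis using partition_block_eq[OF assms(1) that assms(2)] by blast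
  qed
  with assms(2) show ?thesis by blast
qed

lemma NC_step:
  assumes "\<xi> \<in> NC n" "1 \<le> n" "\<xi> \<noteq> {{1..n}}"
  obtains i n' where "1 \<le> n'" "{i..<i+n'} \<in> \<xi>" "first_interval_block \<xi> = {i..<i+n'}"
    "\<And>i' n''. 1 \<le> n'' \<Longrightarrow> {i'..<i'+n''} \<in> \<xi> \<Longrightarrow> i \<le> i'"
    "1 \<le> i" "i + n' \<le> n + 1" "n' < n" "del_block i n' \<xi> \<in> NC (n - n')"
    "card \<xi> = Suc (card (del_block i n' \<xi>))"
proof -
  have part: "partition_on {1..n} \<xi>" using assms(1) by (simp add: NC_iff)
  obtain i n' where i: "1 \<le> n'" "{i..<i+n'} \<in> \<xi>" "first_interval_block \<xi> = {i..<i+n'}"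
    "\<And>i' n''. 1 \<le> n'' \<Longrightarrow> {i'..<i'+n''} \<in> \<xi> \<Longrightarrow> i \<le> i'"
    using first_interval_block[OF part noncrossing_has_interval_block[OF assms(1,2)]] by metis
  have bounds: "1 \<le> i" "i + n' \<le> n + 1" using interval_bounds[OF part i(2,1)] by auto
  have "n' \<noteq> n"
  proof
    assume "n' = n"
    then have "{i..<i+n'} = {1..n}" using bounds by auto
    then show False using partition_whole_block[OF part, folded \<open>{i..<i+n'} = {1..n}\<close>] i(2) assms(2,3) by simp
  qed
  then have "n' < n" using bounds by auto
  moreover have "del_block i n' \<xi> \<in> NC (n - n')" using NC_del_block[OF part i(2,1)] assms(1) by blast
  ultimately show ?thesis using that[of n' i] i bounds card_del_block[OF part i(2,1)] by blast
qed

lemma finite_NC: "finite (NC n)"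
  by (rule finite_subset[OF _ finitely_many_partition_on[of "{1..n}"]]) (auto simp: NC_iff)

lemma NC_top: "1 \<le> n \<Longrightarrow> {{1..n}} \<in> NC n"
  by (auto simp: NC_iff noncrossing_def intro!: partition_on_space)

section \<open>Recursion of the nested maps\<close>

definition contract :: "'a salg \<Rightarrow> (nat \<Rightarrow> 'a list \<Rightarrow> cs) \<Rightarrow> nat \<Rightarrow> nat \<Rightarrow> 'a list \<Rightarrow> 'a list" where
  "contract A K i n' as =
    (let inner = a_emb A (K n' (take n' (drop (i - 1) as)))
     in if i = 1 then a_mul A inner (as ! n') # drop (n' + 1) as
        else take (i - 2) as @ [a_mul A (as ! (i - 2)) inner] @ drop (i - 1 + n') as)"

lemma nc_ext_top: "1 \<le> length as \<Longrightarrow> nc_ext A K {{1..length as}} as = K (length as) as"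
  by (simp add: nc_ext_def)

text \<open>One unfolding of \<open>ncx\<close>. Its fuel is the number of blocks, so the fuel left
  over must be the number of blocks of the reduced partition; the hypothesis on cardinalities
  records this.\<close>

lemma nc_ext_step:
  assumes "first_interval_block \<xi> = {i..<i+n'}" "1 \<le> n'" "\<xi> \<noteq> {{1..length as}}"
    "card \<xi> = Suc (card (del_block i n' \<xi>))"
  shows "nc_ext A K \<xi> as = nc_ext A K (del_block i n' \<xi>) (contract A K i n' as)"
proof -
  have *: "Min {i..<i+n'} = i" using assms(2) by (intro Min_eqI) auto
  have "nc_ext A K \<xi> as = ncx (Suc (card (del_block i n' \<xi>))) A K \<xi> as"
    by (simp only: nc_ext_def assms(4))
  also have "\<dots> = ncx (card (del_block i n' \<xi>)) A K (del_block i n' \<xi>) (contract A K i n' as)"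
    by (simp only: ncx.simps assms(1) Let_def * card_atLeastLessThan diff_add_inverse if_not_P[OF assms(3)]
        contract_def del_block_def relab_def[abs_def])
  finally show ?thesis by (simp only: nc_ext_def)
qed

lemma length_contract:
  assumes "1 \<le> i" "1 \<le> n'" "i + n' \<le> length as + 1" "n' < length as"
  shows "length (contract A K i n' as) = length as - n'"
  using assms by (auto simp: contract_def Let_def)

section \<open>Cumulants by recursion on the order\<close>

context Sk_trace
begin

text \<open>The formula of order \<open>n\<close> determines the one-block term once all lower
  orders are known. Since \<open>nc_ext\<close> takes a whole family as argument, the recursion
  builds tables up to order \<open>m\<close> instead of single maps.\<close>

primrec cumulant_upto :: "nat \<Rightarrow> nat \<Rightarrow> ('m \<Rightarrow> complex) list \<Rightarrow> cs" where
  "cumulant_upto 0 = (\<lambda>_ _. \<lambda>_. 0)"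
| "cumulant_upto (Suc m) = (\<lambda>j as. if j = Suc m then
      (\<lambda>\<eta>. E (a_prod Alg as) \<eta> - (\<Sum>\<xi>\<in>NC (Suc m) - {{{1..Suc m}}}. nc_ext Alg (cumulant_upto m) \<xi> as \<eta>))
      else cumulant_upto m j as)"

definition cumulant :: "nat \<Rightarrow> ('m \<Rightarrow> complex) list \<Rightarrow> cs" where
  "cumulant n = cumulant_upto n n"

lemma cumulant_upto_eq: "j \<le> m \<Longrightarrow> cumulant_upto m j = cumulant j"
  by (induction m) (auto simp: cumulant_def fun_eq_iff le_Suc_eq)

end

text \<open>\<open>V\<close> is closed under linear combinations and the bimodule operations but
  need not be closed under products. Contraction multiplies an entry by an element of the group
  algebra, so all lists met in the recursion keep their entries in \<open>V\<close>. The choice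
  \<open>FS\<close> gives existence of cumulants; the span of one-letter elements serves for
  circularity.\<close>

locale Sk_submodule = Sk_trace G opr e st k u \<phi>
  for G :: "'m set" and opr e st k u \<phi> +
  fixes V :: "('m \<Rightarrow> complex) set"
  assumes V_sub: "V \<subseteq> FS"
    and V_add [simp]: "x \<in> V \<Longrightarrow> y \<in> V \<Longrightarrow> f_add x y \<in> V"
    and V_smult [simp]: "x \<in> V \<Longrightarrow> f_smult a x \<in> V"
    and V_left [simp]: "x \<in> V \<Longrightarrow> b \<in> S.FS \<Longrightarrow> f_mul (emb b) x \<in> V"
    and V_right [simp]: "x \<in> V \<Longrightarrow> b \<in> S.FS \<Longrightarrow> f_mul x (emb b) \<in> V"
begin

lemma V_FS [simp]: "x \<in> V \<Longrightarrow> x \<in> FS"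
  using V_sub by blast

lemma Alg_simps [simp]: "a_mul Alg = f_mul" "a_emb Alg = emb" "a_carrier Alg = FS" "a_one Alg = delta e"
  "a_star Alg = f_star"
  by (simp_all add: star_alg_def)

text \<open>An arbitrary family need not take values in the group algebra, while the bimodule
  properties of \<open>V\<close> concern only such values. The bound \<open>n\<close> confines the
  demand to the lengths that the recursion reaches.\<close>

definition Kvalid :: "nat \<Rightarrow> (nat \<Rightarrow> ('m \<Rightarrow> complex) list \<Rightarrow> cs) \<Rightarrow> bool" where
  "Kvalid n K \<longleftrightarrow> (\<forall>as. 1 \<le> length as \<and> length as \<le> n \<and> set as \<subseteq> V \<longrightarrow> K (length as) as \<in> S.FS)"

lemma KvalidD:
  "Kvalid n K \<Longrightarrow> length as = m \<Longrightarrow> 1 \<le> m \<Longrightarrow> m \<le> n \<Longrightarrow> set as \<subseteq> V \<Longrightarrow> K m as \<in> S.FS"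
  by (auto simp: Kvalid_def)

lemma take_drop_V:
  assumes "set as \<subseteq> V" "i + n' \<le> length as + 1" "1 \<le> i"
  shows "length (take n' (drop (i - 1) as)) = n'" "set (take n' (drop (i - 1) as)) \<subseteq> V"
proof -
  show "length (take n' (drop (i - 1) as)) = n'" using assms by simp
  show "set (take n' (drop (i - 1) as)) \<subseteq> V"
    using assms(1) set_take_subset set_drop_subset by (metis subset_trans)
qed

lemma contract_V:
  assumes "set as \<subseteq> V" "Kvalid n K" "n' \<le> n" "1 \<le> i" "1 \<le> n'" "i + n' \<le> length as + 1" "n' < length as"
  shows "set (contract Alg K i n' as) \<subseteq> V"
proof -
  let ?in = "K n' (take n' (drop (i - 1) as))"
  note td = take_drop_V[OF assms(1,6,4)]
  have inner: "?in \<in> S.FS"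
    by (rule KvalidD[OF assms(2) td(1) assms(5,3) td(2)])
  have nth: "as ! j \<in> V" if "j < length as" for j using assms(1) that by auto
  have td': "set (take m as) \<subseteq> V" "set (drop m as) \<subseteq> V" for m
    using assms(1) set_take_subset[of m as] set_drop_subset[of m as] by auto
  show ?thesis
    using inner nth td'[of "i - 2"] td' assms(4-) by (auto simp: contract_def Let_def)
qed

text \<open>The hypothesis on the maps is only required below the number of points unless the partition is
  the one-block partition; this is what makes the cumulants computable by recursion.\<close>

lemma nc_ext_cong:
  assumes "\<xi> \<in> NC (length as)" "1 \<le> length as" "set as \<subseteq> V" "Kvalid n K"
    and "\<And>bs. 1 \<le> length bs \<Longrightarrow> length bs \<le> n \<Longrightarrow> set bs \<subseteq> V \<Longrightarrow> K (length bs) bs = K' (length bs) bs"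
    and "length as \<le> n \<or> (length as \<le> Suc n \<and> \<xi> \<noteq> {{1..length as}})"
  shows "nc_ext Alg K \<xi> as = nc_ext Alg K' \<xi> as"
  using assms(1-3,6)
proof (induction "length as" arbitrary: as \<xi> rule: less_induct)
  case less
  show ?case
  proof (cases "\<xi> = {{1..length as}}")
    case True
    then show ?thesis using less.prems assms(5)[of as] nc_ext_top by metis
  next
    case False
    obtain i n' where i: "1 \<le> n'" "{i..<i+n'} \<in> \<xi>" "first_interval_block \<xi> = {i..<i+n'}"
      "1 \<le> i" "i + n' \<le> length as + 1" "n' < length as" "del_block i n' \<xi> \<in> NC (length as - n')"
      "card \<xi> = Suc (card (del_block i n' \<xi>))"
      using NC_step[OF less.prems(1,2) False] by metis
    have n': "n' \<le> n" using i(6) less.prems(4) by auto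
    note td = take_drop_V[OF less.prems(3) i(5,4)]
    have "K n' (take n' (drop (i - 1) as)) = K' n' (take n' (drop (i - 1) as))"
      using assms(5)[of "take n' (drop (i - 1) as)"] td i(1) n' by metis
    then have eq: "contract Alg K i n' as = contract Alg K' i n' as"
      by (simp add: contract_def)
    have len: "length (contract Alg K i n' as) = length as - n'"
      using length_contract i by blast
    have "nc_ext Alg K (del_block i n' \<xi>) (contract Alg K i n' as)
        = nc_ext Alg K' (del_block i n' \<xi>) (contract Alg K i n' as)"
      by (rule less.hyps)
        (use len i n' less.prems contract_V[OF less.prems(3) assms(4) n' i(4,1,5,6)] in auto)
    then show ?thesis
      using nc_ext_step[OF i(3,1) False i(8)] eq by metis
  qed
qed

section \<open>Multilinearity of the nested maps\<close>

definition slot_linear :: "nat \<Rightarrow> (('m \<Rightarrow> complex) list \<Rightarrow> cs) \<Rightarrow> bool" where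
  "slot_linear n F \<longleftrightarrow> (\<forall>as p x y. length as = n \<and> set as \<subseteq> V \<and> p < n \<and> x \<in> V \<and> y \<in> V \<longrightarrow>
     F (as[p := f_add x y]) = f_add (F (as[p := x])) (F (as[p := y])) \<and>
     (\<forall>a. F (as[p := f_smult a x]) = f_smult a (F (as[p := x]))))"

definition lin_op :: "(('m \<Rightarrow> complex) \<Rightarrow> 'm \<Rightarrow> complex) \<Rightarrow> bool" where
  "lin_op g \<longleftrightarrow> (\<forall>x\<in>V. g x \<in> V \<and> (\<forall>y\<in>V. g (f_add x y) = f_add (g x) (g y)) \<and>
     (\<forall>a. g (f_smult a x) = f_smult a (g x)))"

text \<open>A change in slot \<open>p\<close> appears in a single slot \<open>q\<close> of the
  contracted list, through a linear map \<open>g\<close>: the identity away from the block, a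
  multiplication at the neighbour, and passage through the inner map for slots of the block.
  Multilinearity is thereby pushed down the recursion.\<close>

lemma contract_slot:
  assumes as: "set as \<subseteq> V" and K: "Kvalid n' K" "slot_linear n' (K n')"
    and i: "1 \<le> i" "1 \<le> n'" "i + n' \<le> length as + 1" "n' < length as" and p: "p < length as"
  obtains q g bs where "q < length as - n'" "length bs = length as - n'" "set bs \<subseteq> V" "lin_op g"
    "\<And>x. x \<in> V \<Longrightarrow> contract Alg K i n' (as[p := x]) = bs[q := g x]"
proof -
  define sub where "sub = take n' (drop (i - 1) as)"
  note td = take_drop_V[OF as i(3,1), folded sub_def]
  have Ksub: "K n' (sub[q := x]) \<in> S.FS" if "x \<in> V" for q x
    by (rule KvalidD[OF K(1) _ i(2) order_refl])
      (use td that set_update_subset_insert[of sub q x] in auto)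
  have Ks: "K n' sub \<in> S.FS" by (rule KvalidD[OF K(1) td(1) i(2) order_refl td(2)])
  have nth: "as ! j \<in> V" if "j < length as" for j using as that by auto
  define bs where "bs = contract Alg K i n' as"
  have bs: "length bs = length as - n'" "set bs \<subseteq> V"
    using length_contract[OF i, of Alg K] contract_V[OF as K(1) order_refl i] by (simp_all add: bs_def)
  have lin_id: "lin_op (\<lambda>x. x)" by (simp add: lin_op_def)
  have lin1: "lin_op (\<lambda>x. f_mul x (emb (K n' sub)))" "lin_op (\<lambda>x. f_mul (emb (K n' sub)) x)"
    using Ks by (simp_all add: lin_op_def mul_add mul_smult)
  have Klin: "K n' (sub[q := f_add x y]) = f_add (K n' (sub[q := x])) (K n' (sub[q := y]))"
    "K n' (sub[q := f_smult a x]) = f_smult a (K n' (sub[q := x]))"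
    if "x \<in> V" "y \<in> V" "q < n'" for x y q a
    using K(2) td that unfolding slot_linear_def by blast+
  have lin2: "lin_op (\<lambda>x. f_mul z (emb (K n' (sub[q := x]))))" "lin_op (\<lambda>x. f_mul (emb (K n' (sub[q := x]))) z)"
    if "q < n'" "z \<in> V" for q z
    using that Ksub Klin by (simp_all add: lin_op_def mul_add mul_smult emb_add emb_smult)
  show ?thesis
  proof (cases "i = 1")
    case True
    have sub': "take n' as = sub" by (simp add: sub_def True)
    have form: "contract Alg K i n' (as[p := x])
        = f_mul (emb (K n' (take n' (as[p := x])))) (as[p := x] ! n') # drop (n' + 1) (as[p := x])" for x
      by (simp add: contract_def True Let_def)
    consider "p < n'" | "p = n'" | "p > n'" by linarith
    then show ?thesis
    proof cases
      case 1
      show ?thesis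
      proof (rule that[of 0 bs "\<lambda>x. f_mul (emb (K n' (sub[p := x]))) (as ! n')"])
        fix x assume "x \<in> V"
        show "contract Alg K i n' (as[p := x]) = bs[0 := f_mul (emb (K n' (sub[p := x]))) (as ! n')]"
          unfolding form using 1 by (simp add: bs_def contract_def True Let_def take_update_swap sub_def)
      qed (use 1 i bs nth lin2 in auto)
    next
      case 2
      show ?thesis
      proof (rule that[of 0 bs "\<lambda>x. f_mul (emb (K n' sub)) x"])
        fix x assume "x \<in> V"
        show "contract Alg K i n' (as[p := x]) = bs[0 := f_mul (emb (K n' sub)) x]"
          unfolding form using 2 p by (simp add: bs_def contract_def True Let_def sub_def)
      qed (use 2 i bs lin1 in auto)
    next
      case 3
      show ?thesis
      proof (rule that[of "p - n'" bs "\<lambda>x. x"])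
        fix x assume "x \<in> V"
        have "p - n' = Suc (p - Suc n')" using 3 by simp
        then show "contract Alg K i n' (as[p := x]) = bs[p - n' := x]"
          unfolding form using 3 p by (simp add: bs_def contract_def True Let_def drop_update_swap)
      qed (use 3 p i bs lin_id in auto)
    qed
  next
    case False
    then have i2: "i \<ge> 2" using i by simp
    have form: "contract Alg K i n' (as[p := x])
        = take (i - 2) (as[p := x]) @ [f_mul (as[p := x] ! (i - 2)) (emb (K n' (take n' (drop (i - 1) (as[p := x])))))]
          @ drop (i - 1 + n') (as[p := x])" for x
      using False by (simp add: contract_def Let_def)
    have bsf: "bs = take (i - 2) as @ [f_mul (as ! (i - 2)) (emb (K n' sub))] @ drop (i - 1 + n') as"
      using False by (simp add: bs_def contract_def Let_def sub_def)
    \<comment> \<open>Lists are indexed from zero: \<open>i - 2\<close> is the left neighbour of the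
      block, and the block occupies the \<open>n'\<close> indices starting at
      \<open>i - 1\<close>.\<close>
    consider "p < i - 2" | "p = i - 2" | "p \<ge> i - 1" "p < i - 1 + n'" | "p \<ge> i - 1 + n'" by linarith
    then show ?thesis
    proof cases
      case 1
      show ?thesis
      proof (rule that[of p bs "\<lambda>x. x"])
        fix x assume "x \<in> V"
        show "contract Alg K i n' (as[p := x]) = bs[p := x]"
          unfolding form bsf using 1 p i by (simp add: take_update_swap list_update_append sub_def)
      qed (use 1 p i bs lin_id in auto)
    next
      case 2
      show ?thesis
      proof (rule that[of "i - 2" bs "\<lambda>x. f_mul x (emb (K n' sub))"])
        fix x assume "x \<in> V"
        show "contract Alg K i n' (as[p := x]) = bs[i - 2 := f_mul x (emb (K n' sub))]"
          unfolding form bsf using 2 p i i2 by (simp add: list_update_append sub_def)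
      qed (use 2 p i bs lin1 in auto)
    next
      case 3
      show ?thesis
      proof (rule that[of "i - 2" bs "\<lambda>x. f_mul (as ! (i - 2)) (emb (K n' (sub[p - (i - 1) := x])))"])
        fix x assume "x \<in> V"
        show "contract Alg K i n' (as[p := x])
          = bs[i - 2 := f_mul (as ! (i - 2)) (emb (K n' (sub[p - (i - 1) := x])))]"
          unfolding form bsf using 3 p i i2
          by (simp add: list_update_append sub_def drop_update_swap take_update_swap[of n'])
      next
        show "lin_op (\<lambda>x. f_mul (as ! (i - 2)) (emb (K n' (sub[p - (i - 1) := x]))))"
          using 3 i i2 by (intro lin2 nth) auto
      qed (use 3 p i bs in auto)
    next
      case 4
      show ?thesis
      proof (rule that[of "p - n'" bs "\<lambda>x. x"])
        fix x assume "x \<in> V"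
        have "p - n' - (i - 2) = Suc (p - (i - 1 + n'))" "\<not> p - n' < i - 2" using 4 i2 by simp_all
        then show "contract Alg K i n' (as[p := x]) = bs[p - n' := x]"
          unfolding form bsf using 4 p i i2
          by (simp add: list_update_append sub_def drop_update_swap)
      qed (use 4 p i bs lin_id in auto)
    qed
  qed
qed

lemma nc_ext_slot_linear:
  assumes "\<xi> \<in> NC n" "1 \<le> n" "Kvalid n K" "\<And>m. 1 \<le> m \<Longrightarrow> m \<le> n \<Longrightarrow> slot_linear m (K m)"
  shows "slot_linear n (nc_ext Alg K \<xi>)"
  using assms
proof (induction n arbitrary: \<xi> rule: less_induct)
  case (less n)
  show ?case
  proof (cases "\<xi> = {{1..n}}")
    case True
    have "nc_ext Alg K \<xi> as = K n as" if "length as = n" for as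
      using nc_ext_top[of as] that True less.prems(2) by metis
    moreover have "slot_linear n (K n)" using less.prems(4)[of n] less.prems(2) by simp
    ultimately show ?thesis unfolding slot_linear_def by (metis length_list_update)
  next
    case False
    obtain i n' where i: "1 \<le> n'" "{i..<i+n'} \<in> \<xi>" "first_interval_block \<xi> = {i..<i+n'}"
      "1 \<le> i" "i + n' \<le> n + 1" "n' < n" "del_block i n' \<xi> \<in> NC (n - n')"
      "card \<xi> = Suc (card (del_block i n' \<xi>))"
      using NC_step[OF less.prems(1,2) False] by metis
    have Kv: "Kvalid m K" if "m \<le> n" for m using less.prems(3) that by (auto simp: Kvalid_def)
    have IH: "slot_linear (n - n') (nc_ext Alg K (del_block i n' \<xi>))"
      by (rule less.IH) (use i less.prems Kv[of "n - n'"] in auto)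
    have step: "nc_ext Alg K \<xi> as = nc_ext Alg K (del_block i n' \<xi>) (contract Alg K i n' as)"
      if "length as = n" for as
      by (rule nc_ext_step[OF i(3,1) _ i(8)]) (use False that in simp)
    show ?thesis unfolding slot_linear_def
    proof (intro allI impI)
      fix as p x y
      assume "length as = n \<and> set as \<subseteq> V \<and> p < n \<and> x \<in> V \<and> y \<in> V"
      then have as: "length as = n" "set as \<subseteq> V" "p < n" "x \<in> V" "y \<in> V" by auto
      obtain q g bs where q: "q < length as - n'" "length bs = length as - n'" "set bs \<subseteq> V" "lin_op g"
        "\<And>x. x \<in> V \<Longrightarrow> contract Alg K i n' (as[p := x]) = bs[q := g x]"
        using contract_slot[OF as(2) Kv[OF less_imp_le[OF i(6)]] less.prems(4)[OF i(1) less_imp_le[OF i(6)]] i(4,1)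
            i(5)[folded as(1)] i(6)[folded as(1)] as(3)[folded as(1)]] by metis
      have g: "g x \<in> V" "g y \<in> V" "g (f_add x y) = f_add (g x) (g y)" "g (f_smult a x) = f_smult a (g x)" for a
        using q(4) as unfolding lin_op_def by blast+
      show "nc_ext Alg K \<xi> (as[p := f_add x y]) = f_add (nc_ext Alg K \<xi> (as[p := x])) (nc_ext Alg K \<xi> (as[p := y])) \<and>
        (\<forall>a. nc_ext Alg K \<xi> (as[p := f_smult a x]) = f_smult a (nc_ext Alg K \<xi> (as[p := x])))"
        using IH q as g by (simp add: step slot_linear_def)
    qed
  qed
qed

lemma nc_ext_closed:
  assumes "\<xi> \<in> NC n" "1 \<le> n" "Kvalid n K" "length as = n" "set as \<subseteq> V"
  shows "nc_ext Alg K \<xi> as \<in> S.FS"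
  using assms
proof (induction n arbitrary: \<xi> as rule: less_induct)
  case (less n)
  show ?case
  proof (cases "\<xi> = {{1..n}}")
    case True
    then show ?thesis using nc_ext_top[of as Alg K] KvalidD[OF less.prems(3,4,2) _ less.prems(5)] less.prems by auto
  next
    case False
    obtain i n' where i: "1 \<le> n'" "{i..<i+n'} \<in> \<xi>" "first_interval_block \<xi> = {i..<i+n'}"
      "1 \<le> i" "i + n' \<le> n + 1" "n' < n" "del_block i n' \<xi> \<in> NC (n - n')"
      "card \<xi> = Suc (card (del_block i n' \<xi>))"
      using NC_step[OF less.prems(1,2) False] by metis
    have Kv: "Kvalid m K" if "m \<le> n" for m using less.prems(3) that by (auto simp: Kvalid_def)
    have "set (contract Alg K i n' as) \<subseteq> V"
      by (rule contract_V[OF less.prems(5) Kv[of n'] order_refl i(4,1)]) (use i less.prems in auto)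
    moreover have "length (contract Alg K i n' as) = n - n'"
      using length_contract[of i n' as Alg K] i less.prems by auto
    ultimately have "nc_ext Alg K (del_block i n' \<xi>) (contract Alg K i n' as) \<in> S.FS"
      by (intro less.IH[of "n - n'"]) (use i Kv in auto)
    moreover have "nc_ext Alg K \<xi> as = nc_ext Alg K (del_block i n' \<xi>) (contract Alg K i n' as)"
      by (rule nc_ext_step[OF i(3,1) _ i(8)]) (use False less.prems in simp)
    ultimately show ?thesis by simp
  qed
qed

lemma slot_linear_zero:
  assumes "slot_linear n F" "length as = n" "set as \<subseteq> V" "(\<lambda>_. 0) \<in> set as"
  shows "F as = (\<lambda>_. 0)"
proof -
  obtain p where p: "p < n" "as ! p = (\<lambda>_. 0)" using assms(2,4) by (auto simp: in_set_conv_nth)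
  have z: "f_smult 0 (\<lambda>_. 0) = (\<lambda>_. 0)" for m :: 'm by (simp add: f_smult_def)
  have "as ! p \<in> V" using assms p by auto
  then have "F (as[p := f_smult 0 (as ! p)]) = f_smult 0 (F (as[p := as ! p]))"
    using assms(1,2,3) p(1) unfolding slot_linear_def by blast
  moreover have "f_smult 0 (as ! p) = as ! p" using p(2) by (simp add: f_smult_def)
  ultimately have "F as = f_smult 0 (F as)" by simp
  then show ?thesis by (simp add: f_smult_def)
qed

text \<open>Multilinear maps agreeing on a spanning set agree. Spanning is stated as an induction
  rule, and the slots are freed one at a time: the inner induction is on the number \<open>j\<close>
  of leading slots that range over \<open>V\<close> while the others are still in
  \<open>D\<close>.\<close>

lemma slot_linear_eqI:
  assumes F: "slot_linear n F" and H: "slot_linear n H"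
    and D: "D \<subseteq> V"
    and span: "\<And>P x. x \<in> V \<Longrightarrow> (\<And>d. d \<in> D \<Longrightarrow> P d) \<Longrightarrow> P (\<lambda>_. 0) \<Longrightarrow>
        (\<And>x a d. x \<in> V \<Longrightarrow> d \<in> D \<Longrightarrow> P x \<Longrightarrow> P (f_add (f_smult a d) x)) \<Longrightarrow> P x"
    and eq: "\<And>as. length as = n \<Longrightarrow> set as \<subseteq> D \<Longrightarrow> F as = H as"
    and as: "length as = n" "set as \<subseteq> V"
  shows "F as = H as"
proof -
  have "F as = H as" if "j \<le> n" "length as = n" "set as \<subseteq> V" "\<And>p. j \<le> p \<Longrightarrow> p < n \<Longrightarrow> as ! p \<in> D" for j as
    using that
  proof (induction j arbitrary: as)
    case 0
    then have "set as \<subseteq> D" by (auto simp: in_set_conv_nth)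
    then show ?case using eq 0 by blast
  next
    case (Suc j)
    have lt: "j < n" using Suc.prems by simp
    define P where "P x \<longleftrightarrow> F (as[j := x]) = H (as[j := x])" for x
    have upd: "set (as[j := x]) \<subseteq> V" if "x \<in> V" for x
      using Suc.prems(3) that set_update_subset_insert[of as j x] by auto
    have "P (as ! j)"
    proof (rule span[of _ P])
      show "as ! j \<in> V" using Suc.prems lt by auto
      fix d assume d: "d \<in> D"
      show "P d" unfolding P_def
      proof (rule Suc.IH)
        show "set (as[j := d]) \<subseteq> V" using upd d D by blast
        fix p assume "j \<le> p" "p < n"
        then show "as[j := d] ! p \<in> D" using Suc.prems(2,4) d by (cases "p = j") auto
      qed (use Suc.prems in auto)
    next
      have "(\<lambda>_. 0) = f_smult 0 (as ! j)" by (simp add: f_smult_def)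
      also have "\<dots> \<in> V" using Suc.prems lt by (intro V_smult) auto
      finally have z: "(\<lambda>_. 0) \<in> V" .
      have "(\<lambda>_. 0) \<in> set (as[j := (\<lambda>_. 0)])" using Suc.prems lt by (simp add: set_update_memI)
      then show "P (\<lambda>_. 0)" unfolding P_def
        using slot_linear_zero[OF F _ upd[OF z]] slot_linear_zero[OF H _ upd[OF z]] Suc.prems by simp
    next
      fix x a d assume x: "x \<in> V" and d: "d \<in> D" and Px: "P x"
      have dV: "d \<in> V" using d D by blast
      have Pd: "F (as[j := d]) = H (as[j := d])"
      proof (rule Suc.IH)
        show "set (as[j := d]) \<subseteq> V" using upd d D by blast
        fix p assume "j \<le> p" "p < n"
        then show "as[j := d] ! p \<in> D" using Suc.prems(2,4) d by (cases "p = j") auto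
      qed (use Suc.prems in auto)
      have lin: "X (as[j := f_add (f_smult a d) x]) = f_add (f_smult a (X (as[j := d]))) (X (as[j := x]))"
        if "slot_linear n X" for X
      proof -
        have "X (as[j := f_add (f_smult a d) x]) = f_add (X (as[j := f_smult a d])) (X (as[j := x]))"
          using that Suc.prems lt x V_smult[OF dV] unfolding slot_linear_def by blast
        moreover have "X (as[j := f_smult a d]) = f_smult a (X (as[j := d]))"
          using that Suc.prems lt dV unfolding slot_linear_def by blast
        ultimately show ?thesis by simp
      qed
      show "P (f_add (f_smult a d) x)"
        using Px Pd unfolding P_def lin[OF F] lin[OF H] by simp
    qed
    then show ?case by (simp add: P_def)
  qed
  from this[of n as] as show ?thesis by simp
qed

section \<open>Second-order candidates and uniqueness of cumulants\<close>

definition pair_cumulant :: "nat \<Rightarrow> ('m \<Rightarrow> complex) list \<Rightarrow> cs" where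
  "pair_cumulant n as = (if n = 2 then E (f_mul (as ! 0) (as ! 1)) else (\<lambda>_. 0))"

lemma Kvalid_pair_cumulant: "Kvalid n pair_cumulant"
  by (auto simp: Kvalid_def pair_cumulant_def)

lemma slot_linear_pair_cumulant: "slot_linear n (pair_cumulant n)"
proof (cases "n = 2")
  case False
  then show ?thesis by (simp add: slot_linear_def pair_cumulant_def f_add_def f_smult_def)
next
  case True
  show ?thesis unfolding slot_linear_def
  proof (intro allI impI)
    fix as p x y assume "length as = n \<and> set as \<subseteq> V \<and> p < n \<and> x \<in> V \<and> y \<in> V"
    then have as: "length as = 2" "set as \<subseteq> V" "p < 2" "x \<in> V" "y \<in> V" using True by auto
    then have nth: "as ! 0 \<in> V" "as ! 1 \<in> V" by auto
    have "p = 0 \<or> p = 1" using as by auto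
    then show "pair_cumulant n (as[p := f_add x y])
        = f_add (pair_cumulant n (as[p := x])) (pair_cumulant n (as[p := y])) \<and>
      (\<forall>a. pair_cumulant n (as[p := f_smult a x]) = f_smult a (pair_cumulant n (as[p := x])))"
      using as nth True by (elim disjE) (simp_all add: pair_cumulant_def mul_add mul_smult E_add E_smult)
  qed
qed

lemma Kvalid_cumulant_upto: "Kvalid m (cumulant_upto m)"
proof (induction m)
  case 0 then show ?case by (simp add: Kvalid_def)
next
  case (Suc m)
  show ?case unfolding Kvalid_def
  proof (intro allI impI)
    fix as assume as: "1 \<le> length as \<and> length as \<le> Suc m \<and> set as \<subseteq> V"
    show "cumulant_upto (Suc m) (length as) as \<in> S.FS"
    proof (cases "length as = Suc m")
      case False
      then show ?thesis using Suc as by (simp add: Kvalid_def)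
    next
      case True
      have "nc_ext Alg (cumulant_upto m) \<xi> as \<eta> = 0"
        if "\<xi> \<in> NC (Suc m) - {{{1..Suc m}}}" "\<eta> \<notin> Sym k" for \<xi> \<eta>
      proof -
        \<comment> \<open>Cutting the table off by zero above \<open>m\<close> makes it valid at
          length \<open>Suc m\<close>, where closedness of the nested maps is to be applied. A
          partition other than the one-block partition consults shorter lists only.\<close>
        have "nc_ext Alg (cumulant_upto m) \<xi> as = nc_ext Alg (\<lambda>j bs. if j \<le> m then cumulant_upto m j bs else (\<lambda>_. 0)) \<xi> as"
          by (rule nc_ext_cong[OF _ _ _ Suc]) (use that as True in auto)
        also have "\<dots> \<in> S.FS"
          by (rule nc_ext_closed[of _ "Suc m"]) (use that as True Suc in \<open>auto simp: Kvalid_def\<close>)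
        finally show ?thesis using that(2) by (simp add: S.FS_iff)
      qed
      then show ?thesis using E_closed[of "a_prod Alg as"] by (simp add: S.FS_iff True)
    qed
  qed
qed

text \<open>The top cumulant is defined by subtracting all other terms; these evaluate the maps on
  shorter lists, where the table and the full family coincide.\<close>

lemma moment_cumulant:
  assumes "1 \<le> length as" "set as \<subseteq> V"
  shows "E (a_prod Alg as) = cs_sum (\<lambda>\<xi>. nc_ext Alg cumulant \<xi> as) (NC (length as))"
proof -
  obtain m where m: "length as = Suc m" using assms(1) by (cases "length as") auto
  have top: "{{1..Suc m}} \<in> NC (Suc m)" by (rule NC_top) simp
  have "nc_ext Alg cumulant \<xi> as = nc_ext Alg (cumulant_upto m) \<xi> as"
    if "\<xi> \<in> NC (Suc m) - {{{1..Suc m}}}" for \<xi>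
    by (rule sym, rule nc_ext_cong[OF _ _ _ Kvalid_cumulant_upto]) (use that assms m cumulant_upto_eq in auto)
  then have "(\<Sum>\<xi>\<in>NC (Suc m). nc_ext Alg cumulant \<xi> as \<eta>)
      = nc_ext Alg cumulant {{1..Suc m}} as \<eta> + (\<Sum>\<xi>\<in>NC (Suc m) - {{{1..Suc m}}}. nc_ext Alg (cumulant_upto m) \<xi> as \<eta>)" for \<eta>
    by (subst sum.remove[OF finite_NC top]) simp
  moreover have "nc_ext Alg cumulant {{1..Suc m}} as = cumulant_upto (Suc m) (Suc m) as"
    using nc_ext_top[of as Alg cumulant] m by (simp add: cumulant_def)
  ultimately show ?thesis by (simp add: cs_sum_def m fun_eq_iff)
qed

text \<open>Uniqueness of cumulants localised at \<open>V\<close>: at each length the terms with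
  several blocks are fixed by shorter lengths, so equality of the two sums forces equality of the
  one-block terms.\<close>

theorem cumulants_eq_pair_cumulant:
  assumes K: "is_Sk_cumulants Alg E K"
    and pair: "\<And>as. 1 \<le> length as \<Longrightarrow> set as \<subseteq> V \<Longrightarrow>
        E (a_prod Alg as) = cs_sum (\<lambda>\<xi>. nc_ext Alg pair_cumulant \<xi> as) (NC (length as))"
    and as: "1 \<le> length as" "set as \<subseteq> V"
  shows "K (length as) as = pair_cumulant (length as) as"
  using as
proof (induction "length as" arbitrary: as rule: less_induct)
  case less
  let ?n = "length as"
  have top: "{{1..?n}} \<in> NC ?n" by (rule NC_top[OF less.prems(1)])
  \<comment> \<open>Validity is known for \<open>pair_cumulant\<close> but not for the given
    \<open>K\<close>, hence the comparison starts from the former.\<close>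
  have eq: "nc_ext Alg K \<xi> as = nc_ext Alg pair_cumulant \<xi> as" if "\<xi> \<in> NC ?n - {{{1..?n}}}" for \<xi>
    by (rule sym, rule nc_ext_cong[OF _ less.prems Kvalid_pair_cumulant[of "?n - 1"]])
      (use that less in auto)
  have "set as \<subseteq> FS" using less.prems(2) V_sub by blast
  then have "E (a_prod Alg as) = cs_sum (\<lambda>\<xi>. nc_ext Alg K \<xi> as) (NC ?n)"
    using K less.prems(1) unfolding is_Sk_cumulants_def by simp
  then have sums: "(\<Sum>\<xi>\<in>NC ?n. nc_ext Alg K \<xi> as \<eta>) = (\<Sum>\<xi>\<in>NC ?n. nc_ext Alg pair_cumulant \<xi> as \<eta>)" for \<eta>
    using pair[OF less.prems] by (simp add: cs_sum_def fun_eq_iff)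
  have "nc_ext Alg K {{1..?n}} as \<eta> = nc_ext Alg pair_cumulant {{1..?n}} as \<eta>" for \<eta>
    using sums[of \<eta>] eq by (simp add: sum.remove[OF finite_NC top])
  then show ?case using nc_ext_top[OF less.prems(1)] by (metis ext)
qed

lemma pair_cumulant_zero:
  assumes "set as \<subseteq> V" "\<xi> \<in> NC (length as)" "1 \<le> length as" "(\<lambda>_. 0) \<in> set as"
  shows "nc_ext Alg pair_cumulant \<xi> as = (\<lambda>_. 0)"
  by (rule slot_linear_zero[OF nc_ext_slot_linear[OF assms(2,3)]])
    (use assms Kvalid_pair_cumulant slot_linear_pair_cumulant in auto)

end

lemma (in Sk_trace) Sk_submodule_FS: "Sk_submodule G opr e st k u \<phi> FS"
  by unfold_locales auto

lemma (in Sk_trace) is_Sk_cumulants_cumulant: "is_Sk_cumulants Alg E cumulant"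
proof -
  interpret F: Sk_submodule G opr e st k u \<phi> FS by (rule Sk_submodule_FS)
  show ?thesis unfolding is_Sk_cumulants_def using F.moment_cumulant by auto
qed

section \<open>Counting index paths\<close>

text \<open>The value \<open>undefined\<close> off the range keeps concatenated tuples extensional,
  as members of \<open>Iset\<close> must be.\<close>

definition cat :: "nat \<Rightarrow> idx \<Rightarrow> idx \<Rightarrow> idx" where
  "cat k i j = (\<lambda>q. if q \<in> {1..k} then i q else if q \<in> {k<..2*k} then j (q - k) else undefined)"

lemma Sym_outside: "\<gamma> \<in> Sym n \<Longrightarrow> q \<notin> {1..n} \<Longrightarrow> \<gamma> q = q"
  by (simp add: Sym_def permutes_not_in)

lemma Sym_in: "\<gamma> \<in> Sym n \<Longrightarrow> \<gamma> q \<in> {1..n} \<longleftrightarrow> q \<in> {1..n}"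
  unfolding Sym_def mem_Collect_eq by (rule permutes_in_image)

text \<open>In this form a left factor \<open>djs\<close> or \<open>tau\<close> of
  \<open>\<gamma>\<close> acts directly on \<open>cat k r s\<close>, that is, by permuting
  coordinates inside the row and column tuples or by exchanging the two tuples.\<close>

lemma flattening_eq:
  assumes "\<gamma> \<in> Sym (2*k)"
  shows "flattening k \<gamma> T r s = T (cat k r s \<circ> \<gamma>)"
proof -
  have "(\<lambda>p\<in>{1..2*k}. (\<lambda>q. if q \<le> k then r q else s (q - k)) (\<gamma> p)) = cat k r s \<circ> \<gamma>"
  proof
    fix p
    show "(\<lambda>p\<in>{1..2*k}. (\<lambda>q. if q \<le> k then r q else s (q - k)) (\<gamma> p)) p = (cat k r s \<circ> \<gamma>) p"
    proof (cases "p \<in> {1..2*k}")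
      case True
      then have "\<gamma> p \<in> {1..2*k}" using assms by (simp only: Sym_in)
      then show ?thesis using True by (simp add: cat_def)
    next
      case False
      then show ?thesis using Sym_outside[OF assms False] by (auto simp: cat_def)
    qed
  qed
  then show ?thesis by (simp add: flattening_def)
qed

lemma Jset_comp [simp]: "i \<in> Jset k N \<Longrightarrow> \<eta> \<in> Sym k \<Longrightarrow> i \<circ> \<eta> \<in> Jset k N"
  unfolding Jset_def
proof (rule PiE_I)
  assume i: "i \<in> {1..k} \<rightarrow>\<^sub>E {1..N}" and \<eta>: "\<eta> \<in> Sym k"
  show "(i \<circ> \<eta>) x \<in> {1..N}" if "x \<in> {1..k}" for x
    using PiE_mem[OF i, of "\<eta> x"] Sym_in[OF \<eta>, of x] that by simp
  show "(i \<circ> \<eta>) x = undefined" if "x \<notin> {1..k}" for x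
    using PiE_arb[OF i that] Sym_outside[OF \<eta> that] by simp
qed

lemma cat_in_Iset [simp]: "i \<in> Jset k N \<Longrightarrow> j \<in> Jset k N \<Longrightarrow> cat k i j \<in> Iset k N"
  unfolding Jset_def Iset_def
proof (rule PiE_I)
  assume i: "i \<in> {1..k} \<rightarrow>\<^sub>E {1..N}" and j: "j \<in> {1..k} \<rightarrow>\<^sub>E {1..N}"
  show "cat k i j x \<in> {1..N}" if "x \<in> {1..2*k}" for x
  proof (cases "x \<le> k")
    case True then show ?thesis using PiE_mem[OF i, of x] that by (simp add: cat_def)
  next
    case False
    then have "x - k \<in> {1..k}" using that by auto
    then show ?thesis using PiE_mem[OF j, of "x - k"] that False by (simp add: cat_def)
  qed
qed (auto simp: cat_def)

lemma Iset_comp [simp]: "x \<in> Iset k N \<Longrightarrow> \<gamma> \<in> Sym (2*k) \<Longrightarrow> x \<circ> \<gamma> \<in> Iset k N"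
  using Jset_comp[of x "2*k" N \<gamma>] by (simp add: Jset_def Iset_def)

lemma Jset_ext: "i \<in> Jset k N \<Longrightarrow> i' \<in> Jset k N \<Longrightarrow> (\<And>q. q \<in> {1..k} \<Longrightarrow> i q = i' q) \<Longrightarrow> i = i'"
  unfolding Jset_def by (rule PiE_ext)

lemma cat_inject:
  assumes "i \<in> Jset k N" "j \<in> Jset k N" "i' \<in> Jset k N" "j' \<in> Jset k N"
  shows "cat k i j = cat k i' j' \<longleftrightarrow> i = i' \<and> j = j'"
proof
  assume eq: "cat k i j = cat k i' j'"
  have "i q = i' q" if "q \<in> {1..k}" for q using fun_cong[OF eq, of q] that by (simp add: cat_def)
  moreover have "j q = j' q" if "q \<in> {1..k}" for q using fun_cong[OF eq, of "q + k"] that by (auto simp: cat_def)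
  ultimately show "i = i' \<and> j = j'"
    using assms by (auto intro: Jset_ext)
qed simp

lemma finite_Jset [simp]: "finite (Jset k N)"
  by (simp add: Jset_def finite_PiE)

lemma card_Jset: "card (Jset k N) = N ^ k"
  by (simp add: Jset_def card_PiE)

lemma comp_Sym_cancel: "\<gamma> \<in> Sym n \<Longrightarrow> x \<circ> \<gamma> = y \<circ> \<gamma> \<longleftrightarrow> x = y"
  by (metis Sym_inv_comp(2) comp_id o_assoc)

section \<open>Block permutations acting on concatenated tuples\<close>

lemma permutesI_inverse:
  assumes "\<And>x. x \<notin> S \<Longrightarrow> p x = x" "\<And>x. p (q x) = x" "\<And>x. q (p x) = x"
  shows "p permutes S"
  unfolding permutes_def using assms by metis

lemma halves_cases:
  obtains (low) "x \<in> {1..k}" | (high) y where "x = y + k" "y \<in> {1..k}" | (out) "x \<notin> {1..2*k::nat}"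
proof -
  consider "x \<in> {1..k}" | "x \<in> {k<..2*k}" | "x \<notin> {1..2*k}" by force
  then show ?thesis
  proof cases
    case 2
    then show ?thesis by (intro high[of "x - k"]) auto
  qed (use low out in auto)
qed

lemma djs_at:
  "x \<in> {1..k} \<Longrightarrow> djs k a b x = a x" "y \<in> {1..k} \<Longrightarrow> djs k a b (y + k) = b y + k"
  "x \<notin> {1..2*k} \<Longrightarrow> djs k a b x = x"
  by (auto simp: djs_def)

lemma tau_at:
  "x \<in> {1..k} \<Longrightarrow> tau k x = x + k" "y \<in> {1..k} \<Longrightarrow> tau k (y + k) = y"
  "x \<notin> {1..2*k} \<Longrightarrow> tau k x = x"
  by (auto simp: tau_def)

lemma cat_at:
  "x \<in> {1..k} \<Longrightarrow> cat k i j x = i x" "y \<in> {1..k} \<Longrightarrow> cat k i j (y + k) = j y"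
  "x \<notin> {1..2*k} \<Longrightarrow> cat k i j x = undefined"
  by (auto simp: cat_def)

lemmas halves_at = djs_at tau_at cat_at

lemma djs_comp:
  assumes "a \<in> Sym k" "b \<in> Sym k" "c \<in> Sym k" "d \<in> Sym k"
  shows "djs k a b \<circ> djs k c d = djs k (a \<circ> c) (b \<circ> d)"
proof
  fix x
  show "(djs k a b \<circ> djs k c d) x = djs k (a \<circ> c) (b \<circ> d) x"
    by (cases rule: halves_cases[of x k])
      (simp_all add: halves_at Sym_in[OF assms(3)] Sym_in[OF assms(4)] del: atLeastAtMost_iff One_nat_def)
qed

lemma djs_id [simp]: "djs k id id = id"
proof
  show "djs k id id x = id x" for x
    by (cases rule: halves_cases[of x k]) (simp_all add: halves_at del: atLeastAtMost_iff One_nat_def)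
qed

lemma djs_in_Sym [simp]:
  assumes "\<eta> \<in> Sym k" "\<eta>' \<in> Sym k"
  shows "djs k \<eta> \<eta>' \<in> Sym (2*k)"
proof -
  have "djs k \<eta> \<eta>' \<circ> djs k (inv \<eta>) (inv \<eta>') = id" "djs k (inv \<eta>) (inv \<eta>') \<circ> djs k \<eta> \<eta>' = id"
    using assms by (simp_all add: djs_comp Sym_inv_comp[OF assms(1)] Sym_inv_comp[OF assms(2)])
  then have "djs k \<eta> \<eta>' permutes {1..2*k}"
    by (intro permutesI_inverse[of _ _ "djs k (inv \<eta>) (inv \<eta>')"] djs_at) (simp_all add: fun_eq_iff)
  then show ?thesis by (simp add: Sym_def)
qed

lemma tau_tau [simp]: "tau k (tau k x) = x"
  by (cases rule: halves_cases[of x k]) (simp_all add: halves_at del: atLeastAtMost_iff One_nat_def)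

lemma tau_comp_tau: "tau k \<circ> tau k = id"
  by (simp add: fun_eq_iff)

lemma tau_in_Sym [simp]: "tau k \<in> Sym (2*k)"
  unfolding Sym_def mem_Collect_eq
  by (rule permutesI_inverse[of _ _ "tau k"], erule tau_at) simp_all

lemma cat_djs:
  assumes "\<eta> \<in> Sym k" "\<eta>' \<in> Sym k"
  shows "cat k i j \<circ> djs k \<eta> \<eta>' = cat k (i \<circ> \<eta>) (j \<circ> \<eta>')"
proof
  fix x
  show "(cat k i j \<circ> djs k \<eta> \<eta>') x = cat k (i \<circ> \<eta>) (j \<circ> \<eta>') x"
    by (cases rule: halves_cases[of x k])
      (simp_all add: halves_at Sym_in[OF assms(1)] Sym_in[OF assms(2)] del: atLeastAtMost_iff One_nat_def)
qed

lemma cat_tau: "cat k i j \<circ> tau k = cat k j i"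
proof
  show "(cat k i j \<circ> tau k) x = cat k j i x" for x
    by (cases rule: halves_cases[of x k]) (simp_all add: halves_at del: atLeastAtMost_iff One_nat_def)
qed

lemma tau_djs:
  assumes "a \<in> Sym k" "b \<in> Sym k"
  shows "tau k \<circ> djs k a b = djs k b a \<circ> tau k"
proof
  fix x
  show "(tau k \<circ> djs k a b) x = (djs k b a \<circ> tau k) x"
    by (cases rule: halves_cases[of x k])
      (simp_all add: halves_at Sym_in[OF assms(1)] Sym_in[OF assms(2)] del: atLeastAtMost_iff One_nat_def)
qed

lemma djs_inject:
  assumes "a \<in> Sym k" "b \<in> Sym k" "c \<in> Sym k" "d \<in> Sym k"
  shows "djs k a b = djs k c d \<longleftrightarrow> a = c \<and> b = d"
proof
  assume eq: "djs k a b = djs k c d"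
  have "a x = c x \<and> b x = d x" for x
  proof (cases "x \<in> {1..k}")
    case True
    then show ?thesis using fun_cong[OF eq, of x] fun_cong[OF eq, of "x + k"]
      by (simp add: djs_at del: atLeastAtMost_iff One_nat_def)
  next
    case False
    then show ?thesis using assms by (simp add: Sym_outside del: atLeastAtMost_iff One_nat_def)
  qed
  then show "a = c \<and> b = d" by (simp add: fun_eq_iff)
qed simp

text \<open>If the first half is shifted onto the second, injectivity sends the second half
  bijectively onto the first, and one permutation \<open>\<eta>\<close> remains to be named. Read
  contrapositively, failure of compatibility exhibits a concrete coordinate
  \<open>q\<close>.\<close>

lemma djs_of_fixing:
  assumes \<gamma>: "\<gamma> \<in> Sym (2*k)" and shift: "\<And>q. q \<in> {1..k} \<Longrightarrow> \<gamma> q = q + k"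
  obtains \<eta> where "\<eta> \<in> Sym k" "\<gamma> = tau k \<circ> djs k id \<eta>"
proof -
  define \<eta> where "\<eta> l = (if l \<in> {1..k} then \<gamma> (l + k) else l)" for l
  have inj: "inj \<gamma>" using \<gamma> permutes_inj by (auto simp: Sym_def)
  have mem: "\<gamma> (l + k) \<in> {1..k}" if l: "l \<in> {1..k}" for l
  proof (cases rule: halves_cases[of "\<gamma> (l + k)" k])
    case (high q)
    then have "\<gamma> q = \<gamma> (l + k)" using shift by simp
    then have "q = l + k" using inj by (simp add: inj_eq)
    then show ?thesis using high l by auto
  next
    case out
    then show ?thesis using Sym_in[OF \<gamma>, of "l + k"] l by auto
  qed
  have "inj_on \<eta> {1..k}" using inj by (intro inj_onI) (simp add: \<eta>_def inj_eq del: atLeastAtMost_iff One_nat_def)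
  moreover have "\<eta> ` {1..k} \<subseteq> {1..k}" using mem by (auto simp: \<eta>_def simp del: atLeastAtMost_iff One_nat_def)
  ultimately have "bij_betw \<eta> {1..k} {1..k}"
    unfolding bij_betw_def by (simp add: endo_inj_surj)
  then have "\<eta> permutes {1..k}"
    by (rule bij_imp_permutes) (simp add: \<eta>_def del: atLeastAtMost_iff One_nat_def)
  moreover have "\<gamma> x = (tau k \<circ> djs k id \<eta>) x" for x
  proof (cases rule: halves_cases[of x k])
    case (high y)
    then show ?thesis using mem by (simp add: halves_at \<eta>_def del: atLeastAtMost_iff One_nat_def)
  next
    case out
    then show ?thesis using Sym_outside[OF \<gamma> out] by (simp add: halves_at del: atLeastAtMost_iff One_nat_def)
  qed (simp add: shift halves_at del: atLeastAtMost_iff One_nat_def)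
  ultimately show ?thesis using that[of \<eta>] unfolding Sym_def by blast
qed

text \<open>The vertices \<open>f 0, ..., f n\<close> are the summation indices of a product of
  \<open>n\<close> matrices; the twisted closing condition is what a trace against a permutation
  matrix leaves behind.\<close>

definition paths :: "nat \<Rightarrow> nat \<Rightarrow> nat \<Rightarrow> perm \<Rightarrow> (nat \<Rightarrow> idx) set" where
  "paths k N n \<rho> = {f \<in> PiE {0..n} (\<lambda>_. Jset k N). f n = f 0 \<circ> \<rho>}"

definition edge :: "nat \<Rightarrow> (nat \<Rightarrow> perm) \<Rightarrow> (nat \<Rightarrow> idx) \<Rightarrow> nat \<Rightarrow> idx" where
  "edge k g f l = cat k (f (l - 1)) (f l) \<circ> g l"

definition fpaths :: "nat \<Rightarrow> nat \<Rightarrow> nat \<Rightarrow> perm \<Rightarrow> (nat \<Rightarrow> perm) \<Rightarrow> nat set set \<Rightarrow> (nat \<Rightarrow> idx) set" where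
  "fpaths k N n \<rho> g \<pi> = {f \<in> paths k N n \<rho>. \<forall>B\<in>\<pi>. \<forall>l\<in>B. \<forall>l'\<in>B. edge k g f l = edge k g f l'}"

lemma paths_mem: "f \<in> paths k N n \<rho> \<Longrightarrow> l \<le> n \<Longrightarrow> f l \<in> Jset k N"
  by (auto simp: paths_def)

lemma finite_paths [simp]: "finite (paths k N n \<rho>)"
  unfolding paths_def by (rule finite_subset[of _ "PiE {0..n} (\<lambda>_. Jset k N)"]) (auto intro!: finite_PiE)

lemma fpaths_subset: "fpaths k N n \<rho> g \<pi> \<subseteq> paths k N n \<rho>"
  by (auto simp: fpaths_def)

lemma finite_fpaths [simp]: "finite (fpaths k N n \<rho> g \<pi>)"
  by (rule finite_subset[OF fpaths_subset]) simp

section \<open>Counting paths that are constant on the blocks of a partition\<close>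

locale word_partition =
  fixes k n :: nat and \<rho> :: perm and g :: "nat \<Rightarrow> perm" and \<pi> :: "nat set set"
  assumes k: "1 \<le> k" and \<rho>: "\<rho> \<in> Sym k" and g: "\<And>l. l \<in> {1..n} \<Longrightarrow> g l \<in> Sym (2*k)"
    and part: "partition_on {1..n} \<pi>"
begin

lemma blocks: "B \<in> \<pi> \<Longrightarrow> finite B \<and> B \<noteq> {} \<and> B \<subseteq> {1..n} \<and> Min B \<in> B \<and> Max B \<in> B"
proof -
  assume B: "B \<in> \<pi>"
  then have "B \<subseteq> {1..n}" "B \<noteq> {}" using partition_block_subset[OF part] partition_onD3[OF part] by auto
  moreover then have "finite B" using finite_subset by blast
  ultimately show ?thesis by simp
qed

text \<open>The start vertex together with the end points of those edges that open a block. At these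
  vertices no earlier edge dictates the tuple.\<close>

definition free :: "nat set" where
  "free = insert 0 (Min ` \<pi>)"

lemma finite_part: "finite \<pi>"
  using part finite_elements by blast

lemma card_free: "card free = Suc (card \<pi>)"
proof -
  have "inj_on Min \<pi>"
    using blocks partition_block_eq[OF part] by (metis inj_onI)
  moreover have "0 \<notin> Min ` \<pi>" using blocks by fastforce
  ultimately show ?thesis by (simp add: free_def finite_part card_image)
qed

lemma free_subset: "free \<subseteq> {0..n}"
  using blocks by (fastforce simp: free_def)

text \<open>At a position that does not open its block, the edge repeats the earlier edge at
  \<open>Min B\<close>. Composition with \<open>g l\<close> is invertible and \<open>cat\<close> is
  injective, so this determines the vertex \<open>f l\<close>.\<close>

lemma fpaths_determined: "inj_on (\<lambda>f. restrict f free) (fpaths k N n \<rho> g \<pi>)"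
proof (rule inj_onI)
  fix f f' assume f: "f \<in> fpaths k N n \<rho> g \<pi>" "f' \<in> fpaths k N n \<rho> g \<pi>"
    and eq: "restrict f free = restrict f' free"
  have p: "f \<in> paths k N n \<rho>" "f' \<in> paths k N n \<rho>" using f by (simp_all add: fpaths_def)
  have "f l = f' l" if "l \<le> n" for l
    using that
  proof (induction l rule: less_induct)
    case (less l)
    show ?case
    proof (cases "l \<in> free")
      case True then show ?thesis using fun_cong[OF eq, of l] by simp
    next
      case False
      then have "l \<in> {1..n}" using less.prems by (auto simp: free_def)
      then obtain B where B: "B \<in> \<pi>" "l \<in> B" using partition_block_exists[OF part] by blast
      have "Min B \<noteq> l" using False B by (auto simp: free_def)
      then have lt: "Min B < l" "1 \<le> Min B" using B blocks[OF B(1)] by (auto simp: le_neq_implies_less)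
      have "edge k g f l = edge k g f (Min B)" "edge k g f' l = edge k g f' (Min B)"
        using f B blocks[OF B(1)] unfolding fpaths_def by blast+
      moreover have "edge k g f (Min B) = edge k g f' (Min B)"
        using less.IH[of "Min B"] less.IH[of "Min B - 1"] lt less.prems by (simp add: edge_def)
      ultimately have "cat k (f (l-1)) (f l) \<circ> g l = cat k (f' (l-1)) (f' l) \<circ> g l"
        by (simp add: edge_def)
      then have "cat k (f (l-1)) (f l) = cat k (f' (l-1)) (f' l)"
        using comp_Sym_cancel[OF g[OF \<open>l \<in> {1..n}\<close>]] by blast
      then show ?thesis
        using cat_inject[OF paths_mem[OF p(1)] paths_mem[OF p(1)] paths_mem[OF p(2)] paths_mem[OF p(2)]]
          less.prems by simp
    qed
  qed
  then have "\<And>l. l \<in> {0..n} \<Longrightarrow> f l = f' l" by simp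
  moreover have "f \<in> PiE {0..n} (\<lambda>_. Jset k N)" "f' \<in> PiE {0..n} (\<lambda>_. Jset k N)"
    using p by (simp_all add: paths_def)
  ultimately show "f = f'" using PiE_ext by blast
qed

lemma fpaths_restrict: "(\<lambda>f. restrict f free) ` fpaths k N n \<rho> g \<pi> \<subseteq> PiE free (\<lambda>_. Jset k N)"
  using free_subset fpaths_subset paths_mem by fastforce

lemma finite_free: "finite free"
  by (simp add: free_def finite_part)

lemma card_fpaths_le: "card (fpaths k N n \<rho> g \<pi>) \<le> N ^ (k * Suc (card \<pi>))"
proof -
  have "card (fpaths k N n \<rho> g \<pi>) = card ((\<lambda>f. restrict f free) ` fpaths k N n \<rho> g \<pi>)"
    by (simp add: card_image fpaths_determined)
  also have "\<dots> \<le> card (PiE free (\<lambda>_. Jset k N))"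
    by (rule card_mono[OF _ fpaths_restrict]) (simp add: finite_PiE finite_free)
  also have "\<dots> = N ^ (k * Suc (card \<pi>))"
    by (simp add: card_PiE finite_free card_Jset card_free power_mult del: mult_Suc_right power_Suc)
  finally show ?thesis .
qed

text \<open>An equation between two different free coordinates costs a factor \<open>N\<close>:
  overwriting coordinate \<open>(a, q)\<close> by an arbitrary value is injective, because the lost
  entry can still be read at \<open>(a', q')\<close>.\<close>

lemma card_fpaths_constrained:
  assumes a: "a \<in> free" "a' \<in> free" "q \<in> {1..k}" "q' \<in> {1..k}" "(a, q) \<noteq> (a', q')"
    and con: "\<And>f. f \<in> fpaths k N n \<rho> g \<pi> \<Longrightarrow> f a q = f a' q'"
  shows "N * card (fpaths k N n \<rho> g \<pi>) \<le> N ^ (k * Suc (card \<pi>))"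
proof -
  let ?S = "(\<lambda>f. restrict f free) ` fpaths k N n \<rho> g \<pi>"
  define T where "T = (\<lambda>(c, h). h(a := (h a)(q := c)) :: nat \<Rightarrow> idx)"
  have conS: "h a q = h a' q'" if "h \<in> ?S" for h using that con a(1,2) by (elim imageE) simp
  have inj: "inj_on T ({1..N} \<times> ?S)"
  proof (rule inj_onI)
    fix z z' assume z: "z \<in> {1..N} \<times> ?S" "z' \<in> {1..N} \<times> ?S" and eq: "T z = T z'"
    obtain c h c' h' where ch: "z = (c, h)" "z' = (c', h')" by (cases z, cases z')
    have h: "h \<in> ?S" "h' \<in> ?S" using z ch by auto
    have E: "(h(a := (h a)(q := c))) b r = (h'(a := (h' a)(q := c'))) b r" for b r
      using eq ch by (simp add: T_def fun_eq_iff)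
    have other: "h b r = h' b r" if "(b, r) \<noteq> (a, q)" for b r
      using E[of b r] that by (cases "b = a"; cases "r = q") simp_all
    have "h a' q' = h' a' q'" using other[of a' q'] a(5) by auto
    then have "h a q = h' a q" using conS[OF h(1)] conS[OF h(2)] by simp
    then have "h b r = h' b r" for b r using other[of b r] by (cases "(b, r) = (a, q)") auto
    then have "h = h'" by (intro ext)
    moreover have "c = c'" using E[of a q] by simp
    ultimately show "z = z'" using ch by simp
  qed
  have sub: "T ` ({1..N} \<times> ?S) \<subseteq> PiE free (\<lambda>_. Jset k N)"
  proof
    fix y assume "y \<in> T ` ({1..N} \<times> ?S)"
    then obtain z where z: "z \<in> {1..N} \<times> ?S" "y = T z" by blast
    obtain c h where "z = (c, h)" by (cases z)
    with z have ch: "c \<in> {1..N}" "h \<in> ?S" "y = h(a := (h a)(q := c))" by (simp_all add: T_def)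
    have h: "h \<in> PiE free (\<lambda>_. Jset k N)" using ch(2) fpaths_restrict by blast
    then have "h a \<in> Jset k N" using a(1) by (rule PiE_mem)
    then have "(h a)(q := c) \<in> Jset k N"
      using ch(1) a(3) PiE_fun_upd[of c "\<lambda>_. {1..N}" q "h a" "{1..k}"] by (simp add: Jset_def insert_absorb)
    then show "y \<in> PiE free (\<lambda>_. Jset k N)"
      using h a(1) PiE_fun_upd[of _ "\<lambda>_. Jset k N" a h free] unfolding ch(3) by (simp add: insert_absorb)
  qed
  have "N * card (fpaths k N n \<rho> g \<pi>) = card (T ` ({1..N} \<times> ?S))"
    unfolding card_image[OF inj] card_cartesian_product card_image[OF fpaths_determined] by simp
  also have "\<dots> \<le> card (PiE free (\<lambda>_. Jset k N))"
    by (rule card_mono[OF _ sub]) (simp add: finite_PiE finite_free)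
  also have "\<dots> = N ^ (k * Suc (card \<pi>))"
    by (simp add: card_PiE finite_free card_Jset card_free power_mult del: mult_Suc_right power_Suc)
  finally show ?thesis .
qed

text \<open>The denominator is the number of unconstrained choices at the free vertices, each
  carrying \<open>k\<close> coordinates.\<close>

definition fnorm :: "nat \<Rightarrow> complex" where
  "fnorm N = of_nat (card (fpaths k N n \<rho> g \<pi>)) / of_nat N ^ (k * Suc (card \<pi>))"

lemma fnorm_tendsto_0:
  assumes a: "a \<in> free" "a' \<in> free" "q \<in> {1..k}" "q' \<in> {1..k}" "(a, q) \<noteq> (a', q')"
    and con: "\<And>N f. f \<in> fpaths k N n \<rho> g \<pi> \<Longrightarrow> f a q = f a' q'"
  shows "fnorm \<longlonglongrightarrow> 0"
proof (rule Lim_null_comparison)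
  show "\<forall>\<^sub>F N in sequentially. norm (fnorm N) \<le> inverse (real N)"
  proof (rule eventually_sequentiallyI[of 1])
    fix N :: nat assume N: "1 \<le> N"
    have "N * card (fpaths k N n \<rho> g \<pi>) \<le> N ^ (k * Suc (card \<pi>))"
      by (rule card_fpaths_constrained[OF a con])
    then have "real N * real (card (fpaths k N n \<rho> g \<pi>)) \<le> real N ^ (k * Suc (card \<pi>))"
      by (simp only: of_nat_mult[symmetric] of_nat_power[symmetric] of_nat_le_iff)
    then show "norm (fnorm N) \<le> inverse (real N)"
      using N by (simp add: fnorm_def norm_divide norm_power field_simps del: mult_Suc_right)
  qed
  show "(\<lambda>N. inverse (real N)) \<longlonglongrightarrow> 0" by (rule LIMSEQ_inverse_real_of_nat[THEN LIMSEQ_imp_Suc])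
qed

end

section \<open>Paths with prescribed kernel\<close>

definition kernel :: "nat \<Rightarrow> nat \<Rightarrow> (nat \<Rightarrow> perm) \<Rightarrow> (nat \<Rightarrow> idx) \<Rightarrow> nat set set" where
  "kernel k n g f = (\<lambda>l. {l'\<in>{1..n}. edge k g f l' = edge k g f l}) ` {1..n}"

lemma partition_on_kernel: "partition_on {1..n} (kernel k n g f)"
  by (rule partition_onI) (auto simp: kernel_def disjnt_def)

definition cpaths :: "nat \<Rightarrow> nat \<Rightarrow> nat \<Rightarrow> perm \<Rightarrow> (nat \<Rightarrow> perm) \<Rightarrow> nat set set \<Rightarrow> (nat \<Rightarrow> idx) set" where
  "cpaths k N n \<rho> g \<pi> = {f \<in> paths k N n \<rho>. kernel k n g f = \<pi>}"

lemma cpaths_subset: "cpaths k N n \<rho> g \<pi> \<subseteq> fpaths k N n \<rho> g \<pi>"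
  by (auto simp: cpaths_def fpaths_def kernel_def)

lemma finite_cpaths [simp]: "finite (cpaths k N n \<rho> g \<pi>)"
  by (rule finite_subset[OF cpaths_subset]) simp

context word_partition
begin

text \<open>Each block lies inside a class of the kernel, so the kernel arises from
  \<open>\<pi>\<close> by merging blocks. If no two blocks were merged, every class would equal its
  block.\<close>

lemma kernel_refined:
  assumes f: "f \<in> fpaths k N n \<rho> g \<pi>" and neq: "kernel k n g f \<noteq> \<pi>"
  shows "card (kernel k n g f) < card \<pi>"
proof -
  define \<Phi> where "\<Phi> B = {l'\<in>{1..n}. edge k g f l' = edge k g f (Min B)}" for B
  have sub: "B \<subseteq> \<Phi> B" if "B \<in> \<pi>" for B
    using f that blocks[OF that] unfolding fpaths_def \<Phi>_def by blast
  have im: "kernel k n g f = \<Phi> ` \<pi>"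
  proof
    show "kernel k n g f \<subseteq> \<Phi> ` \<pi>"
    proof
      fix C assume "C \<in> kernel k n g f"
      then obtain l where l: "l \<in> {1..n}" "C = {l'\<in>{1..n}. edge k g f l' = edge k g f l}"
        by (auto simp: kernel_def)
      obtain B where B: "B \<in> \<pi>" "l \<in> B" using partition_block_exists[OF part l(1)] by blast
      then have "edge k g f l = edge k g f (Min B)" using sub by (auto simp: \<Phi>_def)
      then have "C = \<Phi> B" using l by (simp add: \<Phi>_def)
      then show "C \<in> \<Phi> ` \<pi>" using B by blast
    qed
    show "\<Phi> ` \<pi> \<subseteq> kernel k n g f"
      using blocks unfolding \<Phi>_def kernel_def by blast
  qed
  have "\<not> inj_on \<Phi> \<pi>"
  proof
    assume inj: "inj_on \<Phi> \<pi>"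
    have "\<Phi> B = B" if B: "B \<in> \<pi>" for B
    proof (rule antisym[OF _ sub[OF B]], rule subsetI)
      fix l assume l: "l \<in> \<Phi> B"
      then have "l \<in> {1..n}" by (auto simp: \<Phi>_def)
      then obtain B' where B': "B' \<in> \<pi>" "l \<in> B'" using partition_block_exists[OF part] by blast
      then have "edge k g f l = edge k g f (Min B')" using sub by (auto simp: \<Phi>_def)
      then have "\<Phi> B' = \<Phi> B" using l by (simp add: \<Phi>_def)
      then have "B' = B" using inj B B'(1) by (auto dest: inj_onD)
      then show "l \<in> B" using B' by simp
    qed
    then have "\<Phi> ` \<pi> = \<pi>" by simp
    then show False using neq im by simp
  qed
  moreover have "card (\<Phi> ` \<pi>) \<le> card \<pi>" by (rule card_image_le[OF finite_part])
  moreover have "card (\<Phi> ` \<pi>) \<noteq> card \<pi>" using calculation(1) eq_card_imp_inj_on[OF finite_part] by blast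
  ultimately show ?thesis unfolding im by linarith
qed

lemma norm_fnorm_le: "norm (fnorm N) \<le> 1"
proof (cases "N = 0")
  case True
  then show ?thesis using k by (simp add: fnorm_def power_0_left)
next
  case False
  have "real (card (fpaths k N n \<rho> g \<pi>)) \<le> real (N ^ (k * Suc (card \<pi>)))"
    using card_fpaths_le[of N] by (simp only: of_nat_le_iff)
  then show ?thesis using False
    by (simp add: fnorm_def norm_divide norm_power field_simps del: mult_Suc_right)
qed

definition cnorm :: "nat \<Rightarrow> complex" where
  "cnorm N = of_nat (card (cpaths k N n \<rho> g \<pi>)) / of_nat N ^ (k * Suc (card \<pi>))"

lemma norm_cnorm_le: "norm (cnorm N) \<le> 1"
proof -
  have "card (cpaths k N n \<rho> g \<pi>) \<le> card (fpaths k N n \<rho> g \<pi>)"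
    by (rule card_mono[OF _ cpaths_subset]) simp
  then have "norm (cnorm N) \<le> norm (fnorm N)"
    by (simp add: cnorm_def fnorm_def norm_divide divide_right_mono)
  then show ?thesis using norm_fnorm_le[of N] by linarith
qed

text \<open>A path counted on the left only has a kernel with fewer blocks. There are at most
  \<open>N ^ (k * card \<pi>)\<close> paths for each such kernel, and the number of partitions does
  not depend on \<open>N\<close>, so the difference is of order \<open>1 / N ^ k\<close>.\<close>

lemma fnorm_minus_cnorm: "(\<lambda>N. fnorm N - cnorm N) \<longlonglongrightarrow> 0"
proof (rule Lim_null_comparison)
  define P where "P = {\<pi>'. partition_on {1..n} \<pi>' \<and> card \<pi>' < card \<pi>}"
  have finP: "finite P" unfolding P_def
    by (rule finite_subset[OF _ finitely_many_partition_on[of "{1..n}"]]) auto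
  show "\<forall>\<^sub>F N in sequentially. norm (fnorm N - cnorm N) \<le> real (card P) * inverse (real N)"
  proof (rule eventually_sequentiallyI[of 1])
    fix N :: nat assume N: "1 \<le> N"
    let ?F = "fpaths k N n \<rho> g \<pi>" and ?C = "cpaths k N n \<rho> g \<pi>"
    have "?F - ?C \<subseteq> (\<Union>\<pi>'\<in>P. fpaths k N n \<rho> g \<pi>')"
    proof
      fix f assume f: "f \<in> ?F - ?C"
      then have fp: "f \<in> paths k N n \<rho>" unfolding fpaths_def by blast
      then have "f \<in> cpaths k N n \<rho> g (kernel k n g f)" unfolding cpaths_def by blast
      moreover have "kernel k n g f \<noteq> \<pi>" using f fp unfolding cpaths_def by blast
      then have "card (kernel k n g f) < card \<pi>" using kernel_refined f by blast
      then have "kernel k n g f \<in> P" unfolding P_def using partition_on_kernel by blast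
      ultimately show "f \<in> (\<Union>\<pi>'\<in>P. fpaths k N n \<rho> g \<pi>')" using cpaths_subset by (meson UN_I subsetD)
    qed
    then have "card (?F - ?C) \<le> card (\<Union>\<pi>'\<in>P. fpaths k N n \<rho> g \<pi>')"
      by (rule card_mono[rotated]) (simp add: finP)
    also have "\<dots> \<le> (\<Sum>\<pi>'\<in>P. card (fpaths k N n \<rho> g \<pi>'))" by (rule card_UN_le[OF finP])
    also have "\<dots> \<le> (\<Sum>\<pi>'\<in>P. N ^ (k * card \<pi>))"
    proof (rule sum_mono)
      fix \<pi>' assume \<pi>': "\<pi>' \<in> P"
      interpret W: word_partition k n \<rho> g \<pi>'
        by unfold_locales (use k \<rho> g \<pi>' in \<open>auto simp: P_def\<close>)
      have "k * Suc (card \<pi>') \<le> k * card \<pi>" using \<pi>' by (simp add: P_def del: mult_Suc_right)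
      then show "card (fpaths k N n \<rho> g \<pi>') \<le> N ^ (k * card \<pi>)"
        using W.card_fpaths_le[of N] power_increasing[of _ _ N] N by (meson le_trans)
    qed
    finally have "real (card (?F - ?C)) \<le> real (card P * N ^ (k * card \<pi>))"
      by (simp only: of_nat_le_iff sum_constant) simp
    moreover have "card ?F = card ?C + card (?F - ?C)"
      using card_Diff_subset[OF _ cpaths_subset, of k N n \<rho> g \<pi>] card_mono[OF _ cpaths_subset, of k N n \<rho> g \<pi>] by simp
    then have "fnorm N - cnorm N = of_nat (card (?F - ?C)) / of_nat N ^ (k * Suc (card \<pi>))"
      by (simp add: fnorm_def cnorm_def add_divide_distrib del: mult_Suc_right)
    ultimately have "norm (fnorm N - cnorm N) \<le> real (card P * N ^ (k * card \<pi>)) / real N ^ (k * Suc (card \<pi>))"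
      by (simp add: norm_divide norm_power divide_right_mono del: mult_Suc_right)
    also have "\<dots> = real (card P) * inverse (real N ^ k)"
      using N by (simp add: power_add field_simps)
    also have "\<dots> \<le> real (card P) * inverse (real N)"
      using N k power_increasing[of 1 k "real N"] by (intro mult_left_mono le_imp_inverse_le) auto
    finally show "norm (fnorm N - cnorm N) \<le> real (card P) * inverse (real N)" .
  qed
  show "(\<lambda>N. real (card P) * inverse (real N)) \<longlonglongrightarrow> 0"
    by (intro tendsto_mult_right_zero LIMSEQ_inverse_real_of_nat[THEN LIMSEQ_imp_Suc])
qed

lemma cnorm_tendsto: "fnorm \<longlonglongrightarrow> c \<Longrightarrow> cnorm \<longlonglongrightarrow> c"
  using tendsto_diff[OF _ fnorm_minus_cnorm, of fnorm c] by simp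

text \<open>The alternative is decided by the first position that closes a pair: everything before it is
  free, so a pair with a non-adjacent partner forces an equation between free coordinates.\<close>

lemma pairing_alternative:
  assumes pairing: "\<And>B. B \<in> \<pi> \<Longrightarrow> card B = 2" and n: "1 \<le> n"
  shows "(\<exists>i. {i..<i+2} \<in> \<pi> \<and> {0..i} \<subseteq> free \<and> (\<forall>i' n'. 1 \<le> n' \<longrightarrow> {i'..<i'+n'} \<in> \<pi> \<longrightarrow> i \<le> i'))
    \<or> (fnorm \<longlonglongrightarrow> 0 \<and> \<not> noncrossing \<pi>)"
proof -
  have pair: "B = {Min B, Max B} \<and> Min B < Max B" if B: "B \<in> \<pi>" for B
  proof -
    obtain x y where xy: "B = {x, y}" "x \<noteq> y" using pairing[OF B] by (auto simp: card_2_iff)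
    then show ?thesis by (cases "x < y") auto
  qed
  have "\<pi> \<noteq> {}" using partition_onD1[OF part] n by auto
  define l where "l = Min (Max ` \<pi>)"
  have "l \<in> Max ` \<pi>" unfolding l_def using finite_part \<open>\<pi> \<noteq> {}\<close> by (intro Min_in) auto
  then obtain B0 where B0: "B0 \<in> \<pi>" "l = Max B0" by blast
  have least: "l \<le> Max B" if "B \<in> \<pi>" for B unfolding l_def using finite_part that by simp
  define p where "p = Min B0"
  have pl: "B0 = {p, l}" "p < l" using pair[OF B0(1)] B0(2) by (auto simp: p_def)
  have pl1: "1 \<le> p" "l \<le> n" using blocks[OF B0(1)] pl by auto
  have fr: "m \<in> free" if "m < l" for m
  proof (cases "m = 0")
    case False
    then have "m \<in> {1..n}" using that pl1 by auto
    then obtain B where B: "B \<in> \<pi>" "m \<in> B" using partition_block_exists[OF part] by blast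
    then have "m = Min B" using pair[OF B(1)] least[OF B(1)] that by auto
    then show ?thesis using B by (auto simp: free_def)
  qed (simp add: free_def)
  show ?thesis
  proof (cases "p = l - 1")
    case True
    have "{p..<p+2} = B0" using True pl by auto
    moreover have "{0..p} \<subseteq> free" using fr pl by auto
    moreover have "p \<le> i'" if "1 \<le> n'" "{i'..<i'+n'} \<in> \<pi>" for i' n'
    proof -
      have "n' = 2" using pairing[OF that(2)] by simp
      then have "{i'..<i'+n'} = {i', i'+1}" by auto
      then have "Max {i'..<i'+n'} = i' + 1" by simp
      then show ?thesis using least[OF that(2)] True pl(2) by simp
    qed
    ultimately show ?thesis using B0(1) by blast
  next
    case False
    then have lt: "p + 1 < l" using pl by linarith
    \<comment> \<open>The position right after \<open>p\<close> lies in another block. As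
      \<open>l\<close> is the first closing position, that block closes after \<open>l\<close>, so
      it crosses \<open>B0\<close>.\<close>
    define m where "m = p + 1"
    have "m \<in> {1..n}" using lt pl1 by (auto simp: m_def)
    then obtain B where B: "B \<in> \<pi>" "m \<in> B" using partition_block_exists[OF part] by blast
    have "m \<notin> B0" using lt pl by (auto simp: m_def)
    then have "B \<noteq> B0" using B by blast
    have MB: "Max B \<in> B" using blocks[OF B(1)] by simp
    have "Max B \<noteq> l"
    proof
      assume "Max B = l"
      then have "l \<in> B" "l \<in> B0" using MB pl(1) by auto
      then show False using partition_block_eq[OF part B(1) B0(1)] \<open>B \<noteq> B0\<close> by simp
    qed
    then have "l < Max B" using least[OF B(1)] by simp
    moreover note MB
    ultimately have "crosses B0 B" unfolding crosses_def
      using lt B(2) pl by (intro exI[of _ p] exI[of _ m] exI[of _ l] exI[of _ "Max B"]) (auto simp: m_def)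
    then have nc: "\<not> noncrossing \<pi>" using B0(1) B(1) \<open>B \<noteq> B0\<close> unfolding noncrossing_def by blast
    have gl: "g l \<in> Sym (2*k)" "g p \<in> Sym (2*k)" using g pl1 pl by auto
    \<comment> \<open>Coordinate 1 of vertex \<open>l - 1\<close> sits at slot
      \<open>inv (g l) 1\<close> of edge \<open>l\<close>. Equality with edge \<open>p\<close>
      places there coordinate \<open>r\<close> of the concatenation of vertices \<open>p - 1\<close>
      and \<open>p\<close>. All three vertices are free, and \<open>l - 1\<close> differs from the
      other two because \<open>p + 1 < l\<close>.\<close>
    define r where "r = g p (inv (g l) 1)"
    have r: "r \<in> {1..2*k}"
      unfolding r_def Sym_in[OF gl(2)] Sym_in[OF Sym_inv[OF gl(1)]] using k by auto
    have "fnorm \<longlonglongrightarrow> 0"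
    proof -
      have main: "f (l - 1) 1 = cat k (f (p - 1)) (f p) r" if f: "f \<in> fpaths k N n \<rho> g \<pi>" for f N
      proof -
        have "edge k g f l = edge k g f p" using f B0(1) pl(1) by (auto simp: fpaths_def)
        then have "edge k g f l (inv (g l) 1) = edge k g f p (inv (g l) 1)" by simp
        moreover have "g l (inv (g l) 1) = 1" using Sym_inv_comp(2)[OF gl(1)] by (metis comp_apply id_apply)
        ultimately show ?thesis using k by (simp add: edge_def r_def cat_def)
      qed
      show ?thesis
      proof (cases rule: halves_cases[of r k])
        case low
        show ?thesis
          by (rule fnorm_tendsto_0[of "l - 1" "p - 1" 1 r])
            (use low fr lt k main in \<open>auto simp: cat_def\<close>)
      next
        case (high y)
        then have c: "cat k i j r = j y" for i j by (simp add: cat_at(2) del: One_nat_def)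
        show ?thesis
          by (rule fnorm_tendsto_0[of "l - 1" p 1 y])
            (use high fr lt k main c in auto)
      next
        case out then show ?thesis using r by simp
      qed
    qed
    with nc show ?thesis by blast
  qed
qed

text \<open>Edges \<open>i\<close> and \<open>i + 1\<close> share the vertex \<open>f i\<close>.
  Unless \<open>g i \<circ> inv (g (i + 1))\<close> sends every \<open>q\<close> of the first half
  to \<open>q + k\<close>, equality of the two edges equates some coordinate of \<open>f i\<close>
  with another coordinate of \<open>f (i - 1)\<close> or \<open>f i\<close>. The shift on the whole
  first half is precisely compatibility.\<close>

lemma incompatible_pair:
  assumes B: "{i..<i+2} \<in> \<pi>" and fr: "{0..i} \<subseteq> free"
    and inc: "\<And>\<eta>. \<eta> \<in> Sym k \<Longrightarrow> g i \<noteq> tau k \<circ> djs k id \<eta> \<circ> g (i + 1)"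
  shows "fnorm \<longlonglongrightarrow> 0"
proof -
  have i: "1 \<le> i" "i + 1 \<le> n" using interval_bounds[OF part B] by auto
  then have gi: "g i \<in> Sym (2*k)" "g (i+1) \<in> Sym (2*k)" using g by auto
  define \<gamma> where "\<gamma> = g i \<circ> inv (g (i+1))"
  have \<gamma>: "\<gamma> \<in> Sym (2*k)" using gi by (simp add: \<gamma>_def)
  have g\<gamma>: "g i = \<gamma> \<circ> g (i+1)"
    unfolding \<gamma>_def using Sym_inv_comp(1)[OF gi(2)] by (simp add: o_assoc[symmetric] del: Suc_eq_plus1 add_Suc_right)
  obtain q where q: "q \<in> {1..k}" "\<gamma> q \<noteq> q + k"
  proof (rule ccontr)
    assume "\<not> thesis"
    then have "\<And>q. q \<in> {1..k} \<Longrightarrow> \<gamma> q = q + k" using that by blast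
    then obtain \<eta> where "\<eta> \<in> Sym k" "\<gamma> = tau k \<circ> djs k id \<eta>" using djs_of_fixing[OF \<gamma>] by blast
    then show False using inc[of \<eta>] g\<gamma> by simp
  qed
  have main: "cat k (f (i - 1)) (f i) (\<gamma> q) = f i q" if f: "f \<in> fpaths k N n \<rho> g \<pi>" for f N
  proof -
    have "edge k g f i = edge k g f (i+1)" using f B unfolding fpaths_def by fastforce
    then have "cat k (f (i-1)) (f i) \<circ> \<gamma> \<circ> g (i+1) = cat k (f i) (f (i+1)) \<circ> g (i+1)"
      by (simp add: edge_def g\<gamma> o_assoc)
    then have "cat k (f (i-1)) (f i) \<circ> \<gamma> = cat k (f i) (f (i+1))"
      using comp_Sym_cancel[OF gi(2)] by blast
    then have "cat k (f (i-1)) (f i) (\<gamma> q) = cat k (f i) (f (i+1)) q" by (metis comp_apply)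
    then show ?thesis using q(1) by (simp add: cat_at(1) del: One_nat_def)
  qed
  show ?thesis
  proof (cases rule: halves_cases[of "\<gamma> q" k])
    case low
    then have c: "cat k a b (\<gamma> q) = a (\<gamma> q)" for a b by (rule cat_at(1))
    show ?thesis
      by (rule fnorm_tendsto_0[of "i - 1" i "\<gamma> q" q]) (use low fr q i main c in auto)
  next
    case (high y)
    then have c: "cat k a b (\<gamma> q) = b y" for a b by (simp add: cat_at(2) del: One_nat_def)
    show ?thesis
      by (rule fnorm_tendsto_0[of i i y q]) (use high fr q i main c in auto)
  next
    case out then show ?thesis using Sym_in[OF \<gamma>, of q] q by auto
  qed
qed

text \<open>For a compatible pair the shared vertex \<open>f i\<close> occupies the same slots in
  both edges and drops out, leaving one condition on its two neighbours.\<close>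

lemma compatible_edge:
  assumes i: "1 \<le> i" "i + 1 \<le> n" and \<eta>: "\<eta> \<in> Sym k" and gi: "g i = tau k \<circ> djs k id \<eta> \<circ> g (i + 1)"
    and f: "\<And>l. l \<le> n \<Longrightarrow> f l \<in> Jset k N"
  shows "edge k g f i = edge k g f (i + 1) \<longleftrightarrow> f (i + 1) = f (i - 1) \<circ> \<eta>"
proof -
  have "cat k (f (i - 1)) (f i) \<circ> tau k \<circ> djs k id \<eta> = cat k (f i) (f (i - 1) \<circ> \<eta>)"
    unfolding cat_tau by (simp add: cat_djs \<eta>)
  then have "edge k g f i = cat k (f i) (f (i - 1) \<circ> \<eta>) \<circ> g (i + 1)"
    unfolding edge_def gi o_assoc by simp
  moreover have "edge k g f (i + 1) = cat k (f i) (f (i + 1)) \<circ> g (i + 1)"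
    by (simp add: edge_def)
  moreover have "g (i + 1) \<in> Sym (2*k)" using g i by auto
  ultimately have "edge k g f i = edge k g f (i + 1) \<longleftrightarrow>
      cat k (f i) (f (i - 1) \<circ> \<eta>) = cat k (f i) (f (i + 1))"
    by (simp only: comp_Sym_cancel)
  also have "\<dots> \<longleftrightarrow> f (i + 1) = f (i - 1) \<circ> \<eta>"
    using cat_inject[OF f Jset_comp[OF f \<eta>] f f, of i "i - 1" i "i + 1"] i by auto
  finally show ?thesis .
qed

text \<open>The base case of the contraction. Compatibility with \<open>\<eta>\<close> asks for
  \<open>f 2 = f 0 \<circ> \<eta>\<close>, while the path closes with
  \<open>f 2 = f 0 \<circ> \<rho>\<close>; no coordinate is lost exactly when
  \<open>\<eta> = \<rho>\<close>.\<close>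

lemma pair_partition_limit:
  assumes n: "n = 2" and B: "\<pi> = {{1..2}}"
  shows "fnorm \<longlonglongrightarrow> (if g 1 = tau k \<circ> djs k id \<rho> \<circ> g 2 then 1 else 0)"
proof -
  have iv: "{1..<1+2} = {1..2::nat}" by auto
  then have blk: "{1..<1+2} \<in> \<pi>" by (simp add: B)
  have "Min {1..2::nat} = 1" by (rule Min_eqI) auto
  then have "insert 0 (Min ` \<pi>) = {0, 1}" by (simp add: B)
  moreover have "{0..1::nat} = {0, 1}" by auto
  ultimately have fr: "{0..1} \<subseteq> free" unfolding free_def by simp
  have closing: "f 2 = f 0 \<circ> \<rho>" "\<And>l. l \<le> 2 \<Longrightarrow> f l \<in> Jset k N" if "f \<in> paths k N n \<rho>" for f N
    using that n paths_mem[OF that] by (simp_all add: paths_def)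
  show ?thesis
  proof (cases "g 1 = tau k \<circ> djs k id \<rho> \<circ> g 2")
    case True
    have "fpaths k N n \<rho> g \<pi> = paths k N n \<rho>" for N
    proof -
      have "edge k g f 1 = edge k g f 2" if "f \<in> paths k N n \<rho>" for f
        using compatible_edge[of 1 \<rho> f N] True \<rho> closing[OF that] n by (simp add: numeral_2_eq_2)
      moreover have "{1..2::nat} = {1, 2}" by auto
      ultimately show ?thesis unfolding fpaths_def B by auto
    qed
    moreover have "card (paths k N n \<rho>) = N ^ (k * 2)" for N
    proof -
      have "bij_betw (\<lambda>f. restrict f {0,1}) (paths k N n \<rho>) (PiE {0,1::nat} (\<lambda>_. Jset k N))"
      proof (rule bij_betw_imageI)
        show "inj_on (\<lambda>f. restrict f {0,1}) (paths k N n \<rho>)"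
        proof (rule inj_onI)
          fix f f' assume f: "f \<in> paths k N n \<rho>" "f' \<in> paths k N n \<rho>" and eq: "restrict f {0,1} = restrict f' {0,1}"
          have "f 0 = f' 0" "f 1 = f' 1" using fun_cong[OF eq, of 0] fun_cong[OF eq, of 1] by auto
          moreover then have "f 2 = f' 2" using closing(1)[OF f(1)] closing(1)[OF f(2)] by simp
          moreover have "l = 0 \<or> l = 1 \<or> l = 2" if "l \<in> {0..n}" for l using that n by auto
          ultimately have "f l = f' l" if "l \<in> {0..n}" for l using that by metis
          then show "f = f'" using f PiE_ext[of f "{0..n}" _ f'] unfolding paths_def by blast
        qed
        show "(\<lambda>f. restrict f {0,1}) ` paths k N n \<rho> = PiE {0,1::nat} (\<lambda>_. Jset k N)"
        proof
          show "(\<lambda>f. restrict f {0,1}) ` paths k N n \<rho> \<subseteq> PiE {0,1::nat} (\<lambda>_. Jset k N)"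
            using closing(2) by auto
          show "PiE {0,1::nat} (\<lambda>_. Jset k N) \<subseteq> (\<lambda>f. restrict f {0,1}) ` paths k N n \<rho>"
          proof
            fix h assume h: "h \<in> PiE {0,1::nat} (\<lambda>_. Jset k N)"
            have dom: "{0..n} = insert 2 {0, 1}" unfolding n by auto
            have h0: "h 0 \<in> Jset k N" by (rule PiE_mem[OF h]) simp
            have "h(2 := h 0 \<circ> \<rho>) \<in> PiE (insert 2 {0, 1}) (\<lambda>_. Jset k N)"
              by (rule PiE_fun_upd[OF Jset_comp[OF h0 \<rho>] h])
            then have "h(2 := h 0 \<circ> \<rho>) \<in> paths k N n \<rho>" unfolding paths_def dom by (simp add: n)
            moreover have "restrict (h(2 := h 0 \<circ> \<rho>)) {0,1} = h"
            proof
              fix x show "restrict (h(2 := h 0 \<circ> \<rho>)) {0,1} x = h x"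
                using PiE_arb[OF h, of x] by (cases "x \<in> {0, 1}") auto
            qed
            ultimately show "h \<in> (\<lambda>f. restrict f {0,1}) ` paths k N n \<rho>" by (metis imageI)
          qed
        qed
      qed
      then have "card (paths k N n \<rho>) = card (PiE {0,1::nat} (\<lambda>_. Jset k N))" by (rule bij_betw_same_card)
      also have "\<dots> = N ^ (k * 2)" by (simp add: card_PiE card_Jset power_mult power2_eq_square)
      finally show ?thesis .
    qed
    moreover have "Suc (card \<pi>) = 2" by (simp add: B)
    ultimately have "fnorm N = 1" if "N \<ge> 1" for N using that unfolding fnorm_def by (simp del: mult_Suc_right add: numeral_2_eq_2)
    then have "fnorm \<longlonglongrightarrow> 1" by (intro tendsto_eventually eventually_sequentiallyI[of 1]) auto
    then show ?thesis using True by simp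
  next
    case False
    have "fnorm \<longlonglongrightarrow> 0"
    proof (cases "\<exists>\<eta>\<in>Sym k. g 1 = tau k \<circ> djs k id \<eta> \<circ> g (1 + 1)")
      case True
      then obtain \<eta> where \<eta>: "\<eta> \<in> Sym k" "g 1 = tau k \<circ> djs k id \<eta> \<circ> g (1 + 1)" by blast
      have g11: "g (1 + 1) = g 2" by (simp add: numeral_2_eq_2)
      have "\<eta> \<noteq> \<rho>" using False \<eta>(2) g11 by auto
      \<comment> \<open>Vertex 2 is both \<open>f 0 \<circ> \<eta>\<close> and
        \<open>f 0 \<circ> \<rho>\<close>, which ties two coordinates of the start vertex.\<close>
      then obtain q where q: "\<eta> q \<noteq> \<rho> q" by (meson ext)
      have qk: "q \<in> {1..k}" using q Sym_outside[OF \<eta>(1), of q] Sym_outside[OF \<rho>, of q] by metis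
      show ?thesis
      proof (rule fnorm_tendsto_0[of 0 0 "\<eta> q" "\<rho> q"])
        fix N f assume f: "f \<in> fpaths k N n \<rho> g \<pi>"
        have fp: "f \<in> paths k N n \<rho>" using f fpaths_subset by blast
        have "edge k g f 1 = edge k g f (1 + 1)" using f unfolding fpaths_def B by auto
        then have "f (1 + 1) = f (1 - 1) \<circ> \<eta>"
          using compatible_edge[OF _ _ \<eta>, of f N] closing(2)[OF fp] n by simp
        then have "f 0 \<circ> \<eta> = f 0 \<circ> \<rho>" using closing(1)[OF fp] by (simp add: numeral_2_eq_2)
        then show "f 0 (\<eta> q) = f 0 (\<rho> q)" by (metis comp_apply)
      next
        show "0 \<in> free" "0 \<in> free" using fr by auto
      qed (use q qk Sym_in[OF \<eta>(1)] Sym_in[OF \<rho>] in auto)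
    next
      case False
      then show ?thesis using incompatible_pair[OF blk fr] by blast
    qed
    then show ?thesis using False by simp
  qed
qed

end

text \<open>Contracting a compatible adjacent pair (i, i + 1) with permutation \<open>\<eta>\<close> multiplies the letter on its left by
  \<open>u_\<eta>\<close> from the right, or, if there is none, the letter on its right by \<open>u_\<eta>\<close> from the left.\<close>

definition contract_perm :: "nat \<Rightarrow> nat \<Rightarrow> perm \<Rightarrow> (nat \<Rightarrow> perm) \<Rightarrow> nat \<Rightarrow> perm" where
  "contract_perm k i \<eta> g = (\<lambda>l. if i = 1 then (if l = 1 then djs k \<eta> id \<circ> g 3 else g (l + 2))
     else if l < i - 1 then g l else if l = i - 1 then djs k id (inv \<eta>) \<circ> g (i - 1) else g (l + 2))"

locale compatible_pair = word_partition k n \<rho> g \<pi>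
  for k n :: nat and \<rho> :: perm and g :: "nat \<Rightarrow> perm" and \<pi> :: "nat set set" +
  fixes i :: nat and \<eta> :: perm
  assumes n3: "3 \<le> n" and blk: "{i..<i+2} \<in> \<pi>"
    and \<eta>: "\<eta> \<in> Sym k" and gi: "g i = tau k \<circ> djs k id \<eta> \<circ> g (i + 1)"
begin

lemma i: "1 \<le> i" "i + 1 \<le> n"
  using interval_bounds[OF part blk] by auto

text \<open>Contraction drops the vertices \<open>t\<close> and \<open>t + 1\<close>. For
  \<open>i > 1\<close> these are \<open>i - 1\<close> and \<open>i\<close>, so the twist passes to
  the left neighbour; for \<open>i = 1\<close> the start vertex has to stay, vertices 1 and 2 go,
  and the twist passes to the right.\<close>

definition t :: nat where "t = (if i = 1 then 1 else i - 1)"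

lemma t_one: "i = 1 \<Longrightarrow> t = 1" and t_other: "i \<noteq> 1 \<Longrightarrow> t = i - 1"
  unfolding t_def by simp_all

lemma t: "1 \<le> t" "t \<le> n - 2" "t \<le> i" "i \<le> t + 1"
  unfolding t_def using i n3 by auto

abbreviation "g' \<equiv> contract_perm k i \<eta> g"
abbreviation "\<pi>' \<equiv> del_block i 2 \<pi>"

sublocale D: word_partition k "n - 2" \<rho> g' \<pi>'
proof
  show "partition_on {1..n - 2} \<pi>'" by (rule partition_on_del_block[OF part blk]) simp
  fix l assume l: "l \<in> {1..n - 2}"
  have "g m \<in> Sym (2*k)" if "1 \<le> m" "m \<le> n" for m using g that by auto
  then show "g' l \<in> Sym (2*k)"
    using l i n3 \<eta> by (auto simp: contract_perm_def intro!: Sym_comp djs_in_Sym)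
qed (use k \<rho> in auto)

definition short :: "(nat \<Rightarrow> idx) \<Rightarrow> nat \<Rightarrow> idx" where
  "short f = restrict (\<lambda>l. if l < t then f l else f (l + 2)) {0..n - 2}"

lemma short_at: "l < t \<Longrightarrow> short f l = f l" "t \<le> l \<Longrightarrow> l \<le> n - 2 \<Longrightarrow> short f l = f (l + 2)"
  using t by (auto simp: short_def)

text \<open>Of the two dropped vertices, \<open>f i\<close> occurs in no remaining edge, and the
  other is recovered from a kept vertex by \<open>\<eta>\<close> or its inverse.
  \<open>contract_perm\<close> builds this twist into the permutation of the one affected
  edge.\<close>

lemma edge_short:
  assumes good: "f (i + 1) = f (i - 1) \<circ> \<eta>" and l: "l \<in> {1..n} - {i..<i+2}"
  shows "edge k g f l = edge k g' (short f) (relab i 2 l)"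
proof (cases "i = 1")
  case True
  then have t1: "t = 1" by (rule t_one)
  define m where "m = l - 3"
  have l3: "l = m + 3" "m + 3 \<le> n" using l True by (auto simp: m_def)
  have r: "relab i 2 l = m + 1" using l3 True by (simp add: relab_def)
  have s: "short f (m + 1) = f (m + 3)" using short_at(2)[of "m + 1" f] l3 t1 by (simp add: numeral_3_eq_3)
  show ?thesis
  proof (cases "m = 0")
    case m0: True
    have "edge k g' (short f) 1 = cat k (f 0) (f 3) \<circ> djs k \<eta> id \<circ> g 3"
      using s m0 short_at(1)[of 0 f] t1 True by (simp add: edge_def contract_perm_def o_assoc)
    also have "\<dots> = cat k (f 0 \<circ> \<eta>) (f 3) \<circ> g 3" using \<eta> by (simp add: cat_djs)
    also have "f 0 \<circ> \<eta> = f 2" using good True by (simp add: numeral_2_eq_2)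
    finally have "edge k g' (short f) (m + 1) = edge k g f 3" using m0 by (simp add: edge_def comp_def)
    then show ?thesis unfolding r using l3 m0 by simp
  next
    case False
    have s': "short f m = f (m + 2)" using short_at(2)[of m f] l3 False t1 by simp
    have gm: "g' (m + 1) = g (m + 3)" using False True by (simp add: contract_perm_def numeral_3_eq_3)
    have "edge k g f (m + 3) = edge k g' (short f) (m + 1)"
      unfolding edge_def gm s using s' by (simp add: numeral_3_eq_3 numeral_2_eq_2)
    then show ?thesis unfolding r using l3 by simp
  qed
next
  case False
  then have ti: "t = i - 1" "2 \<le> i" using i t_other by auto
  consider "l < i - 1" | "l = i - 1" | "i + 2 \<le> l" using l by force
  then show ?thesis
  proof cases
    case 1
    have "relab i 2 l = l" "g' l = g l" using 1 ti False by (auto simp: relab_def contract_perm_def)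
    moreover have "short f l = f l" "short f (l - 1) = f (l - 1)" using 1 ti by (auto intro!: short_at(1))
    ultimately show ?thesis by (simp add: edge_def)
  next
    case 2
    obtain m where m: "i = m + 2" using ti by (metis le_add_diff_inverse2)
    have s: "short f m = f m" "short f (m + 1) = f (m + 3)"
      using short_at(1)[of m f] short_at(2)[of "m + 1" f] m ti i by (auto simp: numeral_3_eq_3)
    have g1: "g' (m + 1) = djs k id (inv \<eta>) \<circ> g (m + 1)"
      using m by (simp add: contract_perm_def)
    have "f (m + 3) \<circ> inv \<eta> = f (m + 1) \<circ> (\<eta> \<circ> inv \<eta>)"
      using good m by (simp add: o_assoc numeral_3_eq_3)
    then have "f (m + 3) \<circ> inv \<eta> = f (m + 1)" using Sym_inv_comp(2)[OF \<eta>] by simp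
    moreover have "edge k g' (short f) (m + 1) = cat k (f m) (f (m + 3)) \<circ> djs k id (inv \<eta>) \<circ> g (m + 1)"
      unfolding edge_def g1 s by (simp add: o_assoc s)
    ultimately have "edge k g' (short f) (m + 1) = cat k (f m) (f (m + 1)) \<circ> g (m + 1)"
      using \<eta> by (simp only: cat_djs Sym_id Sym_inv comp_id)
    moreover have "relab i 2 l = m + 1" "l = m + 1" using 2 m by (auto simp: relab_def)
    ultimately show ?thesis by (simp add: edge_def)
  next
    case 3
    then obtain m where m: "l = m + 2" "i \<le> m" by (metis add_le_cancel_right le_add_diff_inverse2 le_trans le_add2)
    have "short f m = f (m + 2)" using short_at(2)[of m f] m l ti by auto
    moreover have "short f (m - 1) = f (m + 1)"
      using short_at(2)[of "m - 1" f] m l ti by (auto simp: Suc_diff_Suc)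
    moreover have "g' m = g (m + 2)" "relab i 2 l = m" "l - 1 = m + 1"
      using m ti False by (auto simp: contract_perm_def relab_def)
    ultimately show ?thesis using m(1) by (simp add: edge_def)
  qed
qed

text \<open>Inverse of \<open>short\<close> with \<open>v\<close> inserted at vertex
  \<open>i\<close>; the other reinserted vertex is forced by
  \<open>f (i + 1) = f (i - 1) \<circ> \<eta>\<close>.\<close>

definition long :: "idx \<Rightarrow> (nat \<Rightarrow> idx) \<Rightarrow> nat \<Rightarrow> idx" where
  "long v j = restrict (\<lambda>l. if l = i then v
     else if l < t then j l
     else if i = 1 then (if l = 2 then j 0 \<circ> \<eta> else j (l - 2))
     else (if l = i - 1 then j (i - 1) \<circ> inv \<eta> else j (l - 2))) {0..n}"

lemma fpaths_iff:
  "f \<in> fpaths k N n \<rho> g \<pi> \<longleftrightarrow> f \<in> PiE {0..n} (\<lambda>_. Jset k N) \<and> f (i + 1) = f (i - 1) \<circ> \<eta> \<and>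
     short f \<in> fpaths k N (n - 2) \<rho> g' \<pi>'"
proof (cases "f \<in> PiE {0..n} (\<lambda>_. Jset k N) \<and> f (i + 1) = f (i - 1) \<circ> \<eta>")
  case False
  have "f (i + 1) = f (i - 1) \<circ> \<eta>" if f: "f \<in> fpaths k N n \<rho> g \<pi>"
  proof -
    have "i \<in> {i..<i+2}" "i + 1 \<in> {i..<i+2}" by auto
    then have "edge k g f i = edge k g f (i + 1)" using f blk unfolding fpaths_def by blast
    moreover have "f l \<in> Jset k N" if "l \<le> n" for l using f fpaths_subset paths_mem that by blast
    ultimately show ?thesis using compatible_edge[OF i \<eta> gi] by blast
  qed
  moreover have "f \<in> PiE {0..n} (\<lambda>_. Jset k N)" if "f \<in> fpaths k N n \<rho> g \<pi>"
    using that by (simp add: fpaths_def paths_def)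
  ultimately show ?thesis using False by blast
next
  case True
  then have f: "f \<in> PiE {0..n} (\<lambda>_. Jset k N)" and good: "f (i + 1) = f (i - 1) \<circ> \<eta>" by auto
  have fJ: "f l \<in> Jset k N" if "l \<le> n" for l using PiE_mem[OF f, of l] that by simp
  have "short f \<in> PiE {0..n-2} (\<lambda>_. Jset k N)"
    unfolding short_def restrict_PiE_iff using fJ n3 by auto
  moreover have "short f 0 = f 0" "short f (n - 2) = f n" using short_at(1)[of 0 f] short_at(2)[of "n - 2" f] t n3 by (simp_all del: add_2_eq_Suc')
  ultimately have paths: "f \<in> paths k N n \<rho> \<longleftrightarrow> short f \<in> paths k N (n - 2) \<rho>"
    using f by (simp only: paths_def mem_Collect_eq simp_thms)
  have B0: "edge k g f l = edge k g f l'" if "l \<in> {i..<i+2}" "l' \<in> {i..<i+2}" for l l'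
  proof -
    have "edge k g f i = edge k g f (i + 1)"
      by (rule iffD2[OF compatible_edge[OF i \<eta> gi] good]) (rule fJ)
    moreover have "l = i \<or> l = i + 1" "l' = i \<or> l' = i + 1" using that by auto
    ultimately show ?thesis by metis
  qed
  have edge: "edge k g f l = edge k g' (short f) (relab i 2 l)" if "B \<in> \<pi> - {{i..<i+2}}" "l \<in> B" for B l
  proof (rule edge_short[OF good])
    show "l \<in> {1..n} - {i..<i+2}" using other_blocks[OF part blk _ that(1)] that(2) by (meson one_le_numeral subsetD)
  qed
  have "(\<forall>B\<in>\<pi>. \<forall>l\<in>B. \<forall>l'\<in>B. edge k g f l = edge k g f l') \<longleftrightarrow>
    (\<forall>B\<in>\<pi> - {{i..<i+2}}. \<forall>l\<in>B. \<forall>l'\<in>B. edge k g f l = edge k g f l')"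
  proof (intro iffI ballI)
    fix B l l' assume *: "\<forall>B\<in>\<pi> - {{i..<i+2}}. \<forall>l\<in>B. \<forall>l'\<in>B. edge k g f l = edge k g f l'"
      "B \<in> \<pi>" "l \<in> B" "l' \<in> B"
    show "edge k g f l = edge k g f l'"
    proof (cases "B = {i..<i+2}")
      case True
      then show ?thesis using B0 *(3,4) by blast
    next
      case False
      then show ?thesis using * by blast
    qed
  next
    fix B l l' assume *: "\<forall>B\<in>\<pi>. \<forall>l\<in>B. \<forall>l'\<in>B. edge k g f l = edge k g f l'"
      "B \<in> \<pi> - {{i..<i+2}}" "l \<in> B" "l' \<in> B"
    then show "edge k g f l = edge k g f l'" by blast
  qed
  also have "\<dots> \<longleftrightarrow> (\<forall>B\<in>\<pi> - {{i..<i+2}}. \<forall>l\<in>B. \<forall>l'\<in>B.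
      edge k g' (short f) (relab i 2 l) = edge k g' (short f) (relab i 2 l'))"
    by (intro ball_cong refl) (simp only: edge)
  also have "\<dots> \<longleftrightarrow> (\<forall>B\<in>\<pi>'. \<forall>l\<in>B. \<forall>l'\<in>B. edge k g' (short f) l = edge k g' (short f) l')"
    unfolding del_block_def by simp
  finally show ?thesis using paths True by (simp add: fpaths_def)
qed

text \<open>The map sending \<open>f\<close> to the pair of \<open>f i\<close> and
  \<open>short f\<close> is a bijection: the vertex inside the pair is arbitrary and accounts for
  the factor \<open>N ^ k\<close>.\<close>

lemma card_fpaths_contract:
  "card (fpaths k N n \<rho> g \<pi>) = N ^ k * card (fpaths k N (n - 2) \<rho> g' \<pi>')"
proof -
  let ?F = "fpaths k N n \<rho> g \<pi>" and ?F' = "fpaths k N (n - 2) \<rho> g' \<pi>'"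
  define T where "T = (\<lambda>f. (f i, short f))"
  have "inj_on T ?F"
  proof (rule inj_onI)
    fix f f' assume ff: "f \<in> ?F" "f' \<in> ?F" and eq: "T f = T f'"
    then have f: "f \<in> PiE {0..n} (\<lambda>_. Jset k N)" "f (i + 1) = f (i - 1) \<circ> \<eta>"
      and f': "f' \<in> PiE {0..n} (\<lambda>_. Jset k N)" "f' (i + 1) = f' (i - 1) \<circ> \<eta>"
      unfolding fpaths_iff by auto
    have e: "f i = f' i" "short f = short f'" using eq by (auto simp: T_def)
    have lo: "f l = f' l" if "l < t" for l
      using fun_cong[OF e(2), of l] by (simp only: short_at(1)[OF that])
    have hi: "f l = f' l" if "t + 2 \<le> l" "l \<le> n" for l
    proof -
      have a: "t \<le> l - 2" "l - 2 \<le> n - 2" "l - 2 + 2 = l" using that by auto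
      show ?thesis using fun_cong[OF e(2), of "l - 2"] by (simp only: short_at(2)[OF a(1,2)] a(3))
    qed
    have "f l = f' l" if "l \<le> n" for l
    proof -
      consider "l < t" | "t + 2 \<le> l" | "l = i" | "l = t" "l \<noteq> i" | "l = t + 1" "l \<noteq> i" by linarith
      then show ?thesis
      proof cases
        case 4
        then have "i \<noteq> 1" using t_one by auto
        then have i2: "t = i - 1" "2 \<le> i" using i t_other by auto
        have "f (i + 1) = f' (i + 1)" using hi[of "i + 1"] i2 i by simp
        then have "f (i - 1) = f' (i - 1)" using f(2) f'(2) comp_Sym_cancel[OF \<eta>] by metis
        then show ?thesis using 4 i2 by simp
      next
        case 5
        then have "i = 1" using t_other i by fastforce
        then have i1: "t = 1" "i = 1" using t_one by auto
        have "f 0 = f' 0" using lo t by simp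
        then show ?thesis using f(2) f'(2) 5 i1 by simp
      qed (use lo hi e that in auto)
    qed
    then show "f = f'" using PiE_ext[OF f(1) f'(1)] by simp
  qed
  moreover have "T ` ?F = Jset k N \<times> ?F'"
  proof
    show "T ` ?F \<subseteq> Jset k N \<times> ?F'"
    proof (rule image_subsetI)
      fix f assume "f \<in> ?F"
      then have f: "f \<in> PiE {0..n} (\<lambda>_. Jset k N)" "short f \<in> ?F'" unfolding fpaths_iff by blast+
      have "f i \<in> Jset k N" using i by (intro PiE_mem[OF f(1)]) simp
      then show "T f \<in> Jset k N \<times> ?F'" using f(2) by (simp add: T_def)
    qed
    show "Jset k N \<times> ?F' \<subseteq> T ` ?F"
    proof
      fix z assume z: "z \<in> Jset k N \<times> ?F'"
      obtain v j where vj: "z = (v, j)" by (cases z)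
      then have v: "v \<in> Jset k N" and j: "j \<in> ?F'" using z by auto
      have jp: "j \<in> PiE {0..n-2} (\<lambda>_. Jset k N)" using j by (simp add: fpaths_def paths_def)
      have jJ: "j l \<in> Jset k N" if "l \<le> n - 2" for l using PiE_mem[OF jp, of l] that by simp
      define f where "f = long v j"
      have f_at: "f l = (if l = i then v else if l < t then j l
         else if i = 1 then (if l = 2 then j 0 \<circ> \<eta> else j (l - 2))
         else (if l = i - 1 then j (i - 1) \<circ> inv \<eta> else j (l - 2)))" if "l \<le> n" for l
        unfolding f_def long_def using that by simp
      have fi: "f i = v" using i by (simp add: f_at)
      have "f \<in> PiE {0..n} (\<lambda>_. Jset k N)"
        unfolding f_def long_def restrict_PiE_iff
        using v jJ \<eta> i t n3 by (auto intro!: Jset_comp)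
      moreover have "f (i + 1) = f (i - 1) \<circ> \<eta>"
      proof (cases "i = 1")
        case True
        have "f 2 = j 0 \<circ> \<eta>" "f 0 = j 0"
          using f_at[of 2] f_at[of 0] True t_one[OF True] n3 by simp_all
        then show ?thesis using True by (simp add: numeral_2_eq_2)
      next
        case False
        then have "f (i + 1) = j (i - 1)" "f (i - 1) = j (i - 1) \<circ> inv \<eta>"
          using i t t_other[OF False] by (auto simp: f_def long_def)
        then show ?thesis using Sym_inv_comp(1)[OF \<eta>] by (simp add: o_assoc[symmetric])
      qed
      moreover have short: "short f = j"
      proof
        fix l
        consider "l < t" | "t \<le> l" "l \<le> n - 2" | "n - 2 < l" by linarith
        then show "short f l = j l"
        proof cases
          case 1
          then show ?thesis using t short_at(1)[OF 1] f_at[of l] by simp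
        next
          case 2
          have "f (l + 2) = j l"
          proof (cases "i = 1")
            case True
            then show ?thesis using 2 t_one[OF True] n3 f_at[of "l + 2"] by simp
          next
            case False
            then show ?thesis using 2 t n3 i t_other[OF False] by (auto simp: f_def long_def)
          qed
          then show ?thesis using short_at(2)[OF 2] by simp
        next
          case 3
          then show ?thesis using jp by (simp add: short_def PiE_arb[OF jp])
        qed
      qed
      ultimately have "f \<in> ?F" using j unfolding fpaths_iff by simp
      moreover have "T f = z" using vj fi short by (simp add: T_def)
      ultimately show "z \<in> T ` ?F" by blast
    qed
  qed
  ultimately have "card ?F = card (Jset k N \<times> ?F')" by (metis card_image)
  then show ?thesis by (simp add: card_cartesian_product card_Jset)
qed

text \<open>The factor \<open>N ^ k\<close> of the count is exactly what the normalisation loses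
  with one block. At \<open>N = 0\<close> the quotients degenerate, hence the bound on
  \<open>N\<close>.\<close>

lemma fnorm_contract: "1 \<le> N \<Longrightarrow> fnorm N = D.fnorm N"
  using card_del_block[OF part blk, simplified]
  by (simp add: fnorm_def D.fnorm_def card_fpaths_contract power_add)

lemma fnorm_contract_tendsto: "D.fnorm \<longlonglongrightarrow> c \<Longrightarrow> fnorm \<longlonglongrightarrow> c"
  using tendsto_cong[of fnorm D.fnorm sequentially c] fnorm_contract
  by (metis (mono_tags, lifting) eventually_sequentially)

end

text \<open>Removing an interval pair keeps the crossing, so the descent can never arrive at a
  single pair or the empty partition. It must stop at an incompatible pair or at a pair closed too
  late, and both give the limit zero.\<close>

lemma crossing_pairing_limit:
  assumes "word_partition k n \<rho> g \<pi>" "\<And>B. B \<in> \<pi> \<Longrightarrow> card B = 2" "\<not> noncrossing \<pi>"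
  shows "word_partition.fnorm k n \<rho> g \<pi> \<longlonglongrightarrow> 0"
  using assms
proof (induction n arbitrary: g \<pi> rule: less_induct)
  case (less n)
  interpret word_partition k n \<rho> g \<pi> by (rule less.prems(1))
  have n: "1 \<le> n"
  proof (rule ccontr)
    assume "\<not> 1 \<le> n"
    then have "\<pi> = {}" using part by (simp add: partition_on_empty)
    then show False using less.prems(3) by (simp add: noncrossing_def)
  qed
  show ?case
  proof (cases "\<exists>i. {i..<i+2} \<in> \<pi> \<and> {0..i} \<subseteq> free")
    case False
    then show ?thesis using pairing_alternative[OF less.prems(2) n] by blast
  next
    case True
    then obtain i where i: "{i..<i+2} \<in> \<pi>" "{0..i} \<subseteq> free" by blast
    show ?thesis
    proof (cases "\<exists>\<eta>\<in>Sym k. g i = tau k \<circ> djs k id \<eta> \<circ> g (i + 1)")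
      case False
      then show ?thesis using incompatible_pair[OF i] by blast
    next
      case True
      then obtain \<eta> where \<eta>: "\<eta> \<in> Sym k" "g i = tau k \<circ> djs k id \<eta> \<circ> g (i + 1)" by blast
      have bnd: "1 \<le> i" "i + 1 \<le> n" using interval_bounds[OF part i(1)] by auto
      \<comment> \<open>With two points the interval pair would be the only block, which has nothing
        to cross.\<close>
      have "n \<noteq> 2"
      proof
        assume "n = 2"
        then have "{1..n} \<in> \<pi>" using i(1) bnd by (metis (no_types, lifting) One_nat_def Suc_1 add_2_eq_Suc' add_le_cancel_right atLeastLessThanSuc_atLeastAtMost le_antisym nat_1_add_1)
        then have "\<pi> = {{1..n}}" using partition_whole_block[OF part] n by auto
        then show False using less.prems(3) by (simp add: noncrossing_def)
      qed
      interpret P: compatible_pair k n \<rho> g \<pi> i \<eta>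
        by unfold_locales (use i \<eta> bnd \<open>n \<noteq> 2\<close> in auto)
      have "P.D.fnorm \<longlonglongrightarrow> 0"
      proof (rule less.IH)
        show "n - 2 < n" using n by simp
        show "word_partition k (n - 2) \<rho> P.g' P.\<pi>'" by (rule P.D.word_partition_axioms)
        show "\<not> noncrossing P.\<pi>'" using noncrossing_del_block[OF part i(1)] less.prems(3) by simp
        fix B assume "B \<in> P.\<pi>'"
        then obtain C where C: "C \<in> \<pi> - {{i..<i+2}}" "B = relab i 2 ` C" by (auto simp: del_block_def)
        have "inj_on (relab i 2) C"
          by (rule inj_on_subset[OF relab_inj[OF part i(1)] other_blocks[OF part i(1) _ C(1)]]) auto
        then show "card B = 2" using C less.prems(2) by (simp add: card_image)
      qed
      then show ?thesis by (rule P.fnorm_contract_tendsto)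
    qed
  qed
qed

section \<open>The monoid of letters and its representation by random matrices\<close>

text \<open>A letter \<open>(e, \<gamma>)\<close> stands for the matrix with entries \<open>M (cat i j \<circ> \<gamma>)\<close>, entrywise conjugated if \<open>e\<close>;
  all flattenings, their adjoints and their products with permutation matrices are of this form.
  An element \<open>(w, h)\<close> stands for the product of the letters of \<open>w\<close> followed by \<open>u_h\<close>; commuting \<open>u_h\<close> past a
  letter conjugates the letter, so these elements form a semidirect product.\<close>

type_synonym letter = "bool \<times> perm"
type_synonym element = "letter list \<times> perm"

definition lact :: "nat \<Rightarrow> perm \<Rightarrow> letter \<Rightarrow> letter" where
  "lact k h y = (fst y, djs k h h \<circ> snd y)"

text \<open>The adjoint exchanges row and column tuples, which is the effect of \<open>tau\<close>,
  and conjugates the entries.\<close>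

definition lstar :: "nat \<Rightarrow> letter \<Rightarrow> letter" where
  "lstar k y = (\<not> fst y, tau k \<circ> snd y)"

definition elements :: "nat \<Rightarrow> element set" where
  "elements k = {(w, h). (\<forall>y\<in>set w. snd y \<in> Sym (2*k)) \<and> h \<in> Sym k}"

definition e_mul :: "nat \<Rightarrow> element \<Rightarrow> element \<Rightarrow> element" where
  "e_mul k a b = (fst a @ map (lact k (snd a)) (fst b), snd a \<circ> snd b)"

definition e_star :: "nat \<Rightarrow> element \<Rightarrow> element" where
  "e_star k a = (rev (map (\<lambda>y. lact k (inv (snd a)) (lstar k y)) (fst a)), inv (snd a))"

lemma snd_lact [simp]: "snd y \<in> Sym (2*k) \<Longrightarrow> h \<in> Sym k \<Longrightarrow> snd (lact k h y) \<in> Sym (2*k)"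
  by (simp add: lact_def)

lemma snd_lstar [simp]: "snd y \<in> Sym (2*k) \<Longrightarrow> snd (lstar k y) \<in> Sym (2*k)"
  by (simp add: lstar_def)

lemma lact_lact: "h \<in> Sym k \<Longrightarrow> h' \<in> Sym k \<Longrightarrow> lact k h (lact k h' y) = lact k (h \<circ> h') y"
  by (simp add: lact_def o_assoc djs_comp)

lemma lact_id [simp]: "lact k id = id"
  by (simp add: lact_def fun_eq_iff)

lemma lstar_lstar [simp]: "lstar k (lstar k y) = y"
  by (simp add: lstar_def o_assoc tau_comp_tau)

lemma lstar_lact: "h \<in> Sym k \<Longrightarrow> lstar k (lact k h y) = lact k h (lstar k y)"
  by (simp add: lstar_def lact_def o_assoc tau_djs)

lemma Sk_monoid_elements: "Sk_monoid (elements k) (e_mul k) ([], id) (e_star k) k (\<lambda>\<eta>. ([], \<eta>))"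
proof
  fix x y z assume x: "x \<in> elements k"
  show "e_mul k ([], id) x = x" "e_mul k x ([], id) = x"
    by (simp_all add: e_mul_def)
  have sx: "snd x \<in> Sym k" "\<And>y. y \<in> set (fst x) \<Longrightarrow> snd y \<in> Sym (2*k)"
    using x by (auto simp: elements_def)
  show "e_star k x \<in> elements k"
    using sx by (auto simp: elements_def e_star_def)
  show "e_star k (e_star k x) = x"
  proof -
    obtain w h where wh: "x = (w, h)" "h \<in> Sym k" using sx(1) by (cases x) auto
    have "lact k h (lstar k (lact k (inv h) (lstar k y))) = y" for y
      using wh(2) by (simp add: lstar_lact lact_lact Sym_inv_comp)
    then show ?thesis using wh by (simp add: e_star_def rev_map comp_def)
  qed
  assume y: "y \<in> elements k"
  have sy: "snd y \<in> Sym k" "\<And>z. z \<in> set (fst y) \<Longrightarrow> snd z \<in> Sym (2*k)"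
    using y by (auto simp: elements_def)
  show "e_mul k x y \<in> elements k"
    using sx sy by (auto simp: elements_def e_mul_def)
  define hh where "hh = inv (snd x \<circ> snd y)"
  have hh: "hh = inv (snd y) \<circ> inv (snd x)" using sx sy by (simp add: hh_def Sym_inv_distrib[of _ k])
  have hs: "hh \<in> Sym k" using sx sy by (simp add: hh)
  have "hh \<circ> snd x = inv (snd y)"
    unfolding hh o_assoc[symmetric] Sym_inv_comp(1)[OF sx(1)] by simp
  then have A: "map (\<lambda>z. lact k hh (lstar k z)) (map (lact k (snd x)) v) = map (\<lambda>z. lact k (inv (snd y)) (lstar k z)) v" for v
    using sx(1) hs by (induction v) (simp_all add: lstar_lact lact_lact)
  have B: "map (\<lambda>z. lact k hh (lstar k z)) v = map (lact k (inv (snd y))) (map (\<lambda>z. lact k (inv (snd x)) (lstar k z)) v)" for v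
    unfolding hh using sx(1) sy(1) by (induction v) (simp_all add: lact_lact)
  show "e_star k (e_mul k x y) = e_mul k (e_star k y) (e_star k x)"
    unfolding e_star_def e_mul_def fst_conv snd_conv map_append rev_append hh_def[symmetric] A rev_map B[of "rev (fst x)"]
    by (simp only: hh)
  assume z: "z \<in> elements k"
  show "e_mul k (e_mul k x y) z = e_mul k x (e_mul k y z)"
    using sx sy z by (simp add: e_mul_def lact_lact o_assoc)
next
  show "e_star k ([], a) = ([], inv a)" for a by (simp add: e_star_def)
qed (auto simp: elements_def e_mul_def inj_on_def)

section \<open>Matrices attached to letters and elements\<close>

definition conj_if :: "bool \<Rightarrow> complex \<Rightarrow> complex" where
  "conj_if b z = (if b then cnj z else z)"

definition letter_mat :: "nat \<Rightarrow> (idx \<Rightarrow> complex) \<Rightarrow> letter \<Rightarrow> mat" where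
  "letter_mat k T y = (\<lambda>i j. conj_if (fst y) (T (cat k i j \<circ> snd y)))"

definition word_mat :: "nat \<Rightarrow> nat \<Rightarrow> (idx \<Rightarrow> complex) \<Rightarrow> letter list \<Rightarrow> mat" where
  "word_mat k N T w = mprod k N (map (letter_mat k T) w)"

definition elem_mat :: "nat \<Rightarrow> nat \<Rightarrow> (idx \<Rightarrow> complex) \<Rightarrow> element \<Rightarrow> mat" where
  "elem_mat k N T a = (\<lambda>i j. word_mat k N T (fst a) i (j \<circ> inv (snd a)))"

lemma letter_mat_lact:
  assumes "h \<in> Sym k"
  shows "letter_mat k T (lact k h y) i j = letter_mat k T y (i \<circ> h) (j \<circ> h)"
  by (simp add: letter_mat_def lact_def o_assoc cat_djs assms)

lemma letter_mat_lstar: "letter_mat k T (lstar k y) i j = cnj (letter_mat k T y j i)"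
  by (simp add: letter_mat_def lstar_def conj_if_def o_assoc cat_tau)

lemma word_mat_Nil: "word_mat k N T [] i j = (if i = j then 1 else 0)"
  by (simp add: word_mat_def mprod_def mid_def)

lemma word_mat_Cons: "word_mat k N T (y # w) i j = (\<Sum>l\<in>Jset k N. letter_mat k T y i l * word_mat k N T w l j)"
  by (simp add: word_mat_def mprod_def mmul_def)

lemma sum_Jset_delta:
  assumes "a \<in> Jset k N"
  shows "(\<Sum>l\<in>Jset k N. (if l = a then 1 else 0) * F l) = (F a :: complex)"
    "(\<Sum>l\<in>Jset k N. (if a = l then 1 else 0) * F l) = (F a :: complex)"
    "(\<Sum>l\<in>Jset k N. F l * (if l = a then 1 else 0)) = (F a :: complex)"
  using assms by (simp_all add: if_distrib if_distribR sum.delta sum.delta' cong: if_cong)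

lemma word_mat_append:
  assumes "i \<in> Jset k N"
  shows "word_mat k N T (w @ v) i j = (\<Sum>l\<in>Jset k N. word_mat k N T w i l * word_mat k N T v l j)"
  using assms
proof (induction w arbitrary: i)
  case Nil
  then show ?case using sum_Jset_delta(2)[OF Nil, of "\<lambda>l. word_mat k N T v l j"] by (simp add: word_mat_Nil)
next
  case (Cons y w)
  have "word_mat k N T ((y # w) @ v) i j
      = (\<Sum>m\<in>Jset k N. \<Sum>l\<in>Jset k N. letter_mat k T y i m * (word_mat k N T w m l * word_mat k N T v l j))"
    using Cons.IH by (simp add: word_mat_Cons sum_distrib_left)
  also have "\<dots> = (\<Sum>l\<in>Jset k N. \<Sum>m\<in>Jset k N. letter_mat k T y i m * (word_mat k N T w m l * word_mat k N T v l j))"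
    by (rule sum.swap)
  finally show ?case by (simp add: word_mat_Cons sum_distrib_right mult.assoc)
qed

lemma word_mat_single:
  assumes "j \<in> Jset k N"
  shows "word_mat k N T [y] i j = letter_mat k T y i j"
  using sum_Jset_delta(3)[OF assms] by (simp add: word_mat_Cons word_mat_Nil)

lemma sum_Jset_reindex:
  assumes "h \<in> Sym k"
  shows "(\<Sum>l\<in>Jset k N. F l) = (\<Sum>l\<in>Jset k N. F (l \<circ> h))"
  by (rule sum.reindex_bij_witness[where i="\<lambda>l. l \<circ> h" and j="\<lambda>l. l \<circ> inv h"])
    (use assms in \<open>auto simp: o_assoc[symmetric] Sym_inv_comp[OF assms]\<close>)

lemma word_mat_lact:
  assumes "h \<in> Sym k"
  shows "word_mat k N T (map (lact k h) w) i j = word_mat k N T w (i \<circ> h) (j \<circ> h)"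
proof (induction w arbitrary: i)
  case Nil
  show ?case unfolding list.map word_mat_Nil comp_Sym_cancel[OF assms] ..
next
  case (Cons y w)
  have "word_mat k N T (map (lact k h) (y # w)) i j
      = (\<Sum>l\<in>Jset k N. letter_mat k T y (i \<circ> h) (l \<circ> h) * word_mat k N T w (l \<circ> h) (j \<circ> h))"
    by (simp only: list.map word_mat_Cons letter_mat_lact[OF assms] Cons.IH)
  also have "\<dots> = (\<Sum>l\<in>Jset k N. letter_mat k T y (i \<circ> h) l * word_mat k N T w l (j \<circ> h))"
    by (rule sum_Jset_reindex[OF assms, symmetric])
  finally show ?case by (simp only: word_mat_Cons)
qed

lemma word_mat_lstar:
  assumes "i \<in> Jset k N" "j \<in> Jset k N"
  shows "word_mat k N T (rev (map (lstar k) w)) i j = cnj (word_mat k N T w j i)"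
  using assms
proof (induction w arbitrary: j)
  case Nil
  then show ?case by (auto simp: word_mat_Nil)
next
  case (Cons y w)
  have "word_mat k N T (rev (map (lstar k) w) @ [lstar k y]) i j
      = (\<Sum>l\<in>Jset k N. word_mat k N T (rev (map (lstar k) w)) i l * word_mat k N T [lstar k y] l j)"
    by (rule word_mat_append[OF Cons.prems(1)])
  also have "\<dots> = (\<Sum>l\<in>Jset k N. cnj (letter_mat k T y j l) * cnj (word_mat k N T w l i))"
    using Cons by (intro sum.cong) (simp_all add: word_mat_single letter_mat_lstar mult.commute)
  finally show ?case by (simp add: word_mat_Cons)
qed

text \<open>Letters acted on by \<open>h\<close> are the same matrices read at row and column tuples
  composed with \<open>h\<close>. The two sides therefore differ by the substitution
  \<open>l \<circ> h\<close> in the inner summation.\<close>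

lemma elem_mat_mul:
  assumes a: "a \<in> elements k" and b: "b \<in> elements k" and ij: "i \<in> Jset k N" "j \<in> Jset k N"
  shows "elem_mat k N T (e_mul k a b) i j = (\<Sum>l\<in>Jset k N. elem_mat k N T a i l * elem_mat k N T b l j)"
proof -
  obtain w h where a': "a = (w, h)" "h \<in> Sym k" using a by (cases a) (auto simp: elements_def)
  obtain v h' where b': "b = (v, h')" "h' \<in> Sym k" using b by (cases b) (auto simp: elements_def)
  have e: "j \<circ> (inv h' \<circ> inv h) \<circ> h = j \<circ> inv h'"
    using Sym_inv_comp(1)[OF a'(2)] by (simp add: o_assoc[symmetric])
  have c: "l \<circ> h \<circ> inv h = l" for l :: idx using Sym_inv_comp(2)[OF a'(2)] by (simp add: o_assoc[symmetric])
  have "elem_mat k N T (e_mul k a b) i j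
      = (\<Sum>l\<in>Jset k N. word_mat k N T w i l * word_mat k N T v (l \<circ> h) (j \<circ> inv h'))"
    using a' b' ij by (simp add: elem_mat_def e_mul_def word_mat_append word_mat_lact Sym_inv_distrib[of _ k] e)
  also have "\<dots> = (\<Sum>l\<in>Jset k N. elem_mat k N T a i (l \<circ> h) * elem_mat k N T b (l \<circ> h) j)"
    using a' b' by (simp add: elem_mat_def c)
  also have "\<dots> = (\<Sum>l\<in>Jset k N. elem_mat k N T a i l * elem_mat k N T b l j)"
    by (rule sum_Jset_reindex[OF a'(2), symmetric])
  finally show ?thesis .
qed

lemma elem_mat_star:
  assumes a: "a \<in> elements k" and ij: "i \<in> Jset k N" "j \<in> Jset k N"
  shows "elem_mat k N T (e_star k a) i j = cnj (elem_mat k N T a j i)"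
proof -
  obtain w h where a': "a = (w, h)" "h \<in> Sym k" using a by (cases a) (auto simp: elements_def)
  have "rev (map (\<lambda>y. lact k (inv h) (lstar k y)) w) = map (lact k (inv h)) (rev (map (lstar k) w))"
    by (simp add: rev_map o_def)
  moreover have "j \<circ> h \<circ> inv h = j" using Sym_inv_comp(2)[OF a'(2)] by (simp add: o_assoc[symmetric])
  ultimately show ?thesis
    using a' ij by (simp add: elem_mat_def e_star_def word_mat_lact word_mat_lstar)
qed

lemma elem_mat_u:
  assumes "\<eta> \<in> Sym k"
  shows "elem_mat k N T ([], \<eta>) i j = (if j = i \<circ> \<eta> then 1 else 0)"
proof -
  have "i = j \<circ> inv \<eta> \<longleftrightarrow> j = i \<circ> \<eta>"
    using Sym_inv_comp[OF assms] by (metis comp_id o_assoc)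
  then show ?thesis by (simp add: elem_mat_def word_mat_Nil)
qed

subsection \<open>Expansion over paths\<close>

definition wperm :: "letter list \<Rightarrow> nat \<Rightarrow> perm" where
  "wperm w l = snd (w ! (l - 1))"

definition wconj :: "letter list \<Rightarrow> nat \<Rightarrow> bool" where
  "wconj w l = fst (w ! (l - 1))"

text \<open>The arbitrary weight \<open>G\<close> on the two end points makes the induction on the
  last letter possible: summing over the new end point produces another such weight. The closing
  condition of \<open>paths\<close> is inserted as \<open>G\<close> later.\<close>

lemma word_mat_path_sum:
  "(\<Sum>a\<in>Jset k N. \<Sum>b\<in>Jset k N. word_mat k N T w a b * G a b) =
   (\<Sum>f\<in>PiE {0..length w} (\<lambda>_. Jset k N).
      (\<Prod>l\<in>{1..length w}. conj_if (wconj w l) (T (edge k (wperm w) f l))) * G (f 0) (f (length w)))"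
proof (induction w arbitrary: G rule: rev_induct)
  case Nil
  have "(\<Sum>f\<in>PiE {0::nat} (\<lambda>_. Jset k N). G (f 0) (f 0)) = (\<Sum>a\<in>Jset k N. G a a)"
    by (rule sum.reindex_bij_witness[where i="\<lambda>a. restrict (\<lambda>_. a) {0}" and j="\<lambda>f. f 0"])
      (auto simp: fun_eq_iff PiE_iff extensional_def)
  moreover have "(\<Sum>b\<in>Jset k N. word_mat k N T [] a b * G a b) = G a a" if "a \<in> Jset k N" for a
    using sum_Jset_delta(2)[OF that, of "G a"] by (simp add: word_mat_Nil)
  ultimately show ?case by simp
next
  case (snoc y w)
  let ?n = "length w" and ?J = "Jset k N"
  let ?pr = "\<lambda>f. \<Prod>l\<in>{1..?n}. conj_if (wconj w l) (T (edge k (wperm w) f l))"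
  let ?pr' = "\<lambda>f. \<Prod>l\<in>{1..Suc ?n}. conj_if (wconj (w @ [y]) l) (T (edge k (wperm (w @ [y])) f l))"
  have "(\<Sum>a\<in>?J. \<Sum>b\<in>?J. word_mat k N T (w @ [y]) a b * G a b)
      = (\<Sum>a\<in>?J. \<Sum>c\<in>?J. word_mat k N T w a c * (\<Sum>b\<in>?J. letter_mat k T y c b * G a b))"
  proof (rule sum.cong)
    fix a assume a: "a \<in> ?J"
    have "(\<Sum>b\<in>?J. word_mat k N T (w @ [y]) a b * G a b)
        = (\<Sum>b\<in>?J. \<Sum>c\<in>?J. word_mat k N T w a c * (letter_mat k T y c b * G a b))"
      using a by (intro sum.cong) (simp_all add: word_mat_append word_mat_single sum_distrib_right mult.assoc)
    also have "\<dots> = (\<Sum>c\<in>?J. \<Sum>b\<in>?J. word_mat k N T w a c * (letter_mat k T y c b * G a b))"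
      by (rule sum.swap)
    finally show "(\<Sum>b\<in>?J. word_mat k N T (w @ [y]) a b * G a b)
        = (\<Sum>c\<in>?J. word_mat k N T w a c * (\<Sum>b\<in>?J. letter_mat k T y c b * G a b))"
      by (simp add: sum_distrib_left)
  qed simp
  also have "\<dots> = (\<Sum>f\<in>PiE {0..?n} (\<lambda>_. ?J). ?pr f * (\<Sum>b\<in>?J. letter_mat k T y (f ?n) b * G (f 0) b))"
    by (rule snoc.IH)
  also have "\<dots> = (\<Sum>f\<in>PiE {0..?n} (\<lambda>_. ?J). \<Sum>b\<in>?J. ?pr f * (letter_mat k T y (f ?n) b * G (f 0) b))"
    by (simp only: sum_distrib_left)
  also have "\<dots> = (\<Sum>b\<in>?J. \<Sum>f\<in>PiE {0..?n} (\<lambda>_. ?J). ?pr f * (letter_mat k T y (f ?n) b * G (f 0) b))"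
    by (rule sum.swap)
  also have "\<dots> = (\<Sum>(b, f)\<in>?J \<times> PiE {0..?n} (\<lambda>_. ?J). ?pr f * (letter_mat k T y (f ?n) b * G (f 0) b))"
    by (rule sum.cartesian_product)
  also have "\<dots> = (\<Sum>(b, f)\<in>?J \<times> PiE {0..?n} (\<lambda>_. ?J). ?pr' (f(Suc ?n := b)) * G (f 0) b)"
  proof (rule sum.cong[OF refl], clarify)
    fix b f
    have "?pr' (f(Suc ?n := b)) = (\<Prod>l\<in>{1..?n}. conj_if (wconj (w @ [y]) l) (T (edge k (wperm (w @ [y])) (f(Suc ?n := b)) l)))
        * conj_if (wconj (w @ [y]) (Suc ?n)) (T (edge k (wperm (w @ [y])) (f(Suc ?n := b)) (Suc ?n)))"
      by (simp add: prod.nat_ivl_Suc')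
    also have "(\<Prod>l\<in>{1..?n}. conj_if (wconj (w @ [y]) l) (T (edge k (wperm (w @ [y])) (f(Suc ?n := b)) l))) = ?pr f"
      by (rule prod.cong) (auto simp: wconj_def wperm_def edge_def nth_append)
    also have "conj_if (wconj (w @ [y]) (Suc ?n)) (T (edge k (wperm (w @ [y])) (f(Suc ?n := b)) (Suc ?n)))
        = letter_mat k T y (f ?n) b"
      by (simp add: wconj_def wperm_def edge_def letter_mat_def)
    finally show "?pr f * (letter_mat k T y (f ?n) b * G (f 0) b) = ?pr' (f(Suc ?n := b)) * G (f 0) b"
      by (simp only: mult.assoc)
  qed
  also have "\<dots> = (\<Sum>f\<in>PiE {0..Suc ?n} (\<lambda>_. ?J). ?pr' f * G (f 0) (f (Suc ?n)))"
  \<comment> \<open>Appending a vertex is undone by resetting it to \<open>undefined\<close>, which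
    restores extensionality on \<open>{0..n}\<close>.\<close>
  proof (rule sum.reindex_bij_witness[where i="\<lambda>f. (f (Suc ?n), f(Suc ?n := undefined))" and j="\<lambda>(b, f). f(Suc ?n := b)"])
    fix z assume z: "z \<in> ?J \<times> PiE {0..?n} (\<lambda>_. ?J)"
    obtain b f where bf: "z = (b, f)" "b \<in> ?J" "f \<in> PiE {0..?n} (\<lambda>_. ?J)" using z by (cases z) auto
    have "f (Suc ?n) = undefined" using PiE_arb[OF bf(3), of "Suc ?n"] by simp
    then show "(\<lambda>f. (f (Suc ?n), f(Suc ?n := undefined))) ((\<lambda>(b, f). f(Suc ?n := b)) z) = z"
      using bf by (simp add: fun_upd_idem)
    show "(\<lambda>(b, f). f(Suc ?n := b)) z \<in> PiE {0..Suc ?n} (\<lambda>_. ?J)"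
      using PiE_fun_upd[OF bf(2,3), of "Suc ?n"] bf(1) by (simp add: atLeastAtMostSuc_conv)
    show "?pr' ((\<lambda>(b, f). f(Suc ?n := b)) z) * G ((\<lambda>(b, f). f(Suc ?n := b)) z 0) ((\<lambda>(b, f). f(Suc ?n := b)) z (Suc ?n))
       = (case z of (b, f) \<Rightarrow> ?pr' (f(Suc ?n := b)) * G (f 0) b)"
      using bf(1) by simp
  next
    fix f assume f: "f \<in> PiE {0..Suc ?n} (\<lambda>_. ?J)"
    show "(f (Suc ?n), f(Suc ?n := undefined)) \<in> ?J \<times> PiE {0..?n} (\<lambda>_. ?J)"
      using f by (auto simp: PiE_def extensional_def Pi_def)
  qed simp
  finally show ?case by simp
qed

section \<open>Limits of the normalised traces\<close>

lemma empty_word_limit: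
  assumes "word_partition k 0 \<rho> g {}"
  shows "word_partition.fnorm k 0 \<rho> g {} \<longlonglongrightarrow> (if \<rho> = id then 1 else 0)"
proof -
  interpret word_partition k 0 \<rho> g "{}" by (rule assms)
  have fr: "0 \<in> free" by (simp add: free_def)
  show ?thesis
  proof (cases "\<rho> = id")
    case True
    have "fpaths k N 0 \<rho> g {} = PiE {0} (\<lambda>_. Jset k N)" for N
      by (simp add: fpaths_def paths_def True)
    then have "card (fpaths k N 0 \<rho> g {}) = N ^ k" for N
      by (simp add: card_PiE card_Jset)
    then have "fnorm N = 1" if "N \<ge> 1" for N using that by (simp add: fnorm_def)
    then have "fnorm \<longlonglongrightarrow> 1" by (intro tendsto_eventually eventually_sequentiallyI[of 1]) auto
    then show ?thesis using True by simp
  next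
    case False
    then obtain q where q: "\<rho> q \<noteq> q" by (meson eq_id_iff)
    have qk: "q \<in> {1..k}" using q Sym_outside[OF \<rho>, of q] by blast
    then have rq: "\<rho> q \<in> {1..k}" using Sym_in[OF \<rho>] by blast
    have "fnorm \<longlonglongrightarrow> 0"
    proof (rule fnorm_tendsto_0[OF fr fr qk rq])
      show "(0, q) \<noteq> (0, \<rho> q)" using q by simp
      fix N f assume "f \<in> fpaths k N 0 \<rho> g {}"
      then have "f 0 = f 0 \<circ> \<rho>" by (simp add: fpaths_def paths_def)
      then show "f 0 q = f 0 (\<rho> q)" by (metis comp_apply)
    qed
    then show ?thesis using False by simp
  qed
qed

text \<open>The descent by contraction of compatible pairs, for crossing and non-crossing pairings
  alike. Existence suffices at this point; for non-crossing pairings the value is matched with the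
  nested maps by following the same contraction.\<close>

lemma pairing_limit_exists:
  assumes "word_partition k n \<rho> g \<pi>" "\<And>B. B \<in> \<pi> \<Longrightarrow> card B = 2"
  shows "\<exists>c. word_partition.fnorm k n \<rho> g \<pi> \<longlonglongrightarrow> c"
  using assms
proof (induction n arbitrary: g \<pi> rule: less_induct)
  case (less n)
  interpret word_partition k n \<rho> g \<pi> by (rule less.prems(1))
  show ?case
  proof (cases "n = 0")
    case True
    then have "\<pi> = {}" using part by (simp add: partition_on_empty)
    then show ?thesis using empty_word_limit less.prems(1) True by blast
  next
    case n0: False
    then have n: "1 \<le> n" by simp
    show ?thesis
    proof (cases "\<exists>i. {i..<i+2} \<in> \<pi> \<and> {0..i} \<subseteq> free")
      case False
      then show ?thesis using pairing_alternative[OF less.prems(2) n] by blast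
    next
      case True
      then obtain i where i: "{i..<i+2} \<in> \<pi>" "{0..i} \<subseteq> free" by blast
      show ?thesis
      proof (cases "\<exists>\<eta>\<in>Sym k. g i = tau k \<circ> djs k id \<eta> \<circ> g (i + 1)")
        case False
        then show ?thesis using incompatible_pair[OF i] by blast
      next
        case True
        then obtain \<eta> where \<eta>: "\<eta> \<in> Sym k" "g i = tau k \<circ> djs k id \<eta> \<circ> g (i + 1)" by blast
        have bnd: "1 \<le> i" "i + 1 \<le> n" using interval_bounds[OF part i(1)] by auto
        show ?thesis
        proof (cases "n = 2")
          case n2: True
          then have "i = 1" using bnd by simp
          then have "{i..<i+2} = {1..n}" using n2 by auto
          then have "\<pi> = {{1..2}}" using partition_whole_block[OF part] i(1) n2 by auto
          then show ?thesis using pair_partition_limit[OF n2] by blast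
        next
          case False
          interpret P: compatible_pair k n \<rho> g \<pi> i \<eta>
            by unfold_locales (use i \<eta> bnd False in auto)
          have "\<exists>c. P.D.fnorm \<longlonglongrightarrow> c"
          proof (rule less.IH)
            show "n - 2 < n" using n by simp
            show "word_partition k (n - 2) \<rho> P.g' P.\<pi>'" by (rule P.D.word_partition_axioms)
            fix B assume "B \<in> P.\<pi>'"
            then obtain C where C: "C \<in> \<pi> - {{i..<i+2}}" "B = relab i 2 ` C" by (auto simp: del_block_def)
            have "inj_on (relab i 2) C"
              by (rule inj_on_subset[OF relab_inj[OF part i(1)] other_blocks[OF part i(1) _ C(1)]]) auto
            then show "card B = 2" using C less.prems(2) by (simp add: card_image)
          qed
          then show ?thesis using P.fnorm_contract_tendsto by blast
        qed
      qed
    qed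
  qed
qed

text \<open>As \<open>lim\<close> is total this is a number for every partition, but it is known to
  be the limit for pairings; other partitions enter with weight zero.\<close>

definition ell :: "nat \<Rightarrow> nat \<Rightarrow> perm \<Rightarrow> (nat \<Rightarrow> perm) \<Rightarrow> nat set set \<Rightarrow> complex" where
  "ell k n \<rho> g \<pi> = lim (word_partition.fnorm k n \<rho> g \<pi>)"

lemma ell_tendsto:
  assumes "word_partition k n \<rho> g \<pi>" "\<And>B. B \<in> \<pi> \<Longrightarrow> card B = 2"
  shows "word_partition.fnorm k n \<rho> g \<pi> \<longlonglongrightarrow> ell k n \<rho> g \<pi>"
proof -
  obtain c where c: "word_partition.fnorm k n \<rho> g \<pi> \<longlonglongrightarrow> c" using pairing_limit_exists[OF assms] by blast
  then show ?thesis unfolding ell_def using limI by blast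
qed

lemma ell_eqI: "word_partition.fnorm k n \<rho> g \<pi> \<longlonglongrightarrow> c \<Longrightarrow> ell k n \<rho> g \<pi> = c"
  unfolding ell_def by (rule limI)

lemma cnj_measurable [measurable]: "cnj \<in> borel_measurable borel"
  by (intro borel_measurable_continuous_onI linear_continuous_on bounded_linear_cnj)

section \<open>Moments of the tensor entries\<close>

locale random_tensor =
  fixes k :: nat and P :: "nat \<Rightarrow> 'w measure" and M :: "nat \<Rightarrow> 'w \<Rightarrow> idx \<Rightarrow> complex"
    and c :: real and c' :: complex
  assumes k1: "1 \<le> k" and H: "Hyp_H k P M c c'"
begin

definition mom :: "nat \<Rightarrow> nat \<Rightarrow> nat \<Rightarrow> complex" where
  "mom N p q = integral\<^sup>L (P N) (\<lambda>\<omega>. M N \<omega> (ent0 k) ^ p * cnj (M N \<omega> (ent0 k)) ^ q)"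

definition mu :: "nat \<Rightarrow> nat \<Rightarrow> complex" where
  "mu p q = (if p = 1 \<and> q = 1 then of_real c else if p = 2 \<and> q = 0 then c'
     else if p = 0 \<and> q = 2 then cnj c' else 0)"

lemma prob_P: "1 \<le> N \<Longrightarrow> prob_space (P N)"
  using H unfolding Hyp_H_def by blast

text \<open>\<open>mom N 0 0\<close> is 1 and \<open>N ^ k\<close> diverges, hence the restriction
  to positive order, which blocks of a partition always have. Order one vanishes by centring, and
  \<open>(0, 2)\<close> is the conjugate of \<open>(2, 0)\<close>.\<close>

lemma mom_tendsto:
  assumes "1 \<le> p + q"
  shows "(\<lambda>N. of_nat N ^ k * mom N p q) \<longlonglongrightarrow> mu p q"
proof -
  consider "p + q > 2" | "p = 1" "q = 0" | "p = 0" "q = 1" | "p = 1" "q = 1" | "p = 2" "q = 0" | "p = 0" "q = 2"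
    using assms by linarith
  then show ?thesis
  proof cases
    case 1
    then have "mu p q = 0" by (auto simp: mu_def)
    then show ?thesis using H 1 unfolding Hyp_H_def mom_def by simp
  next
    case 2
    have "mom N p q = 0" if "1 \<le> N" for N using H that 2 unfolding Hyp_H_def mom_def by simp
    then have "(\<lambda>N. of_nat N ^ k * mom N p q) \<longlonglongrightarrow> 0"
      by (intro tendsto_eventually eventually_sequentiallyI[of 1]) auto
    then show ?thesis using 2 by (simp add: mu_def)
  next
    case 3
    have "mom N p q = 0" if "1 \<le> N" for N using H that 3 unfolding Hyp_H_def mom_def by simp
    then have "(\<lambda>N. of_nat N ^ k * mom N p q) \<longlonglongrightarrow> 0"
      by (intro tendsto_eventually eventually_sequentiallyI[of 1]) auto
    then show ?thesis using 3 by (simp add: mu_def)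
  next
    case 4
    have lim: "(\<lambda>N. real N ^ k * integral\<^sup>L (P N) (\<lambda>\<omega>. cmod (M N \<omega> (ent0 k)) ^ 2)) \<longlonglongrightarrow> c"
      using H unfolding Hyp_H_def by blast
    have "mom N p q = of_real (integral\<^sup>L (P N) (\<lambda>\<omega>. cmod (M N \<omega> (ent0 k)) ^ 2))" for N
      unfolding mom_def using 4 by (simp add: complex_norm_square[symmetric] flip: of_real_power integral_complex_of_real)
    then have "(\<lambda>N. of_nat N ^ k * mom N p q)
        = (\<lambda>N. of_real (real N ^ k * integral\<^sup>L (P N) (\<lambda>\<omega>. cmod (M N \<omega> (ent0 k)) ^ 2)))"
      by simp
    then show ?thesis using tendsto_of_real[OF lim, where 'a=complex] 4 by (simp add: mu_def)
  next
    case 5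
    then show ?thesis using H unfolding Hyp_H_def mom_def mu_def by simp
  next
    case 6
    have lim: "(\<lambda>N. of_nat N ^ k * integral\<^sup>L (P N) (\<lambda>\<omega>. M N \<omega> (ent0 k) ^ 2)) \<longlonglongrightarrow> c'"
      using H unfolding Hyp_H_def by blast
    have "mom N p q = cnj (integral\<^sup>L (P N) (\<lambda>\<omega>. M N \<omega> (ent0 k) ^ 2))" for N
      unfolding mom_def using 6 Bochner_Integration.integral_cnj[of "P N" "\<lambda>\<omega>. M N \<omega> (ent0 k) ^ 2"] by simp
    then show ?thesis using tendsto_cnj[OF lim] 6 by (simp add: mu_def)
  qed
qed

lemma ent0_in_Iset: "1 \<le> N \<Longrightarrow> ent0 k \<in> Iset k N"
  unfolding ent0_def Iset_def by auto

lemma entry_measurable: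
  assumes "1 \<le> N" "v \<in> Iset k N"
  shows "(\<lambda>\<omega>. M N \<omega> v) \<in> borel_measurable (P N)"
proof -
  interpret prob_space "P N" by (rule prob_P[OF assms(1)])
  have "indep_vars (\<lambda>_. borel) (\<lambda>i \<omega>. M N \<omega> i) (Iset k N)"
    using H assms(1) unfolding Hyp_H_def by blast
  then show ?thesis using assms(2) by (simp add: indep_vars_def)
qed

text \<open>Finite moments are assumed for one reference entry; equality of distributions transports
  integrability and value to every entry.\<close>

lemma entry_moment:
  assumes N: "1 \<le> N" and v: "v \<in> Iset k N"
  shows "integrable (P N) (\<lambda>\<omega>. M N \<omega> v ^ p * cnj (M N \<omega> v) ^ q)"
    and "integral\<^sup>L (P N) (\<lambda>\<omega>. M N \<omega> v ^ p * cnj (M N \<omega> v) ^ q) = mom N p q"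
proof -
  define h where "h z = z ^ p * cnj z ^ q" for z :: complex
  have h: "h \<in> borel_measurable borel" unfolding h_def by measurable
  note m = entry_measurable[OF N v] and m0 = entry_measurable[OF N ent0_in_Iset[OF N]]
  have eq: "distr (P N) borel (\<lambda>\<omega>. M N \<omega> v) = distr (P N) borel (\<lambda>\<omega>. M N \<omega> (ent0 k))"
    using H N v unfolding Hyp_H_def by blast
  have "integrable (P N) (\<lambda>\<omega>. cmod (M N \<omega> (ent0 k)) ^ (p + q))"
    using H N unfolding Hyp_H_def by blast
  then have int0: "integrable (P N) (\<lambda>\<omega>. h (M N \<omega> (ent0 k)))"
    by (rule Bochner_Integration.integrable_bound)
      (use measurable_compose[OF m0 h] in \<open>auto simp: h_def norm_mult norm_power power_add\<close>)
  have "integrable (distr (P N) borel (\<lambda>\<omega>. M N \<omega> v)) h"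
    unfolding eq using int0 by (simp add: integrable_distr_eq[OF m0 h])
  then show "integrable (P N) (\<lambda>\<omega>. M N \<omega> v ^ p * cnj (M N \<omega> v) ^ q)"
    by (simp add: integrable_distr_eq[OF m h]) (simp add: h_def)
  have "integral\<^sup>L (P N) (\<lambda>\<omega>. h (M N \<omega> v)) = integral\<^sup>L (P N) (\<lambda>\<omega>. h (M N \<omega> (ent0 k)))"
    using integral_distr[OF m h] integral_distr[OF m0 h] eq by simp
  then show "integral\<^sup>L (P N) (\<lambda>\<omega>. M N \<omega> v ^ p * cnj (M N \<omega> v) ^ q) = mom N p q"
    by (simp add: h_def mom_def)
qed

lemma prod_conj_if:
  assumes "finite S"
  shows "(\<Prod>l\<in>S. conj_if (\<epsilon> l) z) = z ^ card {l\<in>S. \<not> \<epsilon> l} * cnj z ^ card {l\<in>S. \<epsilon> l}"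
  using assms
proof (induction S rule: finite_induct)
  case (insert x F)
  have "{l\<in>insert x F. \<epsilon> l} = (if \<epsilon> x then insert x {l\<in>F. \<epsilon> l} else {l\<in>F. \<epsilon> l})"
    "{l\<in>insert x F. \<not> \<epsilon> l} = (if \<epsilon> x then {l\<in>F. \<not> \<epsilon> l} else insert x {l\<in>F. \<not> \<epsilon> l})" by auto
  then show ?case using insert by (simp add: conj_if_def)
qed simp

text \<open>Positions are grouped by the tensor entry they read. Distinct entries are independent,
  so the expectation factorises over the groups, and each group contributes a mixed moment whose
  orders count its plain and conjugated letters.\<close>

lemma path_moment:
  fixes x :: "nat \<Rightarrow> idx" and n :: nat
  assumes N: "1 \<le> N" and x: "\<And>l. l \<in> {1..n} \<Longrightarrow> x l \<in> Iset k N"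
  shows "integrable (P N) (\<lambda>\<omega>. \<Prod>l\<in>{1..n}. conj_if (\<epsilon> l) (M N \<omega> (x l)))"
    and "integral\<^sup>L (P N) (\<lambda>\<omega>. \<Prod>l\<in>{1..n}. conj_if (\<epsilon> l) (M N \<omega> (x l)))
      = (\<Prod>B\<in>(\<lambda>l. {l'\<in>{1..n}. x l' = x l}) ` {1..n}. mom N (card {l\<in>B. \<not> \<epsilon> l}) (card {l\<in>B. \<epsilon> l}))"
proof -
  interpret prob_space "P N" by (rule prob_P[OF N])
  define V where "V = x ` {1..n}"
  define B where "B v = {l \<in> {1..n}. x l = v}" for v
  define p where "p v = card {l\<in>B v. \<not> \<epsilon> l}" for v
  define q where "q v = card {l\<in>B v. \<epsilon> l}" for v
  define Y where "Y v \<omega> = M N \<omega> v ^ p v * cnj (M N \<omega> v) ^ q v" for v \<omega>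
  have V: "finite V" "V \<subseteq> Iset k N" using x by (auto simp: V_def)
  have prod: "(\<Prod>l\<in>{1..n}. conj_if (\<epsilon> l) (M N \<omega> (x l))) = (\<Prod>v\<in>V. Y v \<omega>)" for \<omega>
  proof -
    have "(\<Prod>l\<in>{1..n}. conj_if (\<epsilon> l) (M N \<omega> (x l)))
        = (\<Prod>v\<in>V. \<Prod>l\<in>B v. conj_if (\<epsilon> l) (M N \<omega> (x l)))"
      unfolding V_def B_def by (rule prod.image_gen) simp
    also have "\<dots> = (\<Prod>v\<in>V. \<Prod>l\<in>B v. conj_if (\<epsilon> l) (M N \<omega> v))"
      by (intro prod.cong refl) (simp add: B_def)
    also have "\<dots> = (\<Prod>v\<in>V. Y v \<omega>)"
      unfolding Y_def p_def q_def by (intro prod.cong refl prod_conj_if) (simp add: B_def)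
    finally show ?thesis .
  qed
  have "indep_vars (\<lambda>_. borel) (\<lambda>i \<omega>. M N \<omega> i) (Iset k N)"
    using H N unfolding Hyp_H_def by blast
  then have "indep_vars (\<lambda>_. borel) (\<lambda>i \<omega>. M N \<omega> i) V" by (rule indep_vars_subset) (rule V)
  then have indep: "indep_vars (\<lambda>_. borel) Y V"
    unfolding Y_def by (rule indep_vars_compose2[where Y="\<lambda>v z. z ^ p v * cnj z ^ q v"]) measurable
  have int: "integrable (P N) (Y v)" if "v \<in> V" for v
    unfolding Y_def by (rule entry_moment(1)[OF N]) (use that V in auto)
  show "integrable (P N) (\<lambda>\<omega>. \<Prod>l\<in>{1..n}. conj_if (\<epsilon> l) (M N \<omega> (x l)))"
    unfolding prod by (rule indep_vars_integrable[OF V(1) indep int])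
  have "integral\<^sup>L (P N) (\<lambda>\<omega>. \<Prod>v\<in>V. Y v \<omega>) = (\<Prod>v\<in>V. integral\<^sup>L (P N) (Y v))"
    by (rule indep_vars_lebesgue_integral[OF V(1) indep int])
  also have "\<dots> = (\<Prod>v\<in>V. mom N (p v) (q v))"
    by (rule prod.cong[OF refl], unfold Y_def, rule entry_moment(2)[OF N]) (use V in auto)
  also have "\<dots> = (\<Prod>B\<in>B ` V. mom N (card {l\<in>B. \<not> \<epsilon> l}) (card {l\<in>B. \<epsilon> l}))"
  proof -
    have "inj_on B V"
    proof (rule inj_onI)
      fix v v' assume "v \<in> V" "v' \<in> V" "B v = B v'"
      then obtain l where "l \<in> {1..n}" "v = x l" by (auto simp: V_def)
      then have "l \<in> B v" by (simp add: B_def)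
      then have "l \<in> B v'" using \<open>B v = B v'\<close> by simp
      then show "v = v'" using \<open>v = x l\<close> by (simp add: B_def)
    qed
    then show ?thesis by (simp add: prod.reindex p_def q_def)
  qed
  also have "B ` V = (\<lambda>l. {l'\<in>{1..n}. x l' = x l}) ` {1..n}" by (simp add: V_def B_def image_image)
  finally show "integral\<^sup>L (P N) (\<lambda>\<omega>. \<Prod>l\<in>{1..n}. conj_if (\<epsilon> l) (M N \<omega> (x l)))
      = (\<Prod>B\<in>(\<lambda>l. {l'\<in>{1..n}. x l' = x l}) ` {1..n}. mom N (card {l\<in>B. \<not> \<epsilon> l}) (card {l\<in>B. \<epsilon> l}))"
    unfolding prod .
qed

section \<open>Expected normalised traces and their limits\<close>

definition tr_elem :: "nat \<Rightarrow> element \<Rightarrow> 'w \<Rightarrow> complex" where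
  "tr_elem N a \<omega> = (\<Sum>i\<in>Jset k N. elem_mat k N (M N \<omega>) a i i)"

definition phiN' :: "nat \<Rightarrow> element \<Rightarrow> complex" where
  "phiN' N a = integral\<^sup>L (P N) (\<lambda>\<omega>. tr_elem N a \<omega> / of_nat N ^ k)"

lemma tr_elem_paths:
  assumes "h \<in> Sym k"
  shows "tr_elem N (w, h) \<omega> = (\<Sum>f\<in>paths k N (length w) (inv h).
     \<Prod>l\<in>{1..length w}. conj_if (wconj w l) (M N \<omega> (edge k (wperm w) f l)))"
proof -
  let ?\<rho> = "inv h"
  have "tr_elem N (w, h) \<omega> = (\<Sum>a\<in>Jset k N. \<Sum>b\<in>Jset k N. word_mat k N (M N \<omega>) w a b * (if b = a \<circ> ?\<rho> then 1 else 0))"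
    unfolding tr_elem_def elem_mat_def using assms by (simp add: sum_Jset_delta(3))
  also have "\<dots> = (\<Sum>f\<in>PiE {0..length w} (\<lambda>_. Jset k N).
      (\<Prod>l\<in>{1..length w}. conj_if (wconj w l) (M N \<omega> (edge k (wperm w) f l))) * (if f (length w) = f 0 \<circ> ?\<rho> then 1 else 0))"
    by (rule word_mat_path_sum)
  also have "\<dots> = (\<Sum>f\<in>paths k N (length w) ?\<rho>.
      (\<Prod>l\<in>{1..length w}. conj_if (wconj w l) (M N \<omega> (edge k (wperm w) f l))) * (if f (length w) = f 0 \<circ> ?\<rho> then 1 else 0))"
    by (rule sum.mono_neutral_right) (auto simp: paths_def intro!: finite_PiE)
  also have "\<dots> = (\<Sum>f\<in>paths k N (length w) ?\<rho>.
      (\<Prod>l\<in>{1..length w}. conj_if (wconj w l) (M N \<omega> (edge k (wperm w) f l))))"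
    by (rule sum.cong) (auto simp: paths_def)
  finally show ?thesis .
qed

lemma wperm_Sym: "(w, h) \<in> elements k \<Longrightarrow> l \<in> {1..length w} \<Longrightarrow> wperm w l \<in> Sym (2*k)"
  by (auto simp: elements_def wperm_def)

lemma edge_in_Iset:
  assumes "(w, h) \<in> elements k" "f \<in> paths k N (length w) \<rho>" "l \<in> {1..length w}"
  shows "edge k (wperm w) f l \<in> Iset k N"
  unfolding edge_def using assms wperm_Sym paths_mem by (auto intro!: Iset_comp cat_in_Iset)

lemma tr_elem_integrable:
  assumes "1 \<le> N" "a \<in> elements k"
  shows "integrable (P N) (tr_elem N a)"
proof -
  obtain w h where a: "a = (w, h)" by (cases a)
  then have h: "h \<in> Sym k" using assms by (auto simp: elements_def)
  show ?thesis unfolding a tr_elem_paths[OF h]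
    by (intro Bochner_Integration.integrable_sum path_moment(1)[OF assms(1)] edge_in_Iset)
      (use assms a in auto)
qed

definition weight :: "letter list \<Rightarrow> nat set set \<Rightarrow> complex" where
  "weight w \<pi> = (\<Prod>B\<in>\<pi>. mu (card {l\<in>B. \<not> wconj w l}) (card {l\<in>B. wconj w l}))"

lemma mu_zero: "p + q \<noteq> 2 \<Longrightarrow> mu p q = 0"
  by (auto simp: mu_def)

lemma card_split: "finite B \<Longrightarrow> card {l\<in>B. \<not> Q l} + card {l\<in>B. Q l} = card B"
  by (subst card_Un_disjoint[symmetric]) (auto intro: arg_cong[where f=card])

lemma weight_zero:
  assumes "finite \<pi>" "B \<in> \<pi>" "finite B" "card B \<noteq> 2"
  shows "weight w \<pi> = 0"
proof -
  have "mu (card {l\<in>B. \<not> wconj w l}) (card {l\<in>B. wconj w l}) = 0"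
    by (rule mu_zero) (use card_split[OF assms(3)] assms(4) in simp)
  then show ?thesis unfolding weight_def using assms(1,2) by (intro prod_zero bexI)
qed

text \<open>Paths are sorted by kernel. The factor \<open>N ^ k\<close> of the trace and one factor
  \<open>N ^ k\<close> for each block make up the denominator of \<open>cnorm\<close>; the latter
  are returned to the moments, where they are the scaling under which the moments converge.\<close>

lemma phiN'_expansion:
  assumes N: "1 \<le> N" and w: "(w, h) \<in> elements k"
  shows "phiN' N (w, h) = (\<Sum>\<pi>\<in>{\<pi>. partition_on {1..length w} \<pi>}.
     word_partition.cnorm k (length w) (inv h) (wperm w) \<pi> N *
     (\<Prod>B\<in>\<pi>. of_nat N ^ k * mom N (card {l\<in>B. \<not> wconj w l}) (card {l\<in>B. wconj w l})))"
proof -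
  let ?n = "length w" and ?\<rho> = "inv h" and ?g = "wperm w"
  let ?mm = "\<lambda>B. mom N (card {l\<in>B. \<not> wconj w l}) (card {l\<in>B. wconj w l})"
  have h: "h \<in> Sym k" using w by (auto simp: elements_def)
  have "phiN' N (w, h) = integral\<^sup>L (P N) (\<lambda>\<omega>. tr_elem N (w, h) \<omega>) / of_nat N ^ k"
    unfolding phiN'_def by simp
  also have "integral\<^sup>L (P N) (\<lambda>\<omega>. tr_elem N (w, h) \<omega>) = (\<Sum>f\<in>paths k N ?n ?\<rho>.
      integral\<^sup>L (P N) (\<lambda>\<omega>. \<Prod>l\<in>{1..?n}. conj_if (wconj w l) (M N \<omega> (edge k ?g f l))))"
    unfolding tr_elem_paths[OF h]
    by (rule Bochner_Integration.integral_sum) (rule path_moment(1)[OF N edge_in_Iset[OF w]])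
  also have "\<dots> = (\<Sum>f\<in>paths k N ?n ?\<rho>. \<Prod>B\<in>kernel k ?n ?g f. ?mm B)"
    by (rule sum.cong[OF refl], unfold kernel_def, rule path_moment(2)[OF N edge_in_Iset[OF w]])
  also have "\<dots> = (\<Sum>\<pi>\<in>{\<pi>. partition_on {1..?n} \<pi>}. \<Sum>f\<in>{f\<in>paths k N ?n ?\<rho>. kernel k ?n ?g f = \<pi>}. \<Prod>B\<in>kernel k ?n ?g f. ?mm B)"
    by (rule sum.group[symmetric])
      (simp_all add: finitely_many_partition_on image_subset_iff partition_on_kernel del: One_nat_def)
  also have "\<dots> = (\<Sum>\<pi>\<in>{\<pi>. partition_on {1..?n} \<pi>}. of_nat (card (cpaths k N ?n ?\<rho> ?g \<pi>)) * (\<Prod>B\<in>\<pi>. ?mm B))"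
    by (rule sum.cong[OF refl]) (simp add: cpaths_def)
  also have "\<dots> / of_nat N ^ k = (\<Sum>\<pi>\<in>{\<pi>. partition_on {1..?n} \<pi>}.
      word_partition.cnorm k ?n ?\<rho> ?g \<pi> N * (\<Prod>B\<in>\<pi>. of_nat N ^ k * ?mm B))"
    unfolding sum_divide_distrib
  proof (rule sum.cong[OF refl])
    fix \<pi> assume \<pi>: "\<pi> \<in> {\<pi>. partition_on {1..?n} \<pi>}"
    interpret word_partition k ?n ?\<rho> ?g \<pi>
      by unfold_locales (use k1 h wperm_Sym[OF w] \<pi> in auto)
    have "(\<Prod>B\<in>\<pi>. of_nat N ^ k * ?mm B) = (of_nat N ^ k) ^ card \<pi> * (\<Prod>B\<in>\<pi>. ?mm B)"
      by (simp add: prod.distrib)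
    then show "of_nat (card (cpaths k N ?n ?\<rho> ?g \<pi>)) * (\<Prod>B\<in>\<pi>. ?mm B) / of_nat N ^ k
        = cnorm N * (\<Prod>B\<in>\<pi>. of_nat N ^ k * ?mm B)"
      using N by (simp add: cnorm_def power_add power_mult)
  qed
  finally show ?thesis .
qed

text \<open>For a pairing both factors converge. For any other partition some rescaled block moment
  tends to zero, and the path count only has to stay bounded.\<close>

theorem phiN'_tendsto:
  assumes w: "(w, h) \<in> elements k"
  shows "(\<lambda>N. phiN' N (w, h)) \<longlonglongrightarrow> (\<Sum>\<pi>\<in>{\<pi>. partition_on {1..length w} \<pi>}.
     weight w \<pi> * ell k (length w) (inv h) (wperm w) \<pi>)"
proof -
  let ?n = "length w" and ?\<rho> = "inv h" and ?g = "wperm w"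
  let ?mm = "\<lambda>N B. mom N (card {l\<in>B. \<not> wconj w l}) (card {l\<in>B. wconj w l})"
  have h: "h \<in> Sym k" using w by (auto simp: elements_def)
  have "(\<lambda>N. \<Sum>\<pi>\<in>{\<pi>. partition_on {1..?n} \<pi>}.
      word_partition.cnorm k ?n ?\<rho> ?g \<pi> N * (\<Prod>B\<in>\<pi>. of_nat N ^ k * ?mm N B)) \<longlonglongrightarrow>
      (\<Sum>\<pi>\<in>{\<pi>. partition_on {1..?n} \<pi>}. weight w \<pi> * ell k ?n ?\<rho> ?g \<pi>)"
  proof (rule tendsto_sum)
    fix \<pi> assume \<pi>: "\<pi> \<in> {\<pi>. partition_on {1..?n} \<pi>}"
    interpret word_partition k ?n ?\<rho> ?g \<pi>
      by unfold_locales (use k1 h wperm_Sym[OF w] \<pi> in auto)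
    have cardB: "card {l\<in>B. \<not> wconj w l} + card {l\<in>B. wconj w l} = card B" if "B \<in> \<pi>" for B
      using blocks[OF that] by (intro card_split) simp
    have "1 \<le> card B" if "B \<in> \<pi>" for B using blocks[OF that] by (simp add: card_gt_0_iff Suc_leI)
    then have wt: "(\<lambda>N. \<Prod>B\<in>\<pi>. of_nat N ^ k * ?mm N B) \<longlonglongrightarrow> weight w \<pi>"
      unfolding weight_def by (intro tendsto_prod mom_tendsto) (simp add: cardB)
    show "(\<lambda>N. cnorm N * (\<Prod>B\<in>\<pi>. of_nat N ^ k * ?mm N B)) \<longlonglongrightarrow> weight w \<pi> * ell k ?n ?\<rho> ?g \<pi>"
    proof (cases "\<forall>B\<in>\<pi>. card B = 2")
      case True
      then have "cnorm \<longlonglongrightarrow> ell k ?n ?\<rho> ?g \<pi>"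
        by (intro cnorm_tendsto ell_tendsto word_partition_axioms) auto
      from tendsto_mult[OF this wt] show ?thesis by (simp add: mult.commute)
    next
      case False
      then obtain B where B: "B \<in> \<pi>" "card B \<noteq> 2" by blast
      then have w0: "weight w \<pi> = 0" using blocks[OF B(1)] by (intro weight_zero[OF finite_part]) auto
      \<comment> \<open>The normalised count is at most one in modulus, so the product is dominated
        by the moments, whose limit is \<open>weight w \<pi> = 0\<close>.\<close>
      have "(\<lambda>N. cnorm N * (\<Prod>B\<in>\<pi>. of_nat N ^ k * ?mm N B)) \<longlonglongrightarrow> 0"
      proof (rule Lim_null_comparison)
        show "\<forall>\<^sub>F N in sequentially. norm (cnorm N * (\<Prod>B\<in>\<pi>. of_nat N ^ k * ?mm N B)) \<le> norm (\<Prod>B\<in>\<pi>. of_nat N ^ k * ?mm N B)"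
          by (rule always_eventually) (simp only: norm_mult, intro allI mult_left_le_one_le norm_cnorm_le norm_ge_zero)
        show "(\<lambda>N. norm (\<Prod>B\<in>\<pi>. of_nat N ^ k * ?mm N B)) \<longlonglongrightarrow> 0"
          using tendsto_norm[OF wt] w0 by simp
      qed
      then show ?thesis using w0 by simp
    qed
  qed
  moreover have "eventually (\<lambda>N. (\<Sum>\<pi>\<in>{\<pi>. partition_on {1..?n} \<pi>}.
      word_partition.cnorm k ?n ?\<rho> ?g \<pi> N * (\<Prod>B\<in>\<pi>. of_nat N ^ k * ?mm N B)) = phiN' N (w, h)) sequentially"
    by (rule eventually_sequentiallyI[of 1]) (simp add: phiN'_expansion[OF _ w])
  ultimately show ?thesis by (rule Lim_transform_eventually)
qed

definition phi :: "element \<Rightarrow> complex" where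
  "phi a = lim (\<lambda>N. phiN' N a)"

lemma phiN'_phi: "a \<in> elements k \<Longrightarrow> (\<lambda>N. phiN' N a) \<longlonglongrightarrow> phi a"
proof -
  assume a: "a \<in> elements k"
  obtain w h where wh: "a = (w, h)" by (cases a)
  from phiN'_tendsto[of w h] a show ?thesis unfolding phi_def wh using limI by fastforce
qed

lemma phi_eq:
  assumes "(w, h) \<in> elements k"
  shows "phi (w, h) = (\<Sum>\<pi>\<in>{\<pi>. partition_on {1..length w} \<pi>}. weight w \<pi> * ell k (length w) (inv h) (wperm w) \<pi>)"
  unfolding phi_def by (rule limI[OF phiN'_tendsto[OF assms]])

text \<open>\<open>phi\<close> depends only on the matrices representing an element, so formally
  different elements with equal matrices have equal values.\<close>

lemma phi_cong:
  assumes "\<And>N i. i \<in> Jset k N \<Longrightarrow> (\<And>\<omega>. elem_mat k N (M N \<omega>) a i i = elem_mat k N (M N \<omega>) b i i)"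
  shows "phi a = phi b"
  unfolding phi_def phiN'_def tr_elem_def using assms by (simp cong: sum.cong)

lemma phi_trace:
  assumes "a \<in> elements k" "b \<in> elements k"
  shows "phi (e_mul k a b) = phi (e_mul k b a)"
proof -
  have "tr_elem N (e_mul k a b) \<omega> = tr_elem N (e_mul k b a) \<omega>" for N \<omega>
    unfolding tr_elem_def using assms by (simp add: elem_mat_mul) (subst sum.swap, simp add: mult.commute)
  then show ?thesis by (simp add: phi_def phiN'_def)
qed

lemma phi_star:
  assumes "a \<in> elements k"
  shows "phi (e_star k a) = cnj (phi a)"
proof -
  have "tr_elem N (e_star k a) \<omega> = cnj (tr_elem N a \<omega>)" for N \<omega>
    unfolding tr_elem_def using assms by (simp add: elem_mat_star)
  then have "phiN' N (e_star k a) = cnj (phiN' N a)" for N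
    unfolding phiN'_def by (simp flip: Bochner_Integration.integral_cnj)
  moreover have "e_star k a \<in> elements k"
  proof -
    interpret E: Sk_monoid "elements k" "e_mul k" "([], id)" "e_star k" k "\<lambda>\<eta>. ([], \<eta>)" by (rule Sk_monoid_elements)
    show ?thesis by (rule E.st_closed[OF assms])
  qed
  ultimately show ?thesis using tendsto_cnj[OF phiN'_phi[OF assms]] unfolding phi_def by (simp add: limI)
qed

lemma phi_u:
  assumes "\<eta> \<in> Sym k"
  shows "phi ([], \<eta>) = (if \<eta> = id then 1 else 0)"
proof -
  have el: "([], \<eta>) \<in> elements k" using assms by (simp add: elements_def)
  have "word_partition k 0 (inv \<eta>) (wperm []) {}"
    by unfold_locales (use k1 assms in \<open>auto simp: partition_on_empty\<close>)
  then have "ell k 0 (inv \<eta>) (wperm []) {} = (if inv \<eta> = id then 1 else 0)"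
    by (intro ell_eqI empty_word_limit)
  moreover have "inv \<eta> = id \<longleftrightarrow> \<eta> = id" using Sym_inv_inv[OF assms] by fastforce
  ultimately show ?thesis by (simp add: phi_eq[OF el] partition_on_empty weight_def)
qed

text \<open>At size \<open>N\<close> the double sum is the expected normalised squared
  Hilbert-Schmidt norm of the combination of the matrices of \<open>d p\<close> with coefficients
  \<open>f p\<close>. Non-negativity survives the limit.\<close>

lemma phi_positive:
  assumes "finite S" and d: "\<And>p. p \<in> S \<Longrightarrow> d p \<in> elements k"
  shows "0 \<le> Re (\<Sum>p\<in>S. \<Sum>q\<in>S. cnj (f p) * f q * phi (e_mul k (e_star k (d p)) (d q)))"
proof -
  interpret E: Sk_monoid "elements k" "e_mul k" "([], id)" "e_star k" k "\<lambda>\<eta>. ([], \<eta>)" by (rule Sk_monoid_elements)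
  let ?X = "\<lambda>N. \<Sum>p\<in>S. \<Sum>q\<in>S. cnj (f p) * f q * phiN' N (e_mul k (e_star k (d p)) (d q))"
  have lim: "?X \<longlonglongrightarrow> (\<Sum>p\<in>S. \<Sum>q\<in>S. cnj (f p) * f q * phi (e_mul k (e_star k (d p)) (d q)))"
    by (intro tendsto_intros phiN'_phi) (use d in auto)
  have "0 \<le> Re (?X N)" if N: "1 \<le> N" for N
  proof -
    let ?R = "\<lambda>\<omega> p. elem_mat k N (M N \<omega>) (d p)"
    have sq: "(\<Sum>p\<in>S. \<Sum>q\<in>S. cnj (f p) * f q * (tr_elem N (e_mul k (e_star k (d p)) (d q)) \<omega> / of_nat N ^ k))
        = of_real ((\<Sum>i\<in>Jset k N. \<Sum>l\<in>Jset k N. (cmod (\<Sum>p\<in>S. f p * ?R \<omega> p l i))\<^sup>2) / real N ^ k)" (is "?L = ?Q") for \<omega>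
    proof -
      have "?Q = (\<Sum>i\<in>Jset k N. \<Sum>l\<in>Jset k N. (\<Sum>p\<in>S. cnj (f p * ?R \<omega> p l i)) * (\<Sum>q\<in>S. f q * ?R \<omega> q l i)) / of_nat N ^ k"
        by (simp add: complex_norm_square[unfolded of_real_power] mult.commute)
      also have "(\<Sum>i\<in>Jset k N. \<Sum>l\<in>Jset k N. (\<Sum>p\<in>S. cnj (f p * ?R \<omega> p l i)) * (\<Sum>q\<in>S. f q * ?R \<omega> q l i))
          = (\<Sum>i\<in>Jset k N. \<Sum>l\<in>Jset k N. \<Sum>p\<in>S. \<Sum>q\<in>S. cnj (f p) * f q * (cnj (?R \<omega> p l i) * ?R \<omega> q l i))"
        unfolding sum_product by (simp add: mult_ac)
      also have "\<dots> = (\<Sum>i\<in>Jset k N. \<Sum>p\<in>S. \<Sum>l\<in>Jset k N. \<Sum>q\<in>S. cnj (f p) * f q * (cnj (?R \<omega> p l i) * ?R \<omega> q l i))"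
        by (intro sum.cong refl sum.swap)
      also have "\<dots> = (\<Sum>p\<in>S. \<Sum>i\<in>Jset k N. \<Sum>l\<in>Jset k N. \<Sum>q\<in>S. cnj (f p) * f q * (cnj (?R \<omega> p l i) * ?R \<omega> q l i))"
        by (rule sum.swap)
      also have "\<dots> = (\<Sum>p\<in>S. \<Sum>i\<in>Jset k N. \<Sum>q\<in>S. \<Sum>l\<in>Jset k N. cnj (f p) * f q * (cnj (?R \<omega> p l i) * ?R \<omega> q l i))"
        by (intro sum.cong refl sum.swap)
      also have "\<dots> = (\<Sum>p\<in>S. \<Sum>q\<in>S. \<Sum>i\<in>Jset k N. \<Sum>l\<in>Jset k N. cnj (f p) * f q * (cnj (?R \<omega> p l i) * ?R \<omega> q l i))"
        by (intro sum.cong refl sum.swap)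
      also have "\<dots> = (\<Sum>p\<in>S. \<Sum>q\<in>S. cnj (f p) * f q * tr_elem N (e_mul k (e_star k (d p)) (d q)) \<omega>)"
        using d by (intro sum.cong refl) (simp add: tr_elem_def elem_mat_mul elem_mat_star sum_distrib_left)
      finally show ?thesis by (simp add: sum_divide_distrib)
    qed
    let ?F = "\<lambda>p q \<omega>. cnj (f p) * f q * (tr_elem N (e_mul k (e_star k (d p)) (d q)) \<omega> / of_nat N ^ k)"
    have int: "integrable (P N) (?F p q)" if "p \<in> S" "q \<in> S" for p q
      using that d by (intro integrable_mult_right integrable_divide tr_elem_integrable[OF N]) auto
    have "?X N = (\<Sum>p\<in>S. \<Sum>q\<in>S. integral\<^sup>L (P N) (?F p q))"
      by (simp add: phiN'_def)
    also have "\<dots> = (\<Sum>p\<in>S. integral\<^sup>L (P N) (\<lambda>\<omega>. \<Sum>q\<in>S. ?F p q \<omega>))"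
      by (intro sum.cong refl Bochner_Integration.integral_sum[symmetric] int)
    also have "\<dots> = integral\<^sup>L (P N) (\<lambda>\<omega>. \<Sum>p\<in>S. \<Sum>q\<in>S. ?F p q \<omega>)"
      by (intro Bochner_Integration.integral_sum[symmetric] Bochner_Integration.integrable_sum int)
    also have "\<dots> = of_real (integral\<^sup>L (P N) (\<lambda>\<omega>. (\<Sum>i\<in>Jset k N. \<Sum>l\<in>Jset k N. (cmod (\<Sum>p\<in>S. f p * ?R \<omega> p l i))\<^sup>2) / real N ^ k))"
      unfolding sq by (rule integral_complex_of_real)
    finally show ?thesis
      by (simp only: Re_complex_of_real) (intro integral_nonneg_AE AE_I2 divide_nonneg_nonneg sum_nonneg zero_le_power2 zero_le_power of_nat_0_le_iff)
  qed
  then show ?thesis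
    using tendsto_lowerbound[OF tendsto_Re[OF lim], of 0] eventually_sequentiallyI[of 1 "\<lambda>N. 0 \<le> Re (?X N)"] by simp
qed

end

section \<open>The limiting probability space\<close>

context random_tensor
begin

text \<open>The ambient type of the theorem consists of functions on \<open>nat list\<close>. The
  elements form a countable set, so one-entry lists holding their numbers serve as names, and the
  monoid is transported along this coding.\<close>

definition enc :: "element \<Rightarrow> nat list" where
  "enc a = [to_nat_on (elements k) a]"

definition dec :: "nat list \<Rightarrow> element" where
  "dec = inv_into (elements k) enc"

lemma countable_elements: "countable (elements k)"
proof -
  let ?A = "(UNIV :: bool set) \<times> Sym (2*k)"
  have "elements k \<subseteq> lists ?A \<times> Sym k" by (auto simp: elements_def)
  moreover have "countable (lists ?A \<times> Sym k)"
    by (intro countable_SIGMA countable_lists countable_finite) auto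
  ultimately show ?thesis by (rule countable_subset)
qed

lemma enc_inj: "inj_on enc (elements k)"
  using inj_on_to_nat_on[OF countable_elements] by (simp add: enc_def inj_on_def)

lemma dec_enc [simp]: "a \<in> elements k \<Longrightarrow> dec (enc a) = a"
  unfolding dec_def by (rule inv_into_f_f[OF enc_inj])

definition "G = enc ` elements k"
definition "opr x y = enc (e_mul k (dec x) (dec y))"
definition "star x = enc (e_star k (dec x))"
definition "unit = enc ([], id)"
definition "u \<eta> = enc ([], \<eta>)"
definition "\<phi> x = phi (dec x)"

sublocale El: Sk_monoid "elements k" "e_mul k" "([], id)" "e_star k" k "\<lambda>\<eta>. ([], \<eta>)"
  by (rule Sk_monoid_elements)

lemma elements_u [simp]: "\<eta> \<in> Sym k \<Longrightarrow> ([], \<eta>) \<in> elements k"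
  by (simp add: elements_def)

lemma dec_G [simp]: "x \<in> G \<Longrightarrow> dec x \<in> elements k" "x \<in> G \<Longrightarrow> enc (dec x) = x"
  by (auto simp: G_def)

lemma enc_G [simp]: "a \<in> elements k \<Longrightarrow> enc a \<in> G"
  by (simp add: G_def)

lemma enc_mul: "a \<in> elements k \<Longrightarrow> b \<in> elements k \<Longrightarrow> opr (enc a) (enc b) = enc (e_mul k a b)"
  by (simp add: opr_def)

lemma Sk_monoid_G: "Sk_monoid G opr unit star k u"
proof
  show "inj_on u (Sym k)"
  proof (rule inj_onI)
    fix a b assume "a \<in> Sym k" "b \<in> Sym k" "u a = u b"
    then show "a = b" using inj_onD[OF enc_inj, of "([], a)" "([], b)"] by (simp add: u_def)
  qed
qed (auto simp: opr_def star_def unit_def u_def El.op_assoc El.st_op El.u_comp El.u_st)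

sublocale A: Sk_trace G opr unit star k u \<phi>
proof -
  interpret Sk_monoid G opr unit star k u by (rule Sk_monoid_G)
  show "Sk_trace G opr unit star k u \<phi>"
  proof
    show "\<phi> (opr a b) = \<phi> (opr b a)" if "a \<in> G" "b \<in> G" for a b
      using that by (simp add: \<phi>_def opr_def phi_trace)
    show "\<phi> (u \<eta>) = (if \<eta> = id then 1 else 0)" if "\<eta> \<in> Sym k" for \<eta>
      using that by (simp add: \<phi>_def u_def phi_u)
    show "\<phi> (star a) = cnj (\<phi> a)" if "a \<in> G" for a
      using that by (simp add: \<phi>_def star_def phi_star)
    fix f assume f: "f \<in> FS"
    then have S: "finite (supp f)" "supp f \<subseteq> G" by (auto simp: finsupp_def)
    have "lp (f_mul (f_star f) f) \<phi> = cnj (lp f (\<lambda>p. cnj (lp f (\<lambda>q. \<phi> (opr (star p) q)))))"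
      using f by simp
    also have "\<dots> = (\<Sum>p\<in>supp f. \<Sum>q\<in>supp f. cnj (f p) * f q * \<phi> (opr (star p) q))"
      by (simp add: lp_def sum_distrib_left mult.assoc)
    also have "\<dots> = (\<Sum>p\<in>supp f. \<Sum>q\<in>supp f. cnj (f p) * f q * phi (e_mul k (e_star k (dec p)) (dec q)))"
      by (intro sum.cong refl) (use S in \<open>auto simp: \<phi>_def opr_def star_def subset_iff\<close>)
    finally have eq: "lp (f_mul (f_star f) f) \<phi>
        = (\<Sum>p\<in>supp f. \<Sum>q\<in>supp f. cnj (f p) * f q * phi (e_mul k (e_star k (dec p)) (dec q)))" .
    show "0 \<le> Re (lp (f_mul (f_star f) f) \<phi>)"
      unfolding eq by (rule phi_positive[OF S(1)]) (use S(2) in auto)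
  qed
qed

text \<open>The span of elements with exactly one letter. Group-algebra elements have no letters and
  word length adds up under products, so this is a bimodule; it contains every
  \<open>m^\<epsilon> b\<close> of the definition of circularity.\<close>

definition V :: "(nat list \<Rightarrow> complex) set" where
  "V = {f \<in> A.FS. \<forall>x\<in>supp f. length (fst (dec x)) = 1}"

lemma V_mul:
  assumes f: "f \<in> A.FS" "\<And>x. x \<in> supp f \<Longrightarrow> length (fst (dec x)) = m"
    and g: "g \<in> A.FS" "\<And>x. x \<in> supp g \<Longrightarrow> length (fst (dec x)) = l" and ml: "m + l = 1"
  shows "A.f_mul f g \<in> V"
proof -
  have "length (fst (dec x)) = 1" if x: "x \<in> supp (A.f_mul f g)" for x
  proof -
    obtain p q where pq: "p \<in> supp f" "q \<in> supp g" "x = opr p q"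
      using A.supp_mul[OF f(1) g(1)] x by auto
    then have "p \<in> G" "q \<in> G" using f(1) g(1) by (auto simp: finsupp_def)
    then have "fst (dec x) = fst (dec p) @ map (lact k (snd (dec p))) (fst (dec q))"
      unfolding pq(3) opr_def by (simp add: e_mul_def[symmetric]) (simp add: e_mul_def)
    then show ?thesis using f(2)[OF pq(1)] g(2)[OF pq(2)] ml by simp
  qed
  then show ?thesis using f(1) g(1) by (simp add: V_def)
qed

lemma supp_emb: "x \<in> supp (A.emb b) \<Longrightarrow> length (fst (dec x)) = 0"
proof -
  assume "x \<in> supp (A.emb b)"
  then have "(\<Sum>\<eta>\<in>Sym k. b \<eta> * delta (u \<eta>) x) \<noteq> 0" by (simp add: supp_def A.emb_def)
  then obtain \<eta> where "\<eta> \<in> Sym k" "b \<eta> * delta (u \<eta>) x \<noteq> 0" by (rule sum.not_neutral_contains_not_neutral)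
  then show ?thesis by (auto simp: delta_def u_def split: if_splits)
qed

sublocale W: Sk_submodule G opr unit star k u \<phi> V
proof
  show "V \<subseteq> A.FS" by (auto simp: V_def)
  show "f_add x y \<in> V" if "x \<in> V" "y \<in> V" for x y
    using that supp_add[of x y] by (auto simp: V_def)
  show "f_smult a x \<in> V" if "x \<in> V" for a x
    using that supp_smult[of a x] by (auto simp: V_def)
  show "A.f_mul (A.emb b) x \<in> V" if "x \<in> V" for b x
    by (rule V_mul[of _ 0 _ 1]) (use that supp_emb in \<open>auto simp: V_def\<close>)
  show "A.f_mul x (A.emb b) \<in> V" if "x \<in> V" for b x
    by (rule V_mul[of _ 1 _ 0]) (use that supp_emb in \<open>auto simp: V_def\<close>)
qed

text \<open>A scaled basis element \<open>(s, y, h)\<close> of \<open>V\<close> is \<open>s y u_h\<close>; its letter absorbs \<open>u_h\<close>.\<close>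

definition el :: "complex \<times> letter \<times> perm \<Rightarrow> nat list \<Rightarrow> complex" where
  "el z = f_smult (fst z) (delta (enc ([fst (snd z)], snd (snd z))))"

definition absorb :: "complex \<times> letter \<times> perm \<Rightarrow> letter" where
  "absorb z = (fst (fst (snd z)), djs k id (inv (snd (snd z))) \<circ> snd (fst (snd z)))"

definition basis :: "(complex \<times> letter \<times> perm) set" where
  "basis = {z. snd (fst (snd z)) \<in> Sym (2*k) \<and> snd (snd z) \<in> Sym k}"

lemma basis_elements: "z \<in> basis \<Longrightarrow> ([fst (snd z)], snd (snd z)) \<in> elements k"
  by (auto simp: basis_def elements_def)

lemma el_V: "z \<in> basis \<Longrightarrow> el z \<in> V"
proof -
  assume z: "z \<in> basis"
  have "supp (el z) \<subseteq> {enc ([fst (snd z)], snd (snd z))}"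
    using supp_smult[of "fst z"] unfolding el_def by (metis supp_delta)
  then have "\<forall>x\<in>supp (el z). length (fst (dec x)) = 1" using basis_elements[OF z] by auto
  moreover have "el z \<in> A.FS" unfolding el_def by (intro finsupp_smult finsupp_delta enc_G basis_elements z)
  ultimately show ?thesis unfolding V_def by blast
qed

lemma absorb_Sym: "z \<in> basis \<Longrightarrow> snd (absorb z) \<in> Sym (2*k)"
  by (simp add: basis_def absorb_def)

lemma mul_delta_enc:
  "a \<in> elements k \<Longrightarrow> b \<in> elements k \<Longrightarrow> A.f_mul (delta (enc a)) (delta (enc b)) = delta (enc (e_mul k a b))"
  by (simp add: A.mul_delta enc_mul)

lemma emb_scaled_u: "\<eta> \<in> Sym k \<Longrightarrow> A.emb (f_smult s (cs_u \<eta>)) = f_smult s (delta (enc ([], \<eta>)))"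
  by (simp add: A.emb_smult cs_u_eq_delta A.emb_delta u_def)

lemma f_smult_smult: "f_smult a (f_smult b f) = f_smult (a * b) f"
  by (simp add: f_smult_def mult.assoc)

definition ract_el :: "complex \<Rightarrow> perm \<Rightarrow> complex \<times> letter \<times> perm \<Rightarrow> complex \<times> letter \<times> perm" where
  "ract_el s \<eta> z = (fst z * s, fst (snd z), snd (snd z) \<circ> \<eta>)"

definition lact_el :: "complex \<Rightarrow> perm \<Rightarrow> complex \<times> letter \<times> perm \<Rightarrow> complex \<times> letter \<times> perm" where
  "lact_el s \<eta> z = (s * fst z, lact k \<eta> (fst (snd z)), \<eta> \<circ> snd (snd z))"

lemma ract_basis [simp]: "z \<in> basis \<Longrightarrow> \<eta> \<in> Sym k \<Longrightarrow> ract_el s \<eta> z \<in> basis"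
  by (simp add: basis_def ract_el_def)

lemma lact_basis [simp]: "z \<in> basis \<Longrightarrow> \<eta> \<in> Sym k \<Longrightarrow> lact_el s \<eta> z \<in> basis"
  by (simp add: basis_def lact_el_def)

lemma el_ract:
  assumes "z \<in> basis" "\<eta> \<in> Sym k"
  shows "A.f_mul (el z) (A.emb (f_smult s (cs_u \<eta>))) = el (ract_el s \<eta> z)"
  using assms basis_elements[OF assms(1)]
  by (simp add: emb_scaled_u el_def A.mul_smult mul_delta_enc f_smult_smult ract_el_def e_mul_def mult.commute)

lemma el_lact:
  assumes "z \<in> basis" "\<eta> \<in> Sym k"
  shows "A.f_mul (A.emb (f_smult s (cs_u \<eta>))) (el z) = el (lact_el s \<eta> z)"
  using assms basis_elements[OF assms(1)]
  by (simp add: emb_scaled_u el_def A.mul_smult mul_delta_enc f_smult_smult lact_el_def e_mul_def mult.commute)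

lemma absorb_ract:
  assumes "z \<in> basis" "\<eta> \<in> Sym k"
  shows "absorb (ract_el s \<eta> z) = (fst (absorb z), djs k id (inv \<eta>) \<circ> snd (absorb z))"
  using assms by (simp add: absorb_def ract_el_def basis_def o_assoc djs_comp Sym_inv_distrib[of _ k])

lemma absorb_lact:
  assumes "z \<in> basis" "\<eta> \<in> Sym k"
  shows "absorb (lact_el s \<eta> z) = (fst (absorb z), djs k \<eta> id \<circ> snd (absorb z))"
proof -
  let ?h = "snd (snd z)"
  have h: "?h \<in> Sym k" using assms by (simp add: basis_def)
  have "inv (\<eta> \<circ> ?h) \<circ> \<eta> = inv ?h"
    unfolding Sym_inv_distrib[OF assms(2) h] o_assoc[symmetric] Sym_inv_comp(1)[OF assms(2)] by simp
  then have "djs k id (inv (\<eta> \<circ> ?h)) \<circ> djs k \<eta> \<eta> = djs k \<eta> id \<circ> djs k id (inv ?h)"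
    using assms h by (simp add: djs_comp)
  then show ?thesis by (simp add: absorb_def lact_el_def lact_def o_assoc)
qed

definition elem_of :: "(complex \<times> letter \<times> perm) list \<Rightarrow> element" where
  "elem_of zs = foldr (\<lambda>z a. e_mul k ([fst (snd z)], snd (snd z)) a) zs ([], id)"

definition scal :: "(complex \<times> letter \<times> perm) list \<Rightarrow> complex" where
  "scal zs = prod_list (map fst zs)"

lemma elem_of_elements: "set zs \<subseteq> basis \<Longrightarrow> elem_of zs \<in> elements k"
  by (induction zs) (auto simp: elem_of_def basis_elements)

lemma a_prod_el:
  assumes "set zs \<subseteq> basis"
  shows "a_prod A.Alg (map el zs) = f_smult (scal zs) (delta (enc (elem_of zs)))"
  using assms
proof (induction zs)
  case Nil
  show ?case by (simp add: a_prod_def scal_def elem_of_def f_smult_def) (simp add: unit_def)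
next
  case (Cons z zs)
  then show ?case using elem_of_elements[of zs] basis_elements[of z]
    by (simp add: a_prod_def el_def A.mul_smult mul_delta_enc f_smult_smult scal_def elem_of_def mult.commute)
qed

lemma elem_mat_single:
  assumes "z \<in> basis" "i \<in> Jset k N" "j \<in> Jset k N"
  shows "elem_mat k N T ([fst (snd z)], snd (snd z)) i j = letter_mat k T (absorb z) i j"
  using assms by (simp add: elem_mat_def word_mat_single basis_def absorb_def letter_mat_def o_assoc cat_djs)

lemma elem_mat_elem_of:
  assumes "set zs \<subseteq> basis" "i \<in> Jset k N" "j \<in> Jset k N"
  shows "elem_mat k N T (elem_of zs) i j = word_mat k N T (map absorb zs) i j"
  using assms
proof (induction zs arbitrary: i)
  case Nil
  then show ?case by (simp add: elem_of_def elem_mat_u word_mat_Nil eq_commute)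
next
  case (Cons z zs)
  have "elem_mat k N T (elem_of (z # zs)) i j
      = (\<Sum>l\<in>Jset k N. elem_mat k N T ([fst (snd z)], snd (snd z)) i l * elem_mat k N T (elem_of zs) l j)"
    using Cons elem_of_elements[of zs] basis_elements[of z] by (simp add: elem_of_def elem_mat_mul)
  also have "\<dots> = (\<Sum>l\<in>Jset k N. letter_mat k T (absorb z) i l * word_mat k N T (map absorb zs) l j)"
    using Cons by (intro sum.cong) (simp_all add: elem_mat_single)
  finally show ?case by (simp add: word_mat_Cons)
qed

lemma absorb_elements: "set zs \<subseteq> basis \<Longrightarrow> h \<in> Sym k \<Longrightarrow> (map absorb zs, h) \<in> elements k"
  using absorb_Sym by (auto simp: elements_def)

text \<open>The product of the basis elements and the word of absorbed letters are in general
  different elements of the monoid: one collects permutations at the end, the other in the letters.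
  Their matrices agree, hence so do their values under \<open>phi\<close>.\<close>

lemma E_a_prod:
  assumes zs: "set zs \<subseteq> basis" and \<rho>: "\<rho> \<in> Sym k"
  shows "A.E (a_prod A.Alg (map el zs)) \<rho> = scal zs * phi (map absorb zs, inv \<rho>)"
proof -
  note el = elem_of_elements[OF zs]
  have "phi (e_mul k (elem_of zs) ([], inv \<rho>)) = phi (map absorb zs, inv \<rho>)"
  proof (rule phi_cong)
    fix N i \<omega> assume i: "i \<in> Jset k N"
    have eq: "i = l \<circ> inv \<rho> \<longleftrightarrow> l = i \<circ> \<rho>" for l
      using Sym_inv_comp[OF \<rho>] by (metis comp_id o_assoc)
    have "elem_mat k N (M N \<omega>) (e_mul k (elem_of zs) ([], inv \<rho>)) i i
        = (\<Sum>l\<in>Jset k N. elem_mat k N (M N \<omega>) (elem_of zs) i l * (if l = i \<circ> \<rho> then 1 else 0))"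
      using el \<rho> i by (simp only: elem_mat_mul elements_u Sym_inv elem_mat_u eq)
    also have "\<dots> = word_mat k N (M N \<omega>) (map absorb zs) i (i \<circ> \<rho>)"
      using i \<rho> zs by (simp add: sum_Jset_delta(3) elem_mat_elem_of)
    finally show "elem_mat k N (M N \<omega>) (e_mul k (elem_of zs) ([], inv \<rho>)) i i
        = elem_mat k N (M N \<omega>) (map absorb zs, inv \<rho>) i i"
      using \<rho> by (simp add: elem_mat_def)
  qed
  moreover have "A.E (delta (enc (elem_of zs))) \<rho> = phi (e_mul k (elem_of zs) ([], inv \<rho>))"
    using \<rho> el by (simp add: A.E_delta \<phi>_def u_def enc_mul)
  moreover have "A.E (f_smult (scal zs) (delta (enc (elem_of zs)))) = f_smult (scal zs) (A.E (delta (enc (elem_of zs))))"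
    using el by (intro A.E_smult) simp
  ultimately show ?thesis unfolding a_prod_el[OF zs] by (simp only: f_smult_def)
qed

lemma E_a_prod_outside: "\<rho> \<notin> Sym k \<Longrightarrow> A.E x \<rho> = 0"
  by (simp add: A.E_def)

lemma word_partition_absorb:
  assumes "set zs \<subseteq> basis" "\<rho> \<in> Sym k" "partition_on {1..length zs} \<pi>"
  shows "word_partition k (length zs) \<rho> (wperm (map absorb zs)) \<pi>"
  by unfold_locales (use assms k1 wperm_Sym[OF absorb_elements[OF assms(1,2)]] in auto)

subsection \<open>Covariances\<close>

definition cov :: "bool \<Rightarrow> bool \<Rightarrow> complex" where
  "cov b b' = (if b \<noteq> b' then of_real c else if b then cnj c' else c')"

lemma partitions_two: "partition_on {1..2::nat} \<pi> \<Longrightarrow> \<pi> = {{1..2}} \<or> (\<exists>B\<in>\<pi>. card B = 1)"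
proof -
  assume p: "partition_on {1..2::nat} \<pi>"
  obtain B where B: "B \<in> \<pi>" "1 \<in> B" using partition_block_exists[OF p, of 1] by auto
  have "B \<subseteq> {1, 2}" using partition_block_subset[OF p B(1)] by auto
  moreover have "{1..2::nat} = {1, 2}" by auto
  ultimately have "B = {1} \<or> B = {1..2}" using B(2) by (cases "2 \<in> B") auto
  then show ?thesis using B(1) partition_whole_block[OF p] by auto
qed

lemma mu_pair:
  assumes "i \<noteq> j"
  shows "mu (card {l\<in>{i, j}. \<not> Q l}) (card {l\<in>{i, j}. Q l}) = cov (Q i) (Q j)"
proof -
  have "{l\<in>{i, j}. Q l} = (if Q i then {i} else {}) \<union> (if Q j then {j} else {})"
    "{l\<in>{i, j}. \<not> Q l} = (if Q i then {} else {i}) \<union> (if Q j then {} else {j})" by auto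
  then show ?thesis using assms by (auto simp: cov_def mu_def)
qed

lemma pair_term:
  assumes "snd x \<in> Sym (2*k)" "snd y \<in> Sym (2*k)" "\<rho> \<in> Sym k"
  shows "weight [x, y] {{1..2}} * ell k 2 \<rho> (wperm [x, y]) {{1..2}}
    = (if snd x = tau k \<circ> djs k id \<rho> \<circ> snd y then cov (fst x) (fst y) else 0)"
proof -
  have el: "([x, y], inv \<rho>) \<in> elements k" using assms by (simp add: elements_def)
  have part: "partition_on {1..2::nat} {{1..2}}" by (rule partition_on_space) simp
  interpret word_partition k 2 \<rho> "wperm [x, y]" "{{1..2}}"
    by unfold_locales (use k1 assms part wperm_Sym[OF el] in auto)
  have "ell k 2 \<rho> (wperm [x, y]) {{1..2}} = (if snd x = tau k \<circ> djs k id \<rho> \<circ> snd y then 1 else 0)"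
    using ell_eqI[OF pair_partition_limit] by (simp add: wperm_def)
  moreover have "{1..2::nat} = {1, 2}" by auto
  then have "weight [x, y] {{1..2}} = cov (fst x) (fst y)"
    using mu_pair[of 1 2 "wconj [x, y]"] by (simp add: weight_def wconj_def)
  ultimately show ?thesis by simp
qed

lemma phi_pair:
  assumes "snd x \<in> Sym (2*k)" "snd y \<in> Sym (2*k)" "\<rho> \<in> Sym k"
  shows "phi ([x, y], inv \<rho>) = (if snd x = tau k \<circ> djs k id \<rho> \<circ> snd y then cov (fst x) (fst y) else 0)"
proof -
  have el: "([x, y], inv \<rho>) \<in> elements k" using assms by (simp add: elements_def)
  have zero: "weight [x, y] \<pi> * ell k 2 \<rho> (wperm [x, y]) \<pi> = 0" if p: "partition_on {1..2} \<pi>" "\<pi> \<noteq> {{1..2}}" for \<pi>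
  proof -
    obtain B where "B \<in> \<pi>" "card B = 1" using partitions_two[OF p(1)] p(2) by blast
    then have "weight [x, y] \<pi> = 0"
      using finite_elements[OF _ p(1)] by (intro weight_zero[of \<pi> B]) (auto intro: card_ge_0_finite)
    then show ?thesis by simp
  qed
  have part: "partition_on {1..2::nat} {{1..2}}" by (rule partition_on_space) simp
  have "phi ([x, y], inv \<rho>) = (\<Sum>\<pi>\<in>{\<pi>. partition_on {1..2} \<pi>}. weight [x, y] \<pi> * ell k 2 \<rho> (wperm [x, y]) \<pi>)"
    using phi_eq[OF el] assms(3) by (simp add: numeral_2_eq_2)
  also have "\<dots> = (\<Sum>\<pi>\<in>{{{1..2}}}. weight [x, y] \<pi> * ell k 2 \<rho> (wperm [x, y]) \<pi>)"
    by (rule sum.mono_neutral_right) (use zero part in \<open>simp_all add: finitely_many_partition_on del: One_nat_def\<close>)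
  finally show ?thesis using pair_term[OF assms] by simp
qed

end

text \<open>The permutations read off a contracted list agree with \<open>contract_perm\<close> only
  at the positions of the word, which are the only ones a path count sees.\<close>

lemma fnorm_cong:
  assumes "word_partition k n \<rho> g \<pi>" "word_partition k n \<rho> h \<pi>" "\<And>l. l \<in> {1..n} \<Longrightarrow> g l = h l"
  shows "word_partition.fnorm k n \<rho> g \<pi> = word_partition.fnorm k n \<rho> h \<pi>"
proof -
  interpret A: word_partition k n \<rho> g \<pi> by (rule assms(1))
  interpret B: word_partition k n \<rho> h \<pi> by (rule assms(2))
  have "edge k g f l = edge k h f l" if "B \<in> \<pi>" "l \<in> B" for B l f
    using assms(3)[of l] A.blocks[OF that(1)] that(2) by (auto simp: edge_def)
  then have "(\<forall>B\<in>\<pi>. \<forall>l\<in>B. \<forall>l'\<in>B. edge k g f l = edge k g f l')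
      \<longleftrightarrow> (\<forall>B\<in>\<pi>. \<forall>l\<in>B. \<forall>l'\<in>B. edge k h f l = edge k h f l')" for f
    by (intro ball_cong refl) simp
  then have "fpaths k N n \<rho> g \<pi> = fpaths k N n \<rho> h \<pi>" for N
    by (simp add: fpaths_def)
  then show ?thesis by (simp add: fun_eq_iff A.fnorm_def B.fnorm_def)
qed

lemma lim_eventually_eq:
  fixes f g :: "nat \<Rightarrow> complex"
  assumes "\<And>N. 1 \<le> N \<Longrightarrow> f N = g N"
  shows "lim f = lim g"
proof -
  have "eventually (\<lambda>N. f N = g N) sequentially" using assms by (rule eventually_sequentiallyI)
  then have "(f \<longlonglongrightarrow> L) = (g \<longlonglongrightarrow> L)" for L by (rule tendsto_cong)
  then show ?thesis by (simp add: lim_def)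
qed

context random_tensor
begin

text \<open>As a function of \<open>\<rho>\<close> the covariance is supported on the solutions of
  one compatibility equation, and there is at most one. For this reason inner values of the nested
  maps on basis elements are multiples of a single permutation.\<close>

lemma E_pair:
  assumes z: "z \<in> basis" "z' \<in> basis"
  shows "A.E (A.f_mul (el z) (el z')) = (\<lambda>\<rho>. if \<rho> \<in> Sym k \<and> snd (absorb z) = tau k \<circ> djs k id \<rho> \<circ> snd (absorb z')
     then fst z * fst z' * cov (fst (absorb z)) (fst (absorb z')) else 0)"
proof
  fix \<rho>
  have V: "el z \<in> A.FS" "el z' \<in> A.FS" using el_V z by auto
  have eq: "A.f_mul (el z) (el z') = a_prod A.Alg (map el [z, z'])"
    using V by (simp add: a_prod_def)
  show "A.E (A.f_mul (el z) (el z')) \<rho> = (if \<rho> \<in> Sym k \<and> snd (absorb z) = tau k \<circ> djs k id \<rho> \<circ> snd (absorb z')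
     then fst z * fst z' * cov (fst (absorb z)) (fst (absorb z')) else 0)"
  proof (cases "\<rho> \<in> Sym k")
    case True
    have "A.E (A.f_mul (el z) (el z')) \<rho> = scal [z, z'] * phi (map absorb [z, z'], inv \<rho>)"
      unfolding eq by (rule E_a_prod) (use z True in auto)
    then show ?thesis using phi_pair[OF absorb_Sym[OF z(1)] absorb_Sym[OF z(2)] True] True
      by (simp add: scal_def)
  next
    case False
    then show ?thesis using E_a_prod_outside[OF False, of "A.f_mul (el z) (el z')"] by simp
  qed
qed

lemma compatible_unique:
  assumes "\<eta> \<in> Sym k" "\<rho> \<in> Sym k" "\<gamma> \<in> Sym (2*k)" "tau k \<circ> djs k id \<eta> \<circ> \<gamma> = tau k \<circ> djs k id \<rho> \<circ> \<gamma>"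
  shows "\<eta> = \<rho>"
proof -
  have "tau k \<circ> djs k id \<eta> = tau k \<circ> djs k id \<rho>"
    using comp_Sym_cancel[OF assms(3)] assms(4) by blast
  then have "tau k \<circ> (tau k \<circ> djs k id \<eta>) = tau k \<circ> (tau k \<circ> djs k id \<rho>)" by simp
  then have "djs k id \<eta> = djs k id \<rho>" by (simp add: o_assoc tau_comp_tau)
  then show ?thesis using assms by (simp add: djs_inject)
qed

section \<open>Contraction of lists of basis elements\<close>

definition contract_list :: "nat \<Rightarrow> complex \<Rightarrow> perm \<Rightarrow> (complex \<times> letter \<times> perm) list \<Rightarrow> (complex \<times> letter \<times> perm) list" where
  "contract_list i s \<eta> zs = (if i = 1 then lact_el s \<eta> (zs ! 2) # drop 3 zs
     else take (i - 2) zs @ [ract_el s \<eta> (zs ! (i - 2))] @ drop (i + 1) zs)"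

lemma contract_list_basis:
  assumes "set zs \<subseteq> basis" "1 \<le> i" "i + 1 \<le> length zs" "3 \<le> length zs" "\<eta> \<in> Sym k"
  shows "set (contract_list i s \<eta> zs) \<subseteq> basis" "length (contract_list i s \<eta> zs) = length zs - 2"
proof -
  have nth: "zs ! j \<in> basis" if "j < length zs" for j using assms(1) that by auto
  have "set (take m zs) \<subseteq> basis" "set (drop m zs) \<subseteq> basis" for m
    using assms(1) set_take_subset[of m zs] set_drop_subset[of m zs] by auto
  then show "set (contract_list i s \<eta> zs) \<subseteq> basis"
    using nth[of 2] nth[of "i - 2"] assms by (auto simp: contract_list_def)
  show "length (contract_list i s \<eta> zs) = length zs - 2"
    using assms by (auto simp: contract_list_def)
qed

text \<open>Since the inner covariance is a multiple of one permutation, multiplying the neighbour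
  by it yields a basis element again. Algebraic contraction thus becomes an operation on lists of
  labels.\<close>

lemma contract_el:
  assumes zs: "set zs \<subseteq> basis" and i: "1 \<le> i" "i + 1 \<le> length zs" "3 \<le> length zs" and \<eta>: "\<eta> \<in> Sym k"
    and inner: "A.E (A.f_mul (el (zs ! (i - 1))) (el (zs ! i))) = f_smult s (cs_u \<eta>)"
  shows "contract A.Alg W.pair_cumulant i 2 (map el zs) = map el (contract_list i s \<eta> zs)"
proof -
  have nth: "zs ! j \<in> basis" if "j < length zs" for j using zs that by auto
  have "take 2 (drop (i - 1) (map el zs)) ! 0 = el (zs ! (i - 1))" "take 2 (drop (i - 1) (map el zs)) ! 1 = el (zs ! i)"
    using i by auto
  then have K: "W.pair_cumulant 2 (take 2 (drop (i - 1) (map el zs))) = f_smult s (cs_u \<eta>)"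
    using inner by (simp only: W.pair_cumulant_def simp_thms if_True)
  show ?thesis
  proof (cases "i = 1")
    case True
    have "A.f_mul (A.emb (f_smult s (cs_u \<eta>))) (el (zs ! 2)) = el (lact_el s \<eta> (zs ! 2))"
      by (rule el_lact[OF nth \<eta>]) (use i in simp)
    then show ?thesis using True K i by (simp add: contract_def contract_list_def Let_def drop_map)
  next
    case False
    have "A.f_mul (el (zs ! (i - 2))) (A.emb (f_smult s (cs_u \<eta>))) = el (ract_el s \<eta> (zs ! (i - 2)))"
      by (rule el_ract[OF nth \<eta>]) (use i in simp)
    then show ?thesis using False K i by (simp add: contract_def contract_list_def Let_def drop_map take_map)
  qed
qed

text \<open>The scalars of the removed pair survive in \<open>s\<close>; only the factor
  \<open>d\<close> is new.\<close>

lemma scal_contract_list: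
  assumes i: "1 \<le> i" "i + 1 \<le> length zs" "3 \<le> length zs"
    and s: "s = fst (zs ! (i - 1)) * fst (zs ! i) * d"
  shows "scal (contract_list i s \<eta> zs) = scal zs * d"
proof (cases "i = 1")
  case True
  have "zs = zs ! 0 # zs ! 1 # zs ! 2 # drop 3 zs"
    using i by (intro nth_equalityI) (auto simp: nth_Cons numeral_eq_Suc split: nat.split)
  then have "scal zs = fst (zs ! 0) * (fst (zs ! 1) * (fst (zs ! 2) * scal (drop 3 zs)))"
    by (metis (no_types, lifting) list.simps(9) prod_list.Cons scal_def)
  then show ?thesis using True s by (simp add: contract_list_def scal_def lact_el_def)
next
  case False
  define m where "m = i - 2"
  have m: "i = m + 2" "m + 2 < length zs" using False i by (auto simp: m_def)
  have "drop m zs = zs ! m # zs ! (m + 1) # zs ! (m + 2) # drop (m + 3) zs"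
    using m by (simp add: Cons_nth_drop_Suc numeral_eq_Suc)
  then have "zs = take m zs @ (zs ! m # zs ! (m + 1) # zs ! (m + 2) # drop (m + 3) zs)"
    by (metis append_take_drop_id)
  then have "scal zs = scal (take m zs) * (fst (zs ! m) * (fst (zs ! (m + 1)) * (fst (zs ! (m + 2)) * scal (drop (m + 3) zs))))"
    by (metis (no_types, lifting) list.simps(9) map_append prod_list.Cons prod_list.append scal_def)
  moreover have "scal (contract_list i s \<eta> zs) = scal (take m zs) * (fst (zs ! m) * s * scal (drop (m + 3) zs))"
    using m by (simp add: contract_list_def scal_def ract_el_def numeral_3_eq_3)
  ultimately show ?thesis using s m by (simp add: mult_ac)
qed

text \<open>The link between the two contractions: multiplying a neighbouring letter by
  \<open>u_\<eta>\<close> in the algebra has the same effect on its permutation as deleting the pair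
  from the paths. Conjugation flags are unaffected apart from the shift by two.\<close>

lemma absorb_contract_list:
  assumes zs: "set zs \<subseteq> basis" and i: "1 \<le> i" "i + 1 \<le> length zs" "3 \<le> length zs" and \<eta>: "\<eta> \<in> Sym k"
    and l: "l \<in> {1..length zs - 2}"
  shows "wperm (map absorb (contract_list i s \<eta> zs)) l = contract_perm k i \<eta> (wperm (map absorb zs)) l"
    and "wconj (map absorb (contract_list i s \<eta> zs)) l = wconj (map absorb zs) (if l < (if i = 1 then 1 else i) then l else l + 2)"
proof -
  have nth: "zs ! j \<in> basis" if "j < length zs" for j using zs that by auto
  have len: "length (contract_list i s \<eta> zs) = length zs - 2" using contract_list_basis(2)[OF zs i \<eta>] .
  have at: "map absorb (contract_list i s \<eta> zs) ! (l - 1) = absorb (contract_list i s \<eta> zs ! (l - 1))"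
    using l len by (intro nth_map) auto
  have at': "map absorb zs ! j = absorb (zs ! j)" if "j < length zs" for j using that by simp
  have goal: "wperm (map absorb (contract_list i s \<eta> zs)) l = contract_perm k i \<eta> (wperm (map absorb zs)) l \<and>
    wconj (map absorb (contract_list i s \<eta> zs)) l = wconj (map absorb zs) (if l < (if i = 1 then 1 else i) then l else l + 2)"
  proof (cases "i = 1")
    case True
    show ?thesis
    proof (cases "l = 1")
      case l1: True
      have "contract_list i s \<eta> zs ! (l - 1) = lact_el s \<eta> (zs ! 2)" using True l1 by (simp add: contract_list_def)
      then show ?thesis using absorb_lact[OF nth[of 2] \<eta>, of s] at at'[of 2] i True l1
        by (simp add: wperm_def wconj_def contract_perm_def numeral_2_eq_2)
    next
      case False
      then obtain m where m: "l = m + 2" using l by (metis One_nat_def Suc_leI add_2_eq_Suc' atLeastAtMost_iff le_neq_implies_less less_imp_Suc_add plus_1_eq_Suc add.commute)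
      have "contract_list i s \<eta> zs ! (l - 1) = zs ! (l + 1)"
        using True m l i(3) by (simp add: contract_list_def numeral_3_eq_3)
      moreover have "l + 1 < length zs" using l i by auto
      ultimately show ?thesis using at at'[of "l + 1"] l False True
        by (simp add: wperm_def wconj_def contract_perm_def)
    qed
  next
    case False
    have i2: "2 \<le> i" using False i by simp
    consider "l < i - 1" | "l = i - 1" | "i \<le> l" by linarith
    then show ?thesis
    proof cases
      case 1
      have l1: "l - 1 < i - 2" "l < i" using 1 l by auto
      then have "contract_list i s \<eta> zs ! (l - 1) = zs ! (l - 1)"
        using False i l by (simp add: contract_list_def nth_append)
      then show ?thesis using at at'[of "l - 1"] l i 1 l1 False
        by (simp add: wperm_def wconj_def contract_perm_def)
    next
      case 2
      have "contract_list i s \<eta> zs ! (l - 1) = ract_el s \<eta> (zs ! (l - 1))"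
        using False 2 i l i2 by (simp add: contract_list_def nth_append numeral_2_eq_2)
      then show ?thesis using absorb_ract[OF nth[of "l - 1"] \<eta>, of s] at at'[of "l - 1"] l i 2 False i2
        by (auto simp: wperm_def wconj_def contract_perm_def)
    next
      case 3
      obtain m where m: "l = i + m" using 3 le_Suc_ex by blast
      have "contract_list i s \<eta> zs ! (l - 1) = drop (i + 1) zs ! m"
      proof -
        have "l - 1 = length (take (i - 2) zs @ [ract_el s \<eta> (zs ! (i - 2))]) + m" using m i i2 by simp
        moreover have "contract_list i s \<eta> zs = (take (i - 2) zs @ [ract_el s \<eta> (zs ! (i - 2))]) @ drop (i + 1) zs"
          using False by (simp add: contract_list_def)
        ultimately show ?thesis by (metis nth_append_length_plus)
      qed
      also have "\<dots> = zs ! (l + 1)" using m i by (simp add: add_ac)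
      finally show ?thesis using at at'[of "l + 1"] l i i2 3 False
        by (auto simp: wperm_def wconj_def contract_perm_def)
    qed
  qed
  then show "wperm (map absorb (contract_list i s \<eta> zs)) l = contract_perm k i \<eta> (wperm (map absorb zs)) l"
    and "wconj (map absorb (contract_list i s \<eta> zs)) l = wconj (map absorb zs) (if l < (if i = 1 then 1 else i) then l else l + 2)"
    by auto
qed

text \<open>Relabelling carries the conjugation flags along, so every remaining block keeps its
  factor, and the removed pair contributes its covariance.\<close>

lemma weight_contract_list:
  assumes zs: "set zs \<subseteq> basis" and i: "1 \<le> i" "i + 1 \<le> length zs" "3 \<le> length zs" and \<eta>: "\<eta> \<in> Sym k"
    and part: "partition_on {1..length zs} \<pi>" and blk: "{i..<i+2} \<in> \<pi>"
  shows "weight (map absorb zs) \<pi> = cov (fst (absorb (zs ! (i - 1)))) (fst (absorb (zs ! i))) *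
     weight (map absorb (contract_list i s \<eta> zs)) (del_block i 2 \<pi>)"
proof -
  let ?Q = "wconj (map absorb zs)" and ?Q' = "wconj (map absorb (contract_list i s \<eta> zs))"
  have fin: "finite \<pi>" using finite_elements[OF _ part] by simp
  have Q: "?Q' (relab i 2 l) = ?Q l" if l: "l \<in> {1..length zs} - {i..<i+2}" for l
  proof -
    have r: "relab i 2 l \<in> {1..length zs - 2}" using relab_image[OF part blk] l by auto
    show ?thesis
    proof (cases "l < i")
      case True
      then show ?thesis using absorb_contract_list(2)[OF zs i \<eta> r] l by (auto simp: relab_def)
    next
      case False
      then obtain m where m: "l = m + 2" "i \<le> m" using l by (intro that[of "l - 2"]) auto
      then show ?thesis using absorb_contract_list(2)[OF zs i \<eta> r] by (auto simp: relab_def)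
    qed
  qed
  have blockterm: "mu (card {l\<in>relab i 2 ` B. \<not> ?Q' l}) (card {l\<in>relab i 2 ` B. ?Q' l})
      = mu (card {l\<in>B. \<not> ?Q l}) (card {l\<in>B. ?Q l})" if B: "B \<in> \<pi> - {{i..<i+2}}" for B
  proof -
    have sub: "B \<subseteq> {1..length zs} - {i..<i+2}" by (rule other_blocks[OF part blk _ B]) simp
    have inj: "inj_on (relab i 2) B" by (rule inj_on_subset[OF relab_inj[OF part blk] sub]) simp
    have "{l\<in>relab i 2 ` B. \<not> ?Q' l} = relab i 2 ` {l\<in>B. \<not> ?Q l}" "{l\<in>relab i 2 ` B. ?Q' l} = relab i 2 ` {l\<in>B. ?Q l}"
      using Q sub by blast+
    moreover have "inj_on (relab i 2) {l\<in>B. \<not> ?Q l}" "inj_on (relab i 2) {l\<in>B. ?Q l}"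
      by (rule inj_on_subset[OF inj], blast)+
    ultimately show ?thesis by (simp add: card_image)
  qed
  have "weight (map absorb zs) \<pi> = mu (card {l\<in>{i..<i+2}. \<not> ?Q l}) (card {l\<in>{i..<i+2}. ?Q l}) *
      (\<Prod>B\<in>\<pi> - {{i..<i+2}}. mu (card {l\<in>B. \<not> ?Q l}) (card {l\<in>B. ?Q l}))"
    unfolding weight_def by (rule prod.remove[OF fin blk])
  also have "{i..<i+2} = {i, i+1}" by auto
  also have "mu (card {l\<in>{i, i+1}. \<not> ?Q l}) (card {l\<in>{i, i+1}. ?Q l}) = cov (?Q i) (?Q (i+1))"
    by (rule mu_pair) simp
  also have "(\<Prod>B\<in>\<pi> - {{i, i+1}}. mu (card {l\<in>B. \<not> ?Q l}) (card {l\<in>B. ?Q l}))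
      = weight (map absorb (contract_list i s \<eta> zs)) (del_block i 2 \<pi>)"
  proof -
    have e: "{i, i+1} = {i..<i+2}" by auto
    have inj: "inj_on ((`) (relab i 2)) (\<pi> - {{i..<i+2}})" by (rule relab_image_inj[OF part blk]) simp
    show ?thesis unfolding weight_def del_block_def e prod.reindex[OF inj]
      by (rule prod.cong[OF refl]) (simp only: comp_apply blockterm)
  qed
  finally show ?thesis using i by (simp add: wconj_def)
qed

text \<open>Both sides obey the same recursion on the first interval block. If its size is not two,
  or its two permutations are incompatible, both vanish. Otherwise the inner value is
  \<open>s u_\<eta>\<close>, contraction of the list matches contraction of the paths, and the
  covariance moves from the weight into the scalar.\<close>

lemma nc_ext_el:
  assumes "\<xi> \<in> NC (length zs)" "1 \<le> length zs" "set zs \<subseteq> basis" and \<rho>: "\<rho> \<in> Sym k"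
  shows "nc_ext A.Alg W.pair_cumulant \<xi> (map el zs) \<rho>
    = scal zs * (weight (map absorb zs) \<xi> * ell k (length zs) \<rho> (wperm (map absorb zs)) \<xi>)"
  using assms(1-3)
proof (induction "length zs" arbitrary: zs \<xi> rule: less_induct)
  case less
  let ?n = "length zs" and ?as = "map el zs" and ?w = "map absorb zs"
  have part: "partition_on {1..?n} \<xi>" using less.prems(1) by (simp add: NC_iff)
  have fin: "finite \<xi>" using finite_elements[OF _ part] by simp
  have V: "set ?as \<subseteq> V" using less.prems(3) el_V by auto
  have nth: "zs ! j \<in> basis" if "j < ?n" for j using less.prems(3) that by auto
  show ?case
  proof (cases "\<xi> = {{1..?n}}")
    case True
    have top: "nc_ext A.Alg W.pair_cumulant \<xi> ?as = W.pair_cumulant ?n ?as"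
      unfolding True using nc_ext_top[of ?as A.Alg W.pair_cumulant] less.prems(2) by simp
    show ?thesis
    proof (cases "?n = 2")
      case n2: True
      then obtain z z' where zz: "zs = [z, z']" by (auto simp: numeral_2_eq_2 length_Suc_conv)
      then have b: "z \<in> basis" "z' \<in> basis" using less.prems(3) by auto
      have "nc_ext A.Alg W.pair_cumulant \<xi> ?as \<rho> = A.E (A.f_mul (el z) (el z')) \<rho>"
        unfolding top by (simp add: W.pair_cumulant_def zz)
      moreover have "\<xi> = {{1..2}}" using True n2 by simp
      ultimately show ?thesis
        using pair_term[OF absorb_Sym[OF b(1)] absorb_Sym[OF b(2)] \<rho>] \<rho>
        unfolding n2 by (simp add: E_pair[OF b] zz scal_def)
    next
      case False
      have "weight ?w \<xi> = 0" unfolding True by (rule weight_zero[of _ "{1..?n}"]) (use False in auto)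
      then show ?thesis unfolding top using False by (simp add: W.pair_cumulant_def)
    qed
  next
    case False
    obtain i n' where i: "1 \<le> n'" "{i..<i+n'} \<in> \<xi>" "first_interval_block \<xi> = {i..<i+n'}"
      "\<And>i' n''. 1 \<le> n'' \<Longrightarrow> {i'..<i'+n''} \<in> \<xi> \<Longrightarrow> i \<le> i'"
      "1 \<le> i" "i + n' \<le> ?n + 1" "n' < ?n" "del_block i n' \<xi> \<in> NC (?n - n')"
      "card \<xi> = Suc (card (del_block i n' \<xi>))"
      using NC_step[OF less.prems(1,2) False] by metis
    have step: "nc_ext A.Alg W.pair_cumulant \<xi> ?as
        = nc_ext A.Alg W.pair_cumulant (del_block i n' \<xi>) (contract A.Alg W.pair_cumulant i n' ?as)"
      by (rule nc_ext_step[OF i(3,1) _ i(9)]) (use False in simp)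
    have len: "length (contract A.Alg W.pair_cumulant i n' ?as) = ?n - n'"
      using length_contract[of i n' ?as] i by simp
    have cV: "set (contract A.Alg W.pair_cumulant i n' ?as) \<subseteq> V"
      by (rule W.contract_V[OF V W.Kvalid_pair_cumulant[of n']]) (use i in auto)
    \<comment> \<open>A vanishing inner value puts a zero entry into the contracted list, and
      multilinearity annihilates the whole expression.\<close>
    have zero: "nc_ext A.Alg W.pair_cumulant \<xi> ?as = (\<lambda>_. 0)"
      if z: "W.pair_cumulant n' (take n' (drop (i - 1) ?as)) = (\<lambda>_. 0)"
    proof -
      have "(\<lambda>_. 0) \<in> set (contract A.Alg W.pair_cumulant i n' ?as)"
        unfolding contract_def Let_def z by simp
      then show ?thesis unfolding step
        by (intro W.pair_cumulant_zero[OF cV]) (use i len in auto)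
    qed
    show ?thesis
    proof (cases "n' = 2")
      case n': False
      have "weight ?w \<xi> = 0" by (rule weight_zero[OF fin i(2)]) (use n' in auto)
      then show ?thesis using zero n' by (simp add: W.pair_cumulant_def)
    next
      case n': True
      have n3: "3 \<le> ?n" "i + 1 \<le> ?n" using i(6,7) n' by auto
      have blk: "{i..<i+2} \<in> \<xi>" using i(2) n' by simp
      let ?z = "zs ! (i - 1)" and ?z' = "zs ! i"
      have b: "?z \<in> basis" "?z' \<in> basis" using nth n3 i(5) by auto
      have K: "W.pair_cumulant n' (take n' (drop (i - 1) ?as)) = A.E (A.f_mul (el ?z) (el ?z'))"
        using n' n3 i(5) by (simp add: W.pair_cumulant_def)
      have gw: "wperm ?w i = snd (absorb ?z)" "wperm ?w (i + 1) = snd (absorb ?z')"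
        using n3 i(5) by (simp_all add: wperm_def)
      interpret word_partition k ?n \<rho> "wperm ?w" \<xi>
        by (rule word_partition_absorb[OF less.prems(3) \<rho> part])
      show ?thesis
      proof (cases "\<exists>\<eta>\<in>Sym k. wperm ?w i = tau k \<circ> djs k id \<eta> \<circ> wperm ?w (i + 1)")
        case compat: False
        then have "\<not> (\<rho>' \<in> Sym k \<and> snd (absorb ?z) = tau k \<circ> djs k id \<rho>' \<circ> snd (absorb ?z'))" for \<rho>'
          unfolding gw by blast
        then have "A.E (A.f_mul (el ?z) (el ?z')) = (\<lambda>_. 0)"
          unfolding E_pair[OF b] by (simp only: if_False)
        then have L: "nc_ext A.Alg W.pair_cumulant \<xi> ?as \<rho> = 0" using zero K by simp
        have "weight ?w \<xi> * ell k ?n \<rho> (wperm ?w) \<xi> = 0"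
        proof (cases "\<forall>B\<in>\<xi>. card B = 2")
          case True
          have "noncrossing \<xi>" using less.prems(1) by (simp add: NC_iff)
          then obtain i2 where i2: "{i2..<i2+2} \<in> \<xi>" "{0..i2} \<subseteq> free"
            "\<And>i' n'. 1 \<le> n' \<Longrightarrow> {i'..<i'+n'} \<in> \<xi> \<Longrightarrow> i2 \<le> i'"
            using pairing_alternative[OF _ less.prems(2)] True by blast
          \<comment> \<open>The recursion takes the leftmost interval block, and the interval pair
            supplied by the path argument is leftmost as well. They coincide, so all vertices up to
            \<open>i\<close> are free and incompatibility costs a factor \<open>N\<close>.\<close>
          have "i2 = i" using i2(3)[OF _ blk] i(4)[OF _ i2(1)] by simp
          then have "fnorm \<longlonglongrightarrow> 0" using incompatible_pair[OF blk] i2(2) compat by blast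
          then show ?thesis using ell_eqI by simp
        next
          case False
          then obtain B where B: "B \<in> \<xi>" "card B \<noteq> 2" by blast
          then have "weight ?w \<xi> = 0" using blocks[OF B(1)] by (intro weight_zero[OF fin]) auto
          then show ?thesis by simp
        qed
        then show ?thesis using L by simp
      next
        case True
        then obtain \<eta> where \<eta>: "\<eta> \<in> Sym k" "wperm ?w i = tau k \<circ> djs k id \<eta> \<circ> wperm ?w (i + 1)" by blast
        define d where "d = cov (fst (absorb ?z)) (fst (absorb ?z'))"
        define s where "s = fst ?z * fst ?z' * d"
        have "(\<rho>' \<in> Sym k \<and> snd (absorb ?z) = tau k \<circ> djs k id \<rho>' \<circ> snd (absorb ?z')) \<longleftrightarrow> \<rho>' = \<eta>" for \<rho>'
          using \<eta> compatible_unique[OF \<eta>(1) _ absorb_Sym[OF b(2)], of \<rho>'] unfolding gw by auto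
        then have inner: "A.E (A.f_mul (el ?z) (el ?z')) = f_smult s (cs_u \<eta>)"
          unfolding E_pair[OF b] by (auto simp: f_smult_def cs_u_def s_def d_def)
        let ?zs = "contract_list i s \<eta> zs"
        note cb = contract_list_basis[OF less.prems(3) i(5) n3(2,1) \<eta>(1), of s]
        interpret C: compatible_pair k ?n \<rho> "wperm ?w" \<xi> i \<eta>
          by unfold_locales (use n3 blk \<eta> in auto)
        have part': "partition_on {1..length ?zs} (del_block i 2 \<xi>)"
          using C.D.part cb(2) by simp
        have IH: "nc_ext A.Alg W.pair_cumulant (del_block i 2 \<xi>) (map el ?zs) \<rho>
          = scal ?zs * (weight (map absorb ?zs) (del_block i 2 \<xi>) * ell k (length ?zs) \<rho> (wperm (map absorb ?zs)) (del_block i 2 \<xi>))"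
          by (rule less.hyps) (use cb n3 i(8) n' in auto)
        have "word_partition.fnorm k (?n - 2) \<rho> (wperm (map absorb ?zs)) (del_block i 2 \<xi>) = C.D.fnorm"
          by (rule fnorm_cong)
            (use word_partition_absorb[OF cb(1) \<rho> part'] cb(2) C.D.word_partition_axioms
              absorb_contract_list(1)[OF less.prems(3) i(5) n3(2,1) \<eta>(1)] in auto)
        then have "ell k (length ?zs) \<rho> (wperm (map absorb ?zs)) (del_block i 2 \<xi>) = lim C.D.fnorm"
          by (simp add: ell_def cb(2))
        also have "\<dots> = ell k ?n \<rho> (wperm ?w) \<xi>"
          unfolding ell_def by (rule lim_eventually_eq[symmetric]) (rule C.fnorm_contract)
        finally have e: "ell k (length ?zs) \<rho> (wperm (map absorb ?zs)) (del_block i 2 \<xi>) = ell k ?n \<rho> (wperm ?w) \<xi>" .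
        have "nc_ext A.Alg W.pair_cumulant \<xi> ?as = nc_ext A.Alg W.pair_cumulant (del_block i 2 \<xi>) (map el ?zs)"
          using step contract_el[OF less.prems(3) i(5) n3(2,1) \<eta>(1) inner] n' by simp
        then show ?thesis
          using IH e scal_contract_list[OF i(5) n3(2,1) s_def, of \<eta>]
            weight_contract_list[OF less.prems(3) i(5) n3(2,1) \<eta>(1) part blk, of s]
          by (simp add: d_def mult_ac)
      qed
    qed
  qed
qed

text \<open>In the expansion of the limiting trace over all partitions, those with a block not of
  size two have weight zero and crossing pairings have limit zero. The surviving terms are those of
  the nested maps.\<close>

lemma moments_el:
  assumes zs: "set zs \<subseteq> basis" "1 \<le> length zs"
  shows "A.E (a_prod A.Alg (map el zs)) = cs_sum (\<lambda>\<xi>. nc_ext A.Alg W.pair_cumulant \<xi> (map el zs)) (NC (length zs))"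
proof
  fix \<rho>
  let ?n = "length zs" and ?w = "map absorb zs"
  have V: "set (map el zs) \<subseteq> V" using zs el_V by auto
  show "A.E (a_prod A.Alg (map el zs)) \<rho> = cs_sum (\<lambda>\<xi>. nc_ext A.Alg W.pair_cumulant \<xi> (map el zs)) (NC ?n) \<rho>"
  proof (cases "\<rho> \<in> Sym k")
    case False
    have "nc_ext A.Alg W.pair_cumulant \<xi> (map el zs) \<rho> = 0" if "\<xi> \<in> NC ?n" for \<xi>
      using W.nc_ext_closed[OF that zs(2) W.Kvalid_pair_cumulant _ V] False by (simp add: El.S.FS_iff)
    then show ?thesis using False by (simp add: cs_sum_def E_a_prod_outside)
  next
    case True
    have zero: "weight ?w \<pi> * ell k ?n \<rho> (wperm ?w) \<pi> = 0" if p: "partition_on {1..?n} \<pi>" "\<pi> \<notin> NC ?n" for \<pi>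
    proof (cases "\<forall>B\<in>\<pi>. card B = 2")
      case all2: True
      have "word_partition.fnorm k ?n \<rho> (wperm ?w) \<pi> \<longlonglongrightarrow> 0"
        by (rule crossing_pairing_limit[OF word_partition_absorb[OF zs(1) True p(1)]])
          (use all2 p in \<open>auto simp: NC_iff\<close>)
      then show ?thesis using ell_eqI by simp
    next
      case False
      then obtain B where B: "B \<in> \<pi>" "card B \<noteq> 2" by blast
      have "finite B" using partition_block_subset[OF p(1) B(1)] finite_subset by blast
      then have "weight ?w \<pi> = 0" using B finite_elements[OF _ p(1)] by (intro weight_zero[of \<pi> B]) auto
      then show ?thesis by simp
    qed
    have "A.E (a_prod A.Alg (map el zs)) \<rho> = scal zs * phi (?w, inv \<rho>)" by (rule E_a_prod[OF zs(1) True])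
    also have "phi (?w, inv \<rho>) = (\<Sum>\<pi>\<in>{\<pi>. partition_on {1..?n} \<pi>}. weight ?w \<pi> * ell k ?n \<rho> (wperm ?w) \<pi>)"
      using phi_eq[OF absorb_elements[OF zs(1) Sym_inv[OF True]]] True by simp
    also have "\<dots> = (\<Sum>\<pi>\<in>NC ?n. weight ?w \<pi> * ell k ?n \<rho> (wperm ?w) \<pi>)"
      by (rule sum.mono_neutral_right) (use zero in \<open>auto simp: finitely_many_partition_on NC_iff\<close>)
    finally show ?thesis
      using nc_ext_el[OF _ zs(2,1) True] by (simp add: cs_sum_def sum_distrib_left)
  qed
qed

end

section \<open>Extension from basis elements to the bimodule\<close>

context random_tensor
begin

lemma a_prod_Cons: "a_prod A.Alg (x # xs) = A.f_mul x (a_prod A.Alg xs)"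
  by (simp add: a_prod_def)

lemma a_prod_closed: "set xs \<subseteq> A.FS \<Longrightarrow> a_prod A.Alg xs \<in> A.FS"
  by (induction xs) (auto simp: a_prod_Cons, simp add: a_prod_def)

lemma a_prod_append:
  assumes "set xs \<subseteq> A.FS" "set ys \<subseteq> A.FS"
  shows "a_prod A.Alg (xs @ ys) = A.f_mul (a_prod A.Alg xs) (a_prod A.Alg ys)"
  using assms
proof (induction xs)
  case Nil
  have "a_prod A.Alg [] = delta unit" by (simp add: a_prod_def)
  then show ?case using a_prod_closed[OF Nil(2)] by simp
next
  case (Cons x xs)
  then show ?case using a_prod_closed[of xs] a_prod_closed[of ys] by (simp add: a_prod_Cons A.mul_assoc)
qed

lemma slot_linear_moments: "W.slot_linear n (\<lambda>as. A.E (a_prod A.Alg as))"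
  unfolding W.slot_linear_def
proof (intro allI impI)
  fix as p x y assume "length as = n \<and> set as \<subseteq> V \<and> p < n \<and> x \<in> V \<and> y \<in> V"
  then have as: "p < length as" "set as \<subseteq> A.FS" "x \<in> A.FS" "y \<in> A.FS" using W.V_sub by auto
  let ?l = "a_prod A.Alg (take p as)" and ?r = "a_prod A.Alg (drop (Suc p) as)"
  have td: "set (take p as) \<subseteq> A.FS" "set (drop (Suc p) as) \<subseteq> A.FS"
    using as(2) set_take_subset[of p as] set_drop_subset[of "Suc p" as] by auto
  note c = a_prod_closed[OF td(1)] a_prod_closed[OF td(2)]
  have form: "a_prod A.Alg (as[p := v]) = A.f_mul ?l (A.f_mul v ?r)" if "v \<in> A.FS" for v
    unfolding upd_conv_take_nth_drop[OF as(1)]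
    by (subst a_prod_append) (use td that in \<open>auto simp: a_prod_Cons\<close>)
  show "A.E (a_prod A.Alg (as[p := f_add x y])) = f_add (A.E (a_prod A.Alg (as[p := x]))) (A.E (a_prod A.Alg (as[p := y]))) \<and>
    (\<forall>a. A.E (a_prod A.Alg (as[p := f_smult a x])) = f_smult a (A.E (a_prod A.Alg (as[p := x]))))"
    using as c by (simp add: form A.mul_add A.mul_smult A.E_add A.E_smult)
qed

lemma slot_linear_nc_sum:
  assumes "1 \<le> n"
  shows "W.slot_linear n (\<lambda>as. cs_sum (\<lambda>\<xi>. nc_ext A.Alg W.pair_cumulant \<xi> as) (NC n))"
  unfolding W.slot_linear_def
proof (intro allI impI)
  fix as p x y assume as: "length as = n \<and> set as \<subseteq> V \<and> p < n \<and> x \<in> V \<and> y \<in> V"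
  let ?N = "nc_ext A.Alg W.pair_cumulant"
  have sl: "W.slot_linear n (?N \<xi>)" if "\<xi> \<in> NC n" for \<xi>
    by (rule W.nc_ext_slot_linear[OF that assms W.Kvalid_pair_cumulant W.slot_linear_pair_cumulant])
  have "?N \<xi> (as[p := f_add x y]) = f_add (?N \<xi> (as[p := x])) (?N \<xi> (as[p := y]))"
    "?N \<xi> (as[p := f_smult a x]) = f_smult a (?N \<xi> (as[p := x]))" if "\<xi> \<in> NC n" for \<xi> a
    using sl[OF that] as unfolding W.slot_linear_def by blast+
  then show "cs_sum (\<lambda>\<xi>. ?N \<xi> (as[p := f_add x y])) (NC n)
      = f_add (cs_sum (\<lambda>\<xi>. ?N \<xi> (as[p := x])) (NC n)) (cs_sum (\<lambda>\<xi>. ?N \<xi> (as[p := y])) (NC n)) \<and>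
    (\<forall>a. cs_sum (\<lambda>\<xi>. ?N \<xi> (as[p := f_smult a x])) (NC n) = f_smult a (cs_sum (\<lambda>\<xi>. ?N \<xi> (as[p := x])) (NC n)))"
    by (simp add: cs_sum_def f_add_def f_smult_def fun_eq_iff sum.distrib sum_distrib_left)
qed

text \<open>Induction on the support, cast in the shape of the spanning hypothesis of
  \<open>slot_linear_eqI\<close>.\<close>

lemma V_span:
  assumes x: "x \<in> V" and D: "\<And>d. d \<in> el ` basis \<Longrightarrow> Q d" and Z: "Q (\<lambda>_. 0)"
    and add: "\<And>x a d. x \<in> V \<Longrightarrow> d \<in> el ` basis \<Longrightarrow> Q x \<Longrightarrow> Q (f_add (f_smult a d) x)"
  shows "Q x"
proof -
  have "finite (supp x)" using x by (simp add: V_def finsupp_def)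
  then show ?thesis using x
  proof (induction "supp x" arbitrary: x rule: finite_induct)
    case empty
    then have "x = (\<lambda>_. 0)" by (auto simp: supp_def)
    then show ?case using Z by simp
  next
    case (insert m F)
    define x' where "x' = x(m := 0)"
    have supp': "supp x' = F" using insert.hyps(2,4) by (auto simp: x'_def supp_def)
    have m: "m \<in> supp x" using insert.hyps(4) by blast
    have "x' \<in> V" using insert.prems insert.hyps(1,4) supp' by (auto simp: V_def finsupp_def)
    then have Qx': "Q x'" using insert.hyps(3) supp' by blast
    have mG: "m \<in> G" "length (fst (dec m)) = 1" using insert.prems m by (auto simp: V_def finsupp_def)
    then obtain y h where yh: "dec m = ([y], h)" by (cases "dec m") (auto simp: length_Suc_conv)
    then have "([y], h) \<in> elements k" "m = enc ([y], h)" using dec_G[OF mG(1)] by simp_all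
    then have "delta m = el (1, y, h)" "(1, y, h) \<in> basis"
      by (simp_all add: el_def f_smult_def basis_def elements_def)
    then have "Q (f_add (f_smult (x m) (delta m)) x')" using add[OF \<open>x' \<in> V\<close> _ Qx'] by blast
    moreover have "f_add (f_smult (x m) (delta m)) x' = x"
      by (auto simp: f_add_def f_smult_def delta_def x'_def fun_eq_iff)
    ultimately show ?case by simp
  qed
qed

theorem moments_V:
  assumes "1 \<le> length as" "set as \<subseteq> V"
  shows "A.E (a_prod A.Alg as) = cs_sum (\<lambda>\<xi>. nc_ext A.Alg W.pair_cumulant \<xi> as) (NC (length as))"
proof (rule W.slot_linear_eqI[OF slot_linear_moments slot_linear_nc_sum[OF assms(1)], where D="el ` basis"])
  show "el ` basis \<subseteq> V" using el_V by blast
  show "Q x" if "x \<in> V" "\<And>d. d \<in> el ` basis \<Longrightarrow> Q d" "Q (\<lambda>_. 0)"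
    "\<And>x a d. x \<in> V \<Longrightarrow> d \<in> el ` basis \<Longrightarrow> Q x \<Longrightarrow> Q (f_add (f_smult a d) x)" for Q x
    by (rule V_span[of x Q, OF that])
  fix bs assume bs: "length bs = length as" "set bs \<subseteq> el ` basis"
  define zs where "zs = map (inv_into basis el) bs"
  have "el (inv_into basis el b) = b \<and> inv_into basis el b \<in> basis" if "b \<in> set bs" for b
    using bs(2) that by (simp add: f_inv_into_f inv_into_into subset_iff)
  then have zs: "bs = map el zs" "set zs \<subseteq> basis"
    by (auto simp: zs_def map_idI)
  then show "A.E (a_prod A.Alg bs) = cs_sum (\<lambda>\<xi>. nc_ext A.Alg W.pair_cumulant \<xi> bs) (NC (length as))"
    using moments_el[OF zs(2)] bs(1) assms(1) by simp
qed (use assms in auto)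

subsection \<open>The limiting family\<close>

definition m_fam :: "perm \<Rightarrow> nat list \<Rightarrow> complex" where
  "m_fam \<sigma> = delta (enc ([(False, \<sigma>)], id))"

definition pw_letter :: "bool \<Rightarrow> perm \<Rightarrow> letter" where
  "pw_letter b \<sigma> = (b, if b then tau k \<circ> \<sigma> else \<sigma>)"

lemma pw_letter_basis: "\<sigma> \<in> Sym (2*k) \<Longrightarrow> \<eta> \<in> Sym k \<Longrightarrow> (s, pw_letter b \<sigma>, \<eta>) \<in> basis"
  by (simp add: basis_def pw_letter_def)

lemma a_pw_m_fam:
  assumes "\<sigma> \<in> Sym (2*k)"
  shows "a_pw A.Alg b (m_fam \<sigma>) = el (1, pw_letter b \<sigma>, id)"
proof -
  have el: "([(False, \<sigma>)], id) \<in> elements k" using assms by (simp add: elements_def)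
  have "A.f_star (m_fam \<sigma>) = delta (enc ([(True, tau k \<circ> \<sigma>)], id))"
    unfolding m_fam_def using el by (simp add: A.star_delta star_def e_star_def lstar_def)
  then show ?thesis by (simp add: a_pw_def el_def f_smult_def pw_letter_def m_fam_def)
qed

lemma a_pw_m_fam_u:
  assumes "\<sigma> \<in> Sym (2*k)" "\<eta> \<in> Sym k"
  shows "A.f_mul (a_pw A.Alg b (m_fam \<sigma>)) (A.emb (cs_u \<eta>)) = el (1, pw_letter b \<sigma>, \<eta>)"
proof -
  have "f_smult 1 (cs_u \<eta>) = cs_u \<eta>" by (simp add: f_smult_def)
  then show ?thesis
    using el_ract[OF pw_letter_basis[OF assms(1) Sym_id, of 1 b] assms(2), of 1]
    by (simp add: a_pw_m_fam[OF assms(1)] ract_el_def)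
qed

text \<open>The factors \<open>b l\<close> are arbitrary in the group algebra, so the arguments lie
  in \<open>V\<close> without being basis elements. There every admissible family of cumulants
  agrees with \<open>pair_cumulant\<close>, which is zero from order three on.\<close>

lemma circular: "Sk_circular k A.Alg A.E (Sym (2*k)) m_fam"
  unfolding Sk_circular_def
proof (intro conjI allI impI)
  show "\<exists>K. is_Sk_cumulants A.Alg A.E K" using A.is_Sk_cumulants_cumulant by blast
  fix K L js eps b
  assume K: "is_Sk_cumulants A.Alg A.E K" and L: "3 \<le> (L::nat)" and jb: "\<forall>l<L. js l \<in> Sym (2*k) \<and> b l \<in> CSk k"
  let ?as = "map (\<lambda>l. a_mul A.Alg (a_pw A.Alg (eps l) (m_fam (js l))) (a_emb A.Alg (b l))) [0..<L]"
  have "set ?as \<subseteq> V"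
  proof
    fix x assume "x \<in> set ?as"
    then obtain l where l: "l < L" "x = A.f_mul (a_pw A.Alg (eps l) (m_fam (js l))) (A.emb (b l))" by auto
    have "a_pw A.Alg (eps l) (m_fam (js l)) \<in> V"
      using a_pw_m_fam el_V pw_letter_basis jb l(1) by simp
    then show "x \<in> V" unfolding l(2) using jb l(1) by (intro W.V_right) (simp_all add: CSk_eq_finsupp)
  qed
  moreover have len: "length ?as = L" by simp
  ultimately have "K L ?as = W.pair_cumulant L ?as"
    using W.cumulants_eq_pair_cumulant[OF K moments_V, of ?as] L by simp
  then show "K L ?as = cs_zero" using L by (simp add: W.pair_cumulant_def cs_zero_def)
qed

text \<open>A single point admits only the one-block partition, and \<open>pair_cumulant\<close>
  vanishes at order one.\<close>

lemma centered: "Sk_centered A.Alg A.E (Sym (2*k)) m_fam"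
  unfolding Sk_centered_def
proof
  fix \<sigma> assume s: "\<sigma> \<in> Sym (2*k)"
  have m: "m_fam \<sigma> \<in> V" using a_pw_m_fam[OF s, of False] el_V pw_letter_basis[OF s Sym_id] by (simp add: a_pw_def)
  have nc: "NC 1 = {{{1..1}}}"
  proof -
    have "\<xi> = {{1..1}}" if "\<xi> \<in> NC 1" for \<xi>
    proof -
      have p: "partition_on {1..1} \<xi>" using that by (simp add: NC_iff)
      obtain B where B: "B \<in> \<xi>" "1 \<in> B" using partition_block_exists[OF p, of 1] by auto
      then have "B = {1..1}" using partition_block_subset[OF p B(1)] by auto
      then show ?thesis using partition_whole_block[OF p] B(1) by simp
    qed
    moreover have "{{1..1}} \<in> NC 1" by (rule NC_top) simp
    ultimately show ?thesis by blast
  qed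
  have "A.E (m_fam \<sigma>) = A.E (a_prod A.Alg [m_fam \<sigma>])" using m by (simp add: a_prod_def)
  also have "\<dots> = cs_sum (\<lambda>\<xi>. nc_ext A.Alg W.pair_cumulant \<xi> [m_fam \<sigma>]) (NC 1)"
    using moments_V[of "[m_fam \<sigma>]"] m by simp
  also have "\<dots> = nc_ext A.Alg W.pair_cumulant {{1..1}} [m_fam \<sigma>]" unfolding nc by (simp add: cs_sum_def)
  also have "\<dots> = (\<lambda>_. 0)" using nc_ext_top[of "[m_fam \<sigma>]" A.Alg W.pair_cumulant] by (simp add: W.pair_cumulant_def)
  finally show "A.E (m_fam \<sigma>) = cs_zero" by (simp add: cs_zero_def)
qed

lemma case_valI:
  assumes x: "x = (\<lambda>\<rho>. if \<rho> \<in> Sym k \<and> cond \<rho> then d else 0)"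
    and uniq: "\<And>\<rho> \<rho>'. \<rho> \<in> Sym k \<Longrightarrow> \<rho>' \<in> Sym k \<Longrightarrow> cond \<rho> \<Longrightarrow> cond \<rho>' \<Longrightarrow> \<rho> = \<rho>'"
  shows "case_val k d cond x"
  unfolding case_val_def
proof (intro conjI ballI impI)
  fix \<eta>' assume "\<eta>' \<in> Sym k" "cond \<eta>'"
  then have "(\<rho> \<in> Sym k \<and> cond \<rho>) \<longleftrightarrow> \<rho> = \<eta>'" for \<rho> using uniq by blast
  then show "x = cs_smult d (cs_u \<eta>')" unfolding x by (auto simp: cs_smult_def cs_u_def)
next
  assume "\<not> (\<exists>\<eta>'\<in>Sym k. cond \<eta>')"
  then have "\<not> (\<rho> \<in> Sym k \<and> cond \<rho>)" for \<rho> by blast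
  then show "x = cs_zero" unfolding x cs_zero_def by (simp only: if_False)
qed

lemma E_m_pair:
  assumes "\<sigma> \<in> Sym (2*k)" "\<sigma>' \<in> Sym (2*k)" "\<eta> \<in> Sym k"
    and eq: "\<And>\<rho>. \<rho> \<in> Sym k \<Longrightarrow> snd (absorb (1, pw_letter b \<sigma>, \<eta>)) = tau k \<circ> djs k id \<rho> \<circ> snd (pw_letter b' \<sigma>') \<longleftrightarrow> cond \<rho>"
  shows "case_val k (cov b b') cond
    (A.E (A.f_mul (A.f_mul (a_pw A.Alg b (m_fam \<sigma>)) (A.emb (cs_u \<eta>))) (a_pw A.Alg b' (m_fam \<sigma>'))))"
proof (rule case_valI)
  have ab: "absorb (1, pw_letter b' \<sigma>', id) = pw_letter b' \<sigma>'" by (simp add: absorb_def)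
  have f: "fst (absorb (1, pw_letter b \<sigma>, \<eta>)) = b" "fst (pw_letter b' \<sigma>') = b'" by (simp_all add: absorb_def pw_letter_def)
  show "A.E (A.f_mul (A.f_mul (a_pw A.Alg b (m_fam \<sigma>)) (A.emb (cs_u \<eta>))) (a_pw A.Alg b' (m_fam \<sigma>')))
      = (\<lambda>\<rho>. if \<rho> \<in> Sym k \<and> cond \<rho> then cov b b' else 0)"
    unfolding a_pw_m_fam_u[OF assms(1,3)] a_pw_m_fam[OF assms(2)]
      E_pair[OF pw_letter_basis[OF assms(1,3)] pw_letter_basis[OF assms(2) Sym_id]] ab f
    using eq by (auto simp: fun_eq_iff)
  fix \<rho> \<rho>' assume r: "\<rho> \<in> Sym k" "\<rho>' \<in> Sym k" "cond \<rho>" "cond \<rho>'"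
  have "snd (pw_letter b' \<sigma>') \<in> Sym (2*k)" using assms(2) by (simp add: pw_letter_def)
  then show "\<rho> = \<rho>'" using compatible_unique[OF r(1,2)] eq[OF r(1)] eq[OF r(2)] r(3,4) by simp
qed

lemma comp_move:
  assumes "p \<circ> q = id" "q \<circ> p = id"
  shows "p \<circ> x = y \<longleftrightarrow> x = q \<circ> y"
  using assms by (metis comp_id fun.map_id id_comp o_assoc)

lemma djs_inverse:
  assumes "\<eta> \<in> Sym k"
  shows "djs k id (inv \<eta>) \<circ> djs k id \<eta> = id" "djs k id \<eta> \<circ> djs k id (inv \<eta>) = id"
    "djs k (inv \<eta>) id \<circ> djs k \<eta> id = id" "djs k \<eta> id \<circ> djs k (inv \<eta>) id = id"
  using assms by (simp_all add: djs_comp Sym_inv_comp[OF assms])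

text \<open>Each case solves the compatibility equation for \<open>\<sigma>\<close>. The factor
  \<open>u_\<eta>\<close> is absorbed as \<open>djs k id (inv \<eta>)\<close> into the first letter,
  an adjoint contributes \<open>tau\<close>, and moving \<open>tau\<close> across \<open>djs\<close>
  swaps its two halves; this is why the known and the unknown permutation change places between the
  first two formulas.\<close>

lemma covariances:
  assumes s: "\<sigma> \<in> Sym (2*k)" "\<sigma>' \<in> Sym (2*k)" "\<eta> \<in> Sym k"
  shows "case_val k (of_real c) (\<lambda>\<eta>'. \<sigma> = djs k \<eta>' \<eta> \<circ> \<sigma>')
      (A.E (A.f_mul (A.f_mul (m_fam \<sigma>) (A.emb (cs_u \<eta>))) (A.f_star (m_fam \<sigma>'))))"
    and "case_val k (of_real c) (\<lambda>\<eta>'. \<sigma> = djs k \<eta> \<eta>' \<circ> \<sigma>')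
      (A.E (A.f_mul (A.f_mul (A.f_star (m_fam \<sigma>)) (A.emb (cs_u \<eta>))) (m_fam \<sigma>')))"
    and "case_val k c' (\<lambda>\<eta>'. \<sigma> = tau k \<circ> djs k \<eta> \<eta>' \<circ> \<sigma>')
      (A.E (A.f_mul (A.f_mul (m_fam \<sigma>) (A.emb (cs_u \<eta>))) (m_fam \<sigma>')))"
proof -
  have ab: "snd (absorb (1, pw_letter b \<sigma>, \<eta>)) = djs k id (inv \<eta>) \<circ> snd (pw_letter b \<sigma>)" for b
    by (simp add: absorb_def)
  have pw: "a_pw A.Alg False x = x" "a_pw A.Alg True x = A.f_star x" for x by (simp_all add: a_pw_def)
  note move = comp_move[OF djs_inverse(1,2)[OF s(3)]] comp_move[OF tau_comp_tau tau_comp_tau]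
  have "djs k id (inv \<eta>) \<circ> \<sigma> = tau k \<circ> djs k id \<rho> \<circ> (tau k \<circ> \<sigma>') \<longleftrightarrow> \<sigma> = djs k \<rho> \<eta> \<circ> \<sigma>'"
    if \<rho>: "\<rho> \<in> Sym k" for \<rho>
  proof -
    have "tau k \<circ> djs k id \<rho> \<circ> (tau k \<circ> \<sigma>') = djs k \<rho> id \<circ> (tau k \<circ> tau k) \<circ> \<sigma>'"
      using tau_djs[OF Sym_id \<rho>] by (simp add: o_assoc)
    then have e: "tau k \<circ> djs k id \<rho> \<circ> (tau k \<circ> \<sigma>') = djs k \<rho> id \<circ> \<sigma>'" by (simp add: tau_comp_tau)
    show ?thesis unfolding e move(1) using djs_comp[OF Sym_id s(3) \<rho> Sym_id] by (simp add: o_assoc)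
  qed
  then show "case_val k (of_real c) (\<lambda>\<eta>'. \<sigma> = djs k \<eta>' \<eta> \<circ> \<sigma>')
      (A.E (A.f_mul (A.f_mul (m_fam \<sigma>) (A.emb (cs_u \<eta>))) (A.f_star (m_fam \<sigma>'))))"
    using E_m_pair[OF s, of False True "\<lambda>\<eta>'. \<sigma> = djs k \<eta>' \<eta> \<circ> \<sigma>'"] unfolding ab pw by (simp add: cov_def pw_letter_def)
  have "djs k id (inv \<eta>) \<circ> (tau k \<circ> \<sigma>) = tau k \<circ> djs k id \<rho> \<circ> \<sigma>' \<longleftrightarrow> \<sigma> = djs k \<eta> \<rho> \<circ> \<sigma>'"
    if \<rho>: "\<rho> \<in> Sym k" for \<rho>
  proof -
    have "djs k id (inv \<eta>) \<circ> (tau k \<circ> \<sigma>) = tau k \<circ> (djs k (inv \<eta>) id \<circ> \<sigma>)"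
      using tau_djs[OF Sym_inv[OF s(3)] Sym_id] by (simp add: o_assoc)
    then have "djs k id (inv \<eta>) \<circ> (tau k \<circ> \<sigma>) = tau k \<circ> djs k id \<rho> \<circ> \<sigma>'
        \<longleftrightarrow> djs k (inv \<eta>) id \<circ> \<sigma> = tau k \<circ> (tau k \<circ> (djs k id \<rho> \<circ> \<sigma>'))"
      by (simp only: move(2) o_assoc[symmetric])
    also have "\<dots> \<longleftrightarrow> djs k (inv \<eta>) id \<circ> \<sigma> = djs k id \<rho> \<circ> \<sigma>'" by (simp add: o_assoc tau_comp_tau)
    also have "\<dots> \<longleftrightarrow> \<sigma> = djs k \<eta> id \<circ> (djs k id \<rho> \<circ> \<sigma>')" by (rule comp_move[OF djs_inverse(3,4)[OF s(3)]])
    finally show ?thesis using djs_comp[OF s(3) Sym_id Sym_id \<rho>] by (simp add: o_assoc)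
  qed
  then show "case_val k (of_real c) (\<lambda>\<eta>'. \<sigma> = djs k \<eta> \<eta>' \<circ> \<sigma>')
      (A.E (A.f_mul (A.f_mul (A.f_star (m_fam \<sigma>)) (A.emb (cs_u \<eta>))) (m_fam \<sigma>')))"
    using E_m_pair[OF s, of True False "\<lambda>\<eta>'. \<sigma> = djs k \<eta> \<eta>' \<circ> \<sigma>'"] unfolding ab pw by (simp add: cov_def pw_letter_def)
  have "djs k id (inv \<eta>) \<circ> \<sigma> = tau k \<circ> djs k id \<rho> \<circ> \<sigma>' \<longleftrightarrow> \<sigma> = tau k \<circ> djs k \<eta> \<rho> \<circ> \<sigma>'"
    if \<rho>: "\<rho> \<in> Sym k" for \<rho>
  proof -
    have "djs k id \<eta> \<circ> (tau k \<circ> djs k id \<rho> \<circ> \<sigma>') = tau k \<circ> (djs k \<eta> id \<circ> djs k id \<rho>) \<circ> \<sigma>'"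
      using tau_djs[OF s(3) Sym_id] by (simp add: o_assoc)
    then show ?thesis unfolding move(1) using djs_comp[OF s(3) Sym_id Sym_id \<rho>] by simp
  qed
  then show "case_val k c' (\<lambda>\<eta>'. \<sigma> = tau k \<circ> djs k \<eta> \<eta>' \<circ> \<sigma>')
      (A.E (A.f_mul (A.f_mul (m_fam \<sigma>) (A.emb (cs_u \<eta>))) (m_fam \<sigma>')))"
    using E_m_pair[OF s, of False False "\<lambda>\<eta>'. \<sigma> = tau k \<circ> djs k \<eta> \<eta>' \<circ> \<sigma>'"] unfolding ab pw by (simp add: cov_def pw_letter_def)
qed

subsection \<open>Convergence\<close>

lemma Umat_Jset:
  assumes "i \<in> Jset k N" "j \<in> Jset k N" "\<eta> \<in> Sym k"
  shows "Umat k \<eta> i j = (if j = i \<circ> \<eta> then 1 else 0)"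
proof -
  have "(\<forall>l\<in>{1..k}. i l = j (inv \<eta> l)) \<longleftrightarrow> i = j \<circ> inv \<eta>"
    using Jset_ext[OF assms(1) Jset_comp[OF assms(2) Sym_inv[OF assms(3)]]] by auto
  also have "\<dots> \<longleftrightarrow> j = i \<circ> \<eta>" using Sym_inv_comp[OF assms(3)] by (metis comp_id o_assoc)
  finally show ?thesis by (simp add: Umat_def)
qed

text \<open>Right multiplication by a permutation matrix permutes the column tuple, so a flattening
  or its adjoint followed by \<open>U_\<eta>\<close> is the matrix of one letter.\<close>

lemma letter_product:
  assumes s: "\<sigma> \<in> Sym (2*k)" "\<eta> \<in> Sym k" and ij: "i \<in> Jset k N" "j \<in> Jset k N"
  shows "mmul k N (m_pw b (flattening k \<sigma> T)) (Umat k \<eta>) i j = letter_mat k T (absorb (1, pw_letter b \<sigma>, \<eta>)) i j"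
proof -
  have "j = l \<circ> \<eta> \<longleftrightarrow> l = j \<circ> inv \<eta>" for l using Sym_inv_comp[OF s(2)] by (metis comp_id o_assoc)
  then have "mmul k N (m_pw b (flattening k \<sigma> T)) (Umat k \<eta>) i j
      = (\<Sum>l\<in>Jset k N. m_pw b (flattening k \<sigma> T) i l * (if l = j \<circ> inv \<eta> then 1 else 0))"
    unfolding mmul_def using ij s(2) by (intro sum.cong refl) (simp add: Umat_Jset)
  also have "\<dots> = m_pw b (flattening k \<sigma> T) i (j \<circ> inv \<eta>)" by (rule sum_Jset_delta(3)) (use ij s in simp)
  also have "\<dots> = letter_mat k T (pw_letter b \<sigma>) i (j \<circ> inv \<eta>)"
    using s(1) by (simp add: m_pw_def madj_def flattening_eq letter_mat_def pw_letter_def conj_if_def o_assoc cat_tau)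
  also have "\<dots> = letter_mat k T (absorb (1, pw_letter b \<sigma>, \<eta>)) i j"
    using s(2) by (simp add: absorb_def letter_mat_def o_assoc cat_djs)
  finally show ?thesis .
qed

lemma mprod_word:
  assumes "\<And>l i j. l \<in> set ls \<Longrightarrow> i \<in> Jset k N \<Longrightarrow> j \<in> Jset k N \<Longrightarrow> X l i j = letter_mat k T (y l) i j"
    and "i \<in> Jset k N" "j \<in> Jset k N"
  shows "mprod k N (map X ls) i j = word_mat k N T (map y ls) i j"
  using assms
proof (induction ls arbitrary: i)
  case Nil
  then show ?case by (simp add: mprod_def mid_def word_mat_Nil)
next
  case (Cons l ls)
  have "mprod k N (map X (l # ls)) i j = (\<Sum>m\<in>Jset k N. X l i m * mprod k N (map X ls) m j)"
    by (simp add: mprod_def mmul_def)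
  also have "\<dots> = (\<Sum>m\<in>Jset k N. letter_mat k T (y l) i m * word_mat k N T (map y ls) m j)"
    using Cons by (intro sum.cong) auto
  finally show ?case by (simp add: word_mat_Cons)
qed

text \<open>Coefficients with respect to the permutation matrices are unique as soon as a tuple with
  \<open>k\<close> distinct entries exists, so the definite description returns the traces used in
  \<open>EN\<close>.\<close>

lemma CSN_coeff_EN:
  assumes N: "k \<le> N" and \<eta>: "\<eta> \<in> Sym k"
  shows "CSN_coeff k N (EN k N Q X) \<eta> = PhiN k N Q (\<lambda>\<omega>. mmul k N (X \<omega>) (madj (Umat k \<eta>)))"
proof -
  define F where "F \<rho> = (if \<rho> \<in> Sym k then PhiN k N Q (\<lambda>\<omega>. mmul k N (X \<omega>) (madj (Umat k \<rho>))) else 0)" for \<rho>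
  have "CSN_coeff k N (EN k N Q X) = F" unfolding CSN_coeff_def
  proof (rule the_equality)
    show "F \<in> CSk k \<and> (\<forall>i\<in>Jset k N. \<forall>j\<in>Jset k N. EN k N Q X i j = (\<Sum>\<eta>\<in>Sym k. F \<eta> * Umat k \<eta> i j))"
      by (auto simp: CSk_def F_def EN_def)
    fix f assume f: "f \<in> CSk k \<and> (\<forall>i\<in>Jset k N. \<forall>j\<in>Jset k N. EN k N Q X i j = (\<Sum>\<eta>\<in>Sym k. f \<eta> * Umat k \<eta> i j))"
    show "f = F"
    proof
      fix \<rho>
      show "f \<rho> = F \<rho>"
      proof (cases "\<rho> \<in> Sym k")
        case False
        then show ?thesis using f by (auto simp: CSk_def F_def)
      next
        case True
        \<comment> \<open>The tuple (1, ..., k). Its rearrangements are pairwise different, so row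
          \<open>i0\<close> of the permutation matrices separates the permutations.\<close>
        define i0 :: idx where "i0 = restrict id {1..k}"
        have i0: "i0 \<in> Jset k N" using N by (auto simp: i0_def Jset_def)
        have inj: "i0 \<circ> \<rho> = i0 \<circ> \<rho>' \<longleftrightarrow> \<rho>' = \<rho>" if "\<rho>' \<in> Sym k" for \<rho>'
        proof
          assume e: "i0 \<circ> \<rho> = i0 \<circ> \<rho>'"
          show "\<rho>' = \<rho>"
          proof
            fix q
            show "\<rho>' q = \<rho> q"
            proof (cases "q \<in> {1..k}")
              case q: True
              then have "\<rho> q \<in> {1..k}" "\<rho>' q \<in> {1..k}" using Sym_in[OF True] Sym_in[OF that] by blast+
              then show ?thesis using fun_cong[OF e, of q] by (simp add: i0_def)
            next
              case False
              then show ?thesis using Sym_outside[OF True False] Sym_outside[OF that False] by simp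
            qed
          qed
        qed simp
        have pick: "(\<Sum>\<rho>'\<in>Sym k. h \<rho>' * Umat k \<rho>' i0 (i0 \<circ> \<rho>)) = h \<rho>" for h
        proof -
          have "(\<Sum>\<rho>'\<in>Sym k. h \<rho>' * Umat k \<rho>' i0 (i0 \<circ> \<rho>)) = (\<Sum>\<rho>'\<in>Sym k. if \<rho>' = \<rho> then h \<rho>' else 0)"
            using i0 True by (intro sum.cong refl) (simp add: Umat_Jset inj)
          then show ?thesis using True by simp
        qed
        have "(\<Sum>\<rho>'\<in>Sym k. f \<rho>' * Umat k \<rho>' i0 (i0 \<circ> \<rho>)) = (\<Sum>\<rho>'\<in>Sym k. F \<rho>' * Umat k \<rho>' i0 (i0 \<circ> \<rho>))"
          using f i0 True by (simp add: EN_def F_def)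
        then show ?thesis by (simp only: pick)
      qed
    qed
  qed
  then show ?thesis using \<eta> by (simp add: F_def)
qed

text \<open>For \<open>N \<ge> k\<close> the coefficient at \<open>\<eta>\<close> equals
  \<open>phiN'\<close> of the word of absorbed letters, without error term, so the convergence is
  the one that defines \<open>phi\<close>.\<close>

lemma convergence: "conv_Sk_distr k P (\<lambda>\<sigma> N \<omega>. flattening k \<sigma> (M N \<omega>)) (Sym (2*k)) A.Alg A.E m_fam"
  unfolding conv_Sk_distr_def conv_CS_def
proof (intro allI impI ballI)
  fix L :: nat and js eps eta \<eta>
  assume "1 \<le> L" and je: "\<forall>l<L. js l \<in> Sym (2*k) \<and> eta l \<in> Sym k" and \<eta>: "\<eta> \<in> Sym k"
  define z where "z l = (1 :: complex, pw_letter (eps l) (js l), eta l)" for l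
  define zs where "zs = map z [0..<L]"
  have zs: "set zs \<subseteq> basis" using je pw_letter_basis by (auto simp: zs_def z_def)
  let ?X = "\<lambda>N \<omega>. mprod k N (map (\<lambda>l. mmul k N (m_pw (eps l) (flattening k (js l) (M N \<omega>))) (Umat k (eta l))) [0..<L])"
  let ?as = "map (\<lambda>l. a_mul A.Alg (a_pw A.Alg (eps l) (m_fam (js l))) (a_emb A.Alg (cs_u (eta l)))) [0..<L]"
  have as: "?as = map el zs" using je by (simp add: zs_def z_def a_pw_m_fam_u)
  have "scal zs = 1" by (simp add: scal_def zs_def z_def o_def map_replicate_const prod_list_replicate)
  then have lim: "A.E (a_prod A.Alg ?as) \<eta> = phi (map absorb zs, inv \<eta>)"
    unfolding as using E_a_prod[OF zs \<eta>] by simp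
  have "CSN_coeff k N (EN k N (P N) (?X N)) \<eta> = phiN' N (map absorb zs, inv \<eta>)" if N: "k \<le> N" for N
  proof -
    have "mtr k N (mmul k N (?X N \<omega>) (madj (Umat k \<eta>))) = tr_elem N (map absorb zs, inv \<eta>) \<omega>" for \<omega>
      unfolding mtr_def tr_elem_def
    proof (rule sum.cong[OF refl])
      fix i assume i: "i \<in> Jset k N"
      have "mmul k N (?X N \<omega>) (madj (Umat k \<eta>)) i i = (\<Sum>l\<in>Jset k N. ?X N \<omega> i l * (if l = i \<circ> \<eta> then 1 else 0))"
        unfolding mmul_def madj_def using i \<eta> by (intro sum.cong refl) (simp add: Umat_Jset)
      also have "\<dots> = ?X N \<omega> i (i \<circ> \<eta>)" by (rule sum_Jset_delta(3)) (use i \<eta> in simp)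
      also have "\<dots> = word_mat k N (M N \<omega>) (map (\<lambda>l. absorb (z l)) [0..<L]) i (i \<circ> \<eta>)"
        by (rule mprod_word) (use je i \<eta> letter_product in \<open>auto simp: z_def\<close>)
      finally show "mmul k N (?X N \<omega>) (madj (Umat k \<eta>)) i i = elem_mat k N (M N \<omega>) (map absorb zs, inv \<eta>) i i"
        using \<eta> by (simp add: elem_mat_def zs_def o_def)
    qed
    then show ?thesis unfolding CSN_coeff_EN[OF N \<eta>] by (simp add: PhiN_def phiN'_def)
  qed
  then have "eventually (\<lambda>N. phiN' N (map absorb zs, inv \<eta>) = CSN_coeff k N (EN k N (P N) (?X N)) \<eta>) sequentially"
    by (intro eventually_sequentiallyI[of k]) simp
  then show "(\<lambda>N. CSN_coeff k N (EN k N (P N) (?X N)) \<eta>) \<longlonglongrightarrow> A.E (a_prod A.Alg ?as) \<eta>"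
    unfolding lim by (rule Lim_transform_eventually[OF phiN'_phi[OF absorb_elements[OF zs Sym_inv[OF \<eta>]]]])
qed

lemma m_fam_carrier: "\<sigma> \<in> Sym (2*k) \<Longrightarrow> m_fam \<sigma> \<in> A.FS"
  by (simp add: m_fam_def elements_def)

end

theorem mainTheorem1:
  fixes k :: nat and P :: "nat \<Rightarrow> 'w measure" and M :: "nat \<Rightarrow> 'w \<Rightarrow> idx \<Rightarrow> complex"
    and c :: real and c' :: complex
  assumes "k \<ge> 1" and "Hyp_H k P M c c'"
  shows "\<exists>(A :: (nat list \<Rightarrow> complex) salg) E m.
     Sk_prob_space k A E \<and> (\<forall>\<sigma>\<in>Sym (2*k). m \<sigma> \<in> a_carrier A) \<and>
     conv_Sk_distr k P (\<lambda>\<sigma> N \<omega>. flattening k \<sigma> (M N \<omega>)) (Sym (2*k)) A E m \<and>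
     Sk_centered A E (Sym (2*k)) m \<and> Sk_circular k A E (Sym (2*k)) m \<and>
     (\<forall>\<sigma>\<in>Sym (2*k). \<forall>\<sigma>'\<in>Sym (2*k). \<forall>\<eta>\<in>Sym k.
        case_val k (complex_of_real c) (\<lambda>\<eta>'. \<sigma> = djs k \<eta>' \<eta> \<circ> \<sigma>')
          (E (a_mul A (a_mul A (m \<sigma>) (a_emb A (cs_u \<eta>))) (a_star A (m \<sigma>')))) \<and>
        case_val k (complex_of_real c) (\<lambda>\<eta>'. \<sigma> = djs k \<eta> \<eta>' \<circ> \<sigma>')
          (E (a_mul A (a_mul A (a_star A (m \<sigma>)) (a_emb A (cs_u \<eta>))) (m \<sigma>'))) \<and>
        case_val k c' (\<lambda>\<eta>'. \<sigma> = tau k \<circ> djs k \<eta> \<eta>' \<circ> \<sigma>')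
          (E (a_mul A (a_mul A (m \<sigma>) (a_emb A (cs_u \<eta>))) (m \<sigma>'))))"
proof -
  interpret random_tensor k P M c c' by unfold_locales (use assms in auto)
  show ?thesis
    by (intro exI[of _ A.Alg] exI[of _ A.E] exI[of _ m_fam] conjI ballI A.Sk_prob_space_Alg convergence
        centered circular; simp add: covariances m_fam_carrier)
qed

end
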